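(* Let $-1<\rho<1$, and let $\mathbf{M}_{n,\rho}$ be an $n\times n$ Rademacher elliptical random matrix with parameter $\rho$. Let $B>0$ and $K\ge 1$ be constants. Then, for all sufficiently large $n$ (depending only on $B$, $\rho$, and $K$), the probability that $\mathbf{M}_{n,\rho}$ has an eigenvalue that is an algebraic number of degree at most $K$ is bounded above by $n^{-B}$.
   Context: The degree of an algebraic number is the degree of its minimal polynomial over $\mathbb{Q}$. A Rademacher elliptical random matrix with parameter $\rho$ is the $n\times n$ matrix $\mathbf{M}_{n,\rho}=(x_{i,j})_{1\le i,j\le n}$ defined as follows: let $\{x_{i,j} : i\le j\}\cup\{\xi_{i,j} : i>j\}$ be a collection of independent random variables with $\mathbb{P}(x_{i,j}=1)=\mathbb{P}(x_{i,j}=-1)=1/2$ for $i\le j$, and, for $i>j$, $\xi_{i,j}=1$ with probability $(1+\rho)/2$ and $\xi_{i,j}=-1$ with probability $(1-\rho)/2$; then set $x_{i,j} := x_{j,i}\,\xi_{i,j}$ for $i>j$. *)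

theory Defs
  imports
    "HOL-Probability.Probability"
    "Jordan_Normal_Form.Char_Poly"
begin

definition is_min_poly_rat :: "rat poly \<Rightarrow> complex \<Rightarrow> bool" where
  "is_min_poly_rat p z \<longleftrightarrow>
     lead_coeff p = 1 \<and> poly (map_poly of_rat p) z = 0 \<and>
     (\<forall>q. q \<noteq> 0 \<longrightarrow> poly (map_poly of_rat q) z = 0 \<longrightarrow> degree p \<le> degree q)"

text \<open>Only meaningful for algebraic \<open>z\<close>, cf. \<open>ex1_min_poly_rat\<close> below.\<close>

definition min_poly_rat :: "complex \<Rightarrow> rat poly" where
  "min_poly_rat z = (THE p. is_min_poly_rat p z)"

definition alg_degree :: "complex \<Rightarrow> nat" where
  "alg_degree z = degree (min_poly_rat z)"

lemma ex1_min_poly_rat: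
  assumes "algebraic z"
  shows "\<exists>!p. is_min_poly_rat p z"
proof -
  define P where "P = (\<lambda>q :: rat poly. q \<noteq> 0 \<and> poly (map_poly of_rat q) z = 0)"
  have "\<exists>q. P q"
  proof -
    from assms obtain p where p: "\<And>i. coeff p i \<in> \<rat>" "p \<noteq> 0" "poly p z = 0"
      unfolding algebraic_altdef by blast
    define g where "g = (\<lambda>c :: complex. SOME r :: rat. c = of_rat r)"
    have g: "of_rat (g c) = c" if "c \<in> \<rat>" for c
      using someI_ex[of "\<lambda>r. c = of_rat r"] that unfolding g_def by (auto elim!: Rats_cases)
    have g0: "g 0 = 0" using g[of 0] by simp
    have "map_poly of_rat (map_poly g p) = p"
      by (rule poly_eqI) (simp add: coeff_map_poly g0 g p)
    with p have "P (map_poly g p)" unfolding P_def by auto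
    thus ?thesis ..
  qed
  then obtain q where q: "P q" "\<And>r. P r \<Longrightarrow> degree q \<le> degree r"
    using ex_has_least_nat[of P _ degree] by blast
  define p where "p = Polynomial.smult (inverse (lead_coeff q)) q"
  have "is_min_poly_rat p z"
    using q unfolding is_min_poly_rat_def p_def P_def
    by (auto simp: of_rat_hom.map_poly_hom_smult)
  moreover have "p1 = p2" if "is_min_poly_rat p1 z" "is_min_poly_rat p2 z" for p1 p2
  proof (rule ccontr)
    assume neq: "p1 \<noteq> p2"
    have nz: "p1 \<noteq> 0" "p2 \<noteq> 0" using that by (auto simp: is_min_poly_rat_def)
    hence deg: "degree p1 = degree p2"
      using that by (metis is_min_poly_rat_def le_antisym)
    have "map_poly of_rat (p1 - p2) = (map_poly of_rat p1 - map_poly of_rat p2 :: complex poly)"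
      by (rule poly_eqI) (simp add: coeff_map_poly of_rat_diff)
    hence "poly (map_poly of_rat (p1 - p2)) z = 0"
      using that by (simp add: is_min_poly_rat_def)
    hence "degree p1 \<le> degree (p1 - p2)"
      using that neq by (simp add: is_min_poly_rat_def)
    moreover have "coeff (p1 - p2) (degree p1) = 0"
      using that deg by (simp add: is_min_poly_rat_def)
    moreover have "degree (p1 - p2) \<le> degree p1"
      using deg by (simp add: degree_diff_le)
    ultimately show False
      using neq by (metis eq_iff_diff_eq_0 le_antisym leading_coeff_0_iff)
  qed
  ultimately show ?thesis by blast
qed

text \<open>
  The upper triangle (with the diagonal) of \<open>\<omega>\<close> holds the \<open>x\<^sub>i\<^sub>j\<close> with \<open>i \<le> j\<close>, its strict
  lower triangle the \<open>\<xi>\<^sub>i\<^sub>j\<close> with \<open>i > j\<close>. Indices start at 0.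
\<close>

definition elliptical_mat :: "nat \<Rightarrow> (nat \<times> nat \<Rightarrow> int) \<Rightarrow> int mat" where
  "elliptical_mat n \<omega> =
     mat n n (\<lambda>(i, j). if i \<le> j then \<omega> (i, j) else \<omega> (j, i) * \<omega> (i, j))"

text \<open>
  \<open>bernoulli_pmf\<close> clips its argument to the unit interval; for \<open>-1 < \<rho> < 1\<close> both parameters
  used below lie inside it (see \<open>pmf_sign_pmf\<close> for the resulting probabilities).
\<close>

definition sign_pmf :: "real \<Rightarrow> int pmf" where
  "sign_pmf p = map_pmf (\<lambda>b. if b then 1 else -1) (bernoulli_pmf p)"

definition elliptical_entry_pmf :: "real \<Rightarrow> nat \<times> nat \<Rightarrow> int pmf" where
  "elliptical_entry_pmf \<rho> = (\<lambda>(i, j). if i \<le> j then sign_pmf (1 / 2) else sign_pmf ((1 + \<rho>) / 2))"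

definition rademacher_elliptical :: "nat \<Rightarrow> real \<Rightarrow> int mat pmf" where
  "rademacher_elliptical n \<rho> =
     map_pmf (elliptical_mat n) (Pi_pmf ({..<n} \<times> {..<n}) 0 (elliptical_entry_pmf \<rho>))"

lemma pmf_sign_pmf:
  assumes "0 \<le> p" "p \<le> 1"
  shows "pmf (sign_pmf p) 1 = p" "pmf (sign_pmf p) (- 1) = 1 - p"
proof -
  have "(\<lambda>b. if b then 1 else - 1 :: int) -` {1} = {True}"
       "(\<lambda>b. if b then 1 else - 1 :: int) -` {- 1} = {False}"
    by (auto split: if_splits)
  thus "pmf (sign_pmf p) 1 = p" "pmf (sign_pmf p) (- 1) = 1 - p"
    using assms by (simp_all add: sign_pmf_def pmf_map measure_pmf_single)
qed

text \<open>
  The PMF above is the law of the random matrix built from an independent family on an arbitrary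
  probability space, so no generality is lost by working with the law.
\<close>

lemma (in prob_space) prob_rademacher_elliptical:
  fixes Z :: "nat \<times> nat \<Rightarrow> 'a \<Rightarrow> int"
  assumes \<rho>: "-1 < \<rho>" "\<rho> < 1"
    and indep: "indep_vars (\<lambda>_. count_space UNIV) Z ({..<n} \<times> {..<n})"
    and upper: "\<And>i j. i \<le> j \<Longrightarrow> j < n \<Longrightarrow>
      prob {w \<in> space M. Z (i, j) w = 1} = 1 / 2 \<and> prob {w \<in> space M. Z (i, j) w = -1} = 1 / 2"
    and lower: "\<And>i j. j < i \<Longrightarrow> i < n \<Longrightarrow>
      prob {w \<in> space M. Z (i, j) w = 1} = (1 + \<rho>) / 2 \<and>
      prob {w \<in> space M. Z (i, j) w = -1} = (1 - \<rho>) / 2"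
  shows "prob {w \<in> space M. elliptical_mat n (\<lambda>ij. Z ij w) \<in> S} =
         measure_pmf.prob (rademacher_elliptical n \<rho>) S"
proof -
  define I where "I = {..<n} \<times> {..<n}"
  define X where "X = (\<lambda>w ij. if ij \<in> I then Z ij w else 0)"
  define F where "F = PiE_dflt I (0 :: int) (\<lambda>_. {1, -1})"
  define L where "L = Pi_pmf I 0 (elliptical_entry_pmf \<rho>)"
  have finI: "finite I" by (simp add: I_def)
  have finF: "finite F" unfolding F_def using finI by (rule finite_PiE_dflt) auto
  have meas: "Z ij \<in> measurable M (count_space UNIV)" if "ij \<in> I" for ij
    using indep that unfolding indep_vars_def I_def by auto
  have ev1: "{w \<in> space M. Z ij w = c} \<in> events" if "ij \<in> I" for ij c
  proof -
    have "Z ij -` {c} \<inter> space M \<in> events" using meas[OF that] by (rule measurable_sets) auto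
    thus ?thesis by (simp add: vimage_def Int_def conj_commute)
  qed
  have entry: "prob {w \<in> space M. Z ij w = c} = pmf (elliptical_entry_pmf \<rho> ij) c"
    if "ij \<in> I" "c \<in> {1, -1}" for ij c
  proof -
    obtain i j where ij: "ij = (i, j)" by force
    show ?thesis
      using that upper[of i j] lower[of j i] \<rho>
      by (cases "i \<le> j") (auto simp: ij I_def elliptical_entry_pmf_def pmf_sign_pmf field_simps)
  qed
  have Xev: "{w \<in> space M. X w = f} \<in> events" for f
  proof (cases "\<forall>ij. ij \<notin> I \<longrightarrow> f ij = 0")
    case True
    have "{w \<in> space M. X w = f} = {w \<in> space M. \<forall>ij\<in>I. Z ij w = f ij}"
      using True by (auto simp: X_def fun_eq_iff)
    also have "\<dots> \<in> events" using finI ev1 by (intro sets.sets_Collect_finite_All) auto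
    finally show ?thesis .
  next
    case False
    hence empty: "{w \<in> space M. X w = f} = {}" by (auto simp: X_def fun_eq_iff)
    show ?thesis unfolding empty by (rule sets.empty_sets)
  qed
  have Xprob: "prob {w \<in> space M. X w = f} = pmf L f" if f: "f \<in> F" for f
  proof (cases "I = {}")
    case True
    hence "{w \<in> space M. X w = f} = space M" using f by (auto simp: X_def F_def PiE_dflt_def fun_eq_iff)
    moreover have "pmf L f = 1" using f True
      by (simp add: L_def F_def PiE_dflt_def pmf_return fun_eq_iff)
    ultimately show ?thesis by (simp add: prob_space)
  next
    case False
    have "{w \<in> space M. X w = f} = (\<Inter>ij\<in>I. Z ij -` {f ij} \<inter> space M)"
      using f False by (auto simp: X_def F_def PiE_dflt_def fun_eq_iff)
    also have "prob \<dots> = (\<Prod>ij\<in>I. prob (Z ij -` {f ij} \<inter> space M))"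
      using indep finI False by (intro indep_varsD_finite[of "\<lambda>_. count_space UNIV"]) (auto simp: I_def)
    also have "\<dots> = (\<Prod>ij\<in>I. pmf (elliptical_entry_pmf \<rho> ij) (f ij))"
    proof (rule prod.cong)
      fix ij assume ij: "ij \<in> I"
      have "Z ij -` {f ij} \<inter> space M = {w \<in> space M. Z ij w = f ij}" by auto
      moreover have "f ij \<in> {1, -1}" using f ij unfolding F_def PiE_dflt_def by blast
      ultimately show "prob (Z ij -` {f ij} \<inter> space M) = pmf (elliptical_entry_pmf \<rho> ij) (f ij)"
        using entry[OF ij] by presburger
    qed simp
    also have "\<dots> = pmf L f"
      using f finI unfolding L_def by (subst pmf_Pi') (auto simp: F_def PiE_dflt_def)
    finally show ?thesis .
  qed
  have setL: "set_pmf L \<subseteq> F"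
    unfolding L_def set_Pi_pmf[OF finI] F_def
    by (auto simp: PiE_dflt_def elliptical_entry_pmf_def sign_pmf_def split: if_splits prod.splits)
  have fin: "prob (\<Union>f\<in>G. {w \<in> space M. X w = f}) = measure_pmf.prob L G" if "G \<subseteq> F" for G
  proof -
    have "finite G" using that finF finite_subset by blast
    hence "prob (\<Union>f\<in>G. {w \<in> space M. X w = f}) = (\<Sum>f\<in>G. prob {w \<in> space M. X w = f})"
      using Xev by (intro finite_measure_finite_Union) (auto simp: disjoint_family_on_def)
    also have "\<dots> = (\<Sum>f\<in>G. pmf L f)" using that Xprob by (intro sum.cong) auto
    also have "\<dots> = measure_pmf.prob L G" using \<open>finite G\<close> by (simp add: measure_measure_pmf_finite)
    finally show ?thesis .
  qed
  have UN: "(\<Union>f\<in>G. {w \<in> space M. X w = f}) = {w \<in> space M. X w \<in> G}" for G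
    by auto
  have "measure_pmf.prob L F = 1"
    using setL by (auto simp: measure_pmf.prob_eq_1 AE_measure_pmf_iff)
  hence probF: "prob {w \<in> space M. X w \<in> F} = 1"
    using fin[of F] by (simp add: UN)
  define C where "C = PiE_dflt I (0 :: int) (\<lambda>_. UNIV)"
  have "countable C"
    unfolding C_def dflt_image_PiE[symmetric] using finI
    by (intro countable_image countable_PiE) auto
  have XC: "X w \<in> C" for w by (auto simp: C_def X_def PiE_dflt_def)
  have evG: "{w \<in> space M. X w \<in> G} \<in> events" for G
  proof -
    have "{w \<in> space M. X w \<in> G} = (\<Union>f\<in>G \<inter> C. {w \<in> space M. X w = f})" using XC by auto
    also have "\<dots> \<in> events"
      using \<open>countable C\<close> Xev by (intro sets.countable_UN') auto
    finally show ?thesis .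
  qed
  have AEF: "AE w in M. X w \<in> F"
    using probF evG by (subst (asm) prob_Collect_eq_1) auto
  define T where "T = {f. elliptical_mat n f \<in> S}"
  have "elliptical_mat n (\<lambda>ij. Z ij w) = elliptical_mat n (X w)" for w
    by (rule eq_matI) (auto simp: elliptical_mat_def X_def I_def)
  hence "prob {w \<in> space M. elliptical_mat n (\<lambda>ij. Z ij w) \<in> S} = prob {w \<in> space M. X w \<in> T}"
    by (simp add: T_def)
  also have "\<dots> = prob {w \<in> space M. X w \<in> T \<inter> F}"
    using AEF by (intro finite_measure_eq_AE evG) (auto elim: eventually_mono)
  also have "\<dots> = measure_pmf.prob L (T \<inter> F)"
    using fin[of "T \<inter> F"] by (simp add: UN)
  also have "\<dots> = measure_pmf.prob L T"
    using setL by (intro measure_pmf.finite_measure_eq_AE) (auto simp: AE_measure_pmf_iff)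
  also have "\<dots> = measure_pmf.prob (rademacher_elliptical n \<rho>) S"
    by (simp add: rademacher_elliptical_def L_def I_def T_def vimage_def)
  finally show ?thesis .
qed

end

theory Submission
  imports
    Defs
    "HOL-Library.Poly_Mapping"
    "HOL-Library.Function_Algebras"
    "HOL-Real_Asymp.Real_Asymp"
    "Berlekamp_Zassenhaus.Factor_Bound"
begin

text \<open>
  An algebraic eigenvalue of degree at most \<open>K\<close> is an algebraic integer all of whose conjugates are
  eigenvalues, hence at most \<open>n\<close> in modulus; there are only polynomially many such numbers \<open>z\<close>. It
  therefore suffices that, for each fixed \<open>z\<close> and every \<open>B\<close>, the matrix \<open>M - z\<close> is singular with
  probability at most \<open>n powr (- B)\<close>.

  Given all other rows, the entries of a row of \<open>M\<close> are independent signs, each value having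
  probability at least \<open>(1 - \<bar>\<rho>\<bar>) / 2\<close>. Let \<open>f v\<close> be the probability that a vector with independent
  lazy entries in \<open>{-1, 0, 1}\<close> is orthogonal to \<open>v\<close>. The inner product of a row with \<open>v\<close> takes any
  given value with probability at most \<open>f v\<close>, and even at most \<open>f v / 16\<close> when the lazy entries are
  rarely nonzero, \<open>v\<close> is not sparse and \<open>f v\<close> is not too small.

  Null vectors \<open>v\<close> of \<open>M - z\<close> are treated in three cases. If \<open>f v\<close> is small, some row is a
  combination of the others, which then determine a vector it must annihilate. If \<open>v\<close> is sparse, it
  is determined by few rows. Otherwise half of the rows are exchanged for lazy vectors orthogonal
  to \<open>v\<close>, which gains a factor \<open>16\<close> for each of them, against at most \<open>2 ^ n\<close> choices of the rows.

  Everything takes place in characteristic zero and without Fourier analysis: positivity of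
  characteristic functions is replaced by the Cauchy-Schwarz inequality in the group ring.
\<close>

subsection \<open>Convolution in the group ring\<close>

text \<open>The obstacle is that the rows are dependent: given the others, a row has biases read off
  those others. So every small ball bound is uniform in the sign laws \<open>q\<close> and in the
  target value \<open>a\<close>, and every vector it is applied to is picked, by
  \<open>SOME\<close>, from a property of the remaining rows only; rewriting the row under study
  then leaves the vector unchanged.

  The gain of a constant factor rests on characteristic zero: a finite set \<open>T\<close> has a
  sumset of at least \<open>2 * card T - 1\<close> elements, so an even law with peak at most
  \<open>1 / 2\<close> at \<open>0\<close> loses there under threefold convolution. One step gains
  only \<open>255 / 256\<close>; \<open>m\<close> steps bring the factor below
  \<open>1 / 32\<close>, and absorbing the additive error for sparse vectors doubles it to at most
  \<open>1 / 16\<close>. Exchanging half of the rows thus gains about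
  \<open>16 ^ (n / 2) = 4 ^ n\<close> against \<open>2 ^ n\<close>.

  Only superpolynomial decay is wanted, so the thresholds can be crude: a small \<open>f v\<close>
  lies below a fixed power of \<open>n\<close>, and a sparse vector has at most
  \<open>sqrt n\<close> nonzero coordinates.\<close>

text \<open>
  A finitely supported law on an abelian group is viewed as an element of the group ring; the law of
  a sum of independent variables is the product, and \<open>cf p 0\<close> the probability of the value \<open>0\<close>.
\<close>

abbreviation cf :: "('a \<Rightarrow>\<^sub>0 'b::zero) \<Rightarrow> 'a \<Rightarrow> 'b" where
  "cf \<equiv> Poly_Mapping.lookup"

abbreviation sg :: "'a \<Rightarrow> 'b \<Rightarrow> ('a \<Rightarrow>\<^sub>0 'b::zero)" where
  "sg \<equiv> Poly_Mapping.single"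

abbreviation ks :: "('a \<Rightarrow>\<^sub>0 'b::zero) \<Rightarrow> 'a set" where
  "ks \<equiv> Poly_Mapping.keys"

text \<open>\<open>A\<close> may exceed the support, so that one index set can serve several
  functions or be closed under a reflection.\<close>

lemma cf_times:
  fixes p q :: "'a::ab_group_add \<Rightarrow>\<^sub>0 real"
  assumes "finite A" "ks p \<subseteq> A"
  shows "cf (p * q) z = (\<Sum>x\<in>A. cf p x * cf q (z - x))"
proof -
  have *: "(\<Sum>y. cf q y when z = x + y) = cf q (z - x)" for x
  proof -
    have "(\<Sum>y. cf q y when z = x + y) = (\<Sum>y. cf q y when z - x = y)"
      by (intro Sum_any.cong arg_cong[where f = "\<lambda>b. cf q _ when b"]) (auto simp: algebra_simps)
    thus ?thesis by (simp only: Sum_any_when_equal')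
  qed
  show ?thesis
    unfolding lookup_mult * using assms
    by (intro Sum_any.expand_superset) (auto simp: in_keys_iff subset_iff)
qed

definition cf_nonneg :: "('a \<Rightarrow>\<^sub>0 real) \<Rightarrow> bool" where
  "cf_nonneg p \<longleftrightarrow> (\<forall>x. 0 \<le> cf p x)"

definition cf_even :: "('a::ab_group_add \<Rightarrow>\<^sub>0 real) \<Rightarrow> bool" where
  "cf_even p \<longleftrightarrow> (\<forall>x. cf p (- x) = cf p x)"

definition mass :: "('a \<Rightarrow>\<^sub>0 real) \<Rightarrow> real" where
  "mass p = (\<Sum>x\<in>ks p. cf p x)"

lemma mass_superset: "finite A \<Longrightarrow> ks p \<subseteq> A \<Longrightarrow> mass p = (\<Sum>x\<in>A. cf p x)"
  unfolding mass_def by (rule sum.mono_neutral_left) (auto simp: in_keys_iff)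

lemma mass_shift:
  fixes p :: "'a::ab_group_add \<Rightarrow>\<^sub>0 real"
  assumes "finite C" "\<And>y. y \<in> ks p \<Longrightarrow> y + x \<in> C"
  shows "(\<Sum>z\<in>C. cf p (z - x)) = mass p"
proof -
  have "(\<Sum>z\<in>C. cf p (z - x)) = (\<Sum>y\<in>(\<lambda>z. z - x) ` C. cf p y)"
    by (subst sum.reindex) (auto simp: inj_on_def)
  also have "\<dots> = mass p"
    using assms by (intro mass_superset[symmetric]) (auto simp: image_iff intro!: bexI[of _ "_ + x"])
  finally show ?thesis .
qed

lemma mass_mult: "mass (p * q) = mass p * mass (q :: 'a::ab_group_add \<Rightarrow>\<^sub>0 real)"
proof -
  define C where "C = (\<lambda>(x, y). x + y) ` (ks p \<times> ks q)"
  have C: "finite C" "ks (p * q) \<subseteq> C"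
    using keys_mult[of p q] by (auto simp: C_def image_iff)
  have "mass (p * q) = (\<Sum>z\<in>C. \<Sum>x\<in>ks p. cf p x * cf q (z - x))"
    using C by (simp add: mass_superset[of C] cf_times[of "ks p"])
  also have "\<dots> = (\<Sum>x\<in>ks p. cf p x * (\<Sum>z\<in>C. cf q (z - x)))"
    by (subst sum.swap) (simp add: sum_distrib_left)
  also have "\<dots> = (\<Sum>x\<in>ks p. cf p x * mass q)"
    using C by (intro sum.cong refl arg_cong2[where f = "(*)"] mass_shift)
      (auto simp: C_def image_iff intro!: bexI[of _ "(_, _)"] add.commute)
  finally show ?thesis by (simp add: mass_def sum_distrib_right)
qed

lemma mass_one [simp]: "mass (1 :: 'a::ab_group_add \<Rightarrow>\<^sub>0 real) = 1"
  by (simp add: mass_def)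

lemma mass_single [simp]: "mass (sg a c) = c"
  by (simp add: mass_def)

lemma mass_add: "mass (p + q) = mass p + mass q"
proof -
  have "mass (p + q) = (\<Sum>x\<in>ks p \<union> ks q. cf p x + cf q x)"
    using keys_add[of p q] by (simp add: mass_superset[of "ks p \<union> ks q"] lookup_add)
  also have "\<dots> = mass p + mass q"
    by (simp add: sum.distrib mass_superset[of "ks p \<union> ks q"])
  finally show ?thesis .
qed

lemma mass_prod: "mass (\<Prod>i\<in>I. p i) = (\<Prod>i\<in>I. mass (p i :: 'a::ab_group_add \<Rightarrow>\<^sub>0 real))"
  by (induction I rule: infinite_finite_induct) (auto simp: mass_mult)

lemma mass_power: "mass (p ^ k) = mass (p :: 'a::ab_group_add \<Rightarrow>\<^sub>0 real) ^ k"
  by (induction k) (auto simp: mass_mult)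

lemma cf_nonneg_mult:
  "cf_nonneg p \<Longrightarrow> cf_nonneg q \<Longrightarrow> cf_nonneg (p * q :: 'a::ab_group_add \<Rightarrow>\<^sub>0 real)"
  by (auto simp: cf_nonneg_def cf_times[of "ks p"] intro!: sum_nonneg)

lemma cf_nonneg_one [simp]: "cf_nonneg (1 :: 'a::ab_group_add \<Rightarrow>\<^sub>0 real)"
  by (auto simp: cf_nonneg_def lookup_one when_def)

lemma cf_nonneg_single [simp]: "c \<ge> 0 \<Longrightarrow> cf_nonneg (sg a c)"
  by (auto simp: cf_nonneg_def lookup_single when_def)

lemma cf_nonneg_add: "cf_nonneg p \<Longrightarrow> cf_nonneg q \<Longrightarrow> cf_nonneg (p + q)"
  by (auto simp: cf_nonneg_def lookup_add)

lemma cf_nonneg_prod: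
  "(\<And>i. i \<in> I \<Longrightarrow> cf_nonneg (p i :: 'a::ab_group_add \<Rightarrow>\<^sub>0 real)) \<Longrightarrow> cf_nonneg (\<Prod>i\<in>I. p i)"
  by (induction I rule: infinite_finite_induct) (auto simp: cf_nonneg_mult)

lemma cf_nonneg_power: "cf_nonneg (p :: 'a::ab_group_add \<Rightarrow>\<^sub>0 real) \<Longrightarrow> cf_nonneg (p ^ k)"
  by (induction k) (auto simp: cf_nonneg_mult)

lemma cf_even_mult:
  assumes "cf_even p" "cf_even q" shows "cf_even (p * q)"
  unfolding cf_even_def
proof
  fix z
  define A where "A = ks p \<union> uminus ` ks p"
  have A: "finite A" "ks p \<subseteq> A" "uminus ` A = A" by (auto simp: A_def image_Un image_image)
  have "cf (p * q) (- z) = (\<Sum>x\<in>uminus ` A. cf p x * cf q (- z - x))"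
    using A by (simp add: cf_times)
  also have "\<dots> = (\<Sum>x\<in>A. cf p (- x) * cf q (- (z - x)))"
    by (subst sum.reindex) auto
  also have "\<dots> = (\<Sum>x\<in>A. cf p x * cf q (z - x))"
    using assms unfolding cf_even_def by metis
  finally show "cf (p * q) (- z) = cf (p * q) z" using A by (simp add: cf_times)
qed

lemma cf_even_one [simp]: "cf_even 1"
  by (auto simp: cf_even_def lookup_one when_def)

lemma cf_even_prod: "(\<And>i. i \<in> I \<Longrightarrow> cf_even (p i)) \<Longrightarrow> cf_even (\<Prod>i\<in>I. p i)"
  by (induction I rule: infinite_finite_induct) (auto simp: cf_even_mult)

lemma cf_even_power: "cf_even p \<Longrightarrow> cf_even (p ^ k)"
  by (induction k) (auto simp: cf_even_mult)

text \<open>Evenness turns the value of a square at \<open>0\<close> into a squared l2 norm; this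
  stands in for the nonnegativity of the Fourier transform of \<open>p * p\<close>.\<close>

lemma cf_square_zero:
  assumes "cf_even p" "finite A" "ks p \<subseteq> A"
  shows "cf (p * p) 0 = (\<Sum>x\<in>A. (cf p x)\<^sup>2)"
  using assms by (simp add: cf_times cf_even_def power2_eq_square)

text \<open>Cauchy-Schwarz for \<open>p\<close> and the reflected translate of \<open>q\<close>,
  followed by the inequality of the means. By evenness the two norms are again values at
  \<open>0\<close>.\<close>

lemma cf_times_le_squares:
  assumes "cf_even p" "cf_even q"
  shows "cf (p * q) a \<le> (cf (p * p) 0 + cf (q * q) 0) / 2"
proof -
  \<comment> \<open>Both supports, the second one reflected in \<open>a\<close>, so that a single
    index set carries both norms.\<close>
  define A where "A = ks p \<union> (\<lambda>y. a - y) ` ks q"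
  have A: "finite A" "ks p \<subseteq> A" "ks q \<subseteq> (\<lambda>y. a - y) ` A" by (auto simp: A_def image_Un image_image)
  have "(\<Sum>y\<in>(\<lambda>y. a - y) ` A. (cf q y)\<^sup>2) = (\<Sum>x\<in>A. (cf q (a - x))\<^sup>2)"
    by (subst sum.reindex) (auto simp: inj_on_def)
  hence q: "cf (q * q) 0 = (\<Sum>x\<in>A. (cf q (a - x))\<^sup>2)"
    using A assms by (simp add: cf_square_zero[of q "(\<lambda>y. a - y) ` A"])
  have "cf (p * q) a = (\<Sum>x\<in>A. cf p x * cf q (a - x))"
    using A by (simp add: cf_times)
  also have "\<dots> \<le> (\<Sum>x\<in>A. ((cf p x)\<^sup>2 + (cf q (a - x))\<^sup>2) / 2)"
  proof (rule sum_mono)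
    show "cf p x * cf q (a - x) \<le> ((cf p x)\<^sup>2 + (cf q (a - x))\<^sup>2) / 2" for x
      using sum_squares_bound[of "cf p x" "cf q (a - x)"] by simp
  qed
  also have "\<dots> = (cf (p * p) 0 + cf (q * q) 0) / 2"
    using A assms by (simp add: q cf_square_zero[of p A] sum.distrib sum_divide_distrib add_divide_distrib)
  finally show ?thesis .
qed

lemma cf_square_le:
  assumes "cf_even p" shows "cf (p * p) a \<le> cf (p * p) 0"
  using cf_times_le_squares[OF assms assms, of a] by simp

text \<open>Convolution with a nonnegative \<open>q\<close> averages the translates of
  \<open>p\<close>. Factors that bring no gain are discarded in this way.\<close>

lemma cf_times_le_mass:
  fixes p q :: "'a::ab_group_add \<Rightarrow>\<^sub>0 real"
  assumes "cf_nonneg q" "\<And>x. cf p x \<le> c"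
  shows "cf (p * q) a \<le> c * mass q"
proof -
  have "cf (p * q) a = (\<Sum>x\<in>ks q. cf q x * cf p (a - x))"
    by (subst mult.commute) (simp add: cf_times[of "ks q"])
  also have "\<dots> \<le> (\<Sum>x\<in>ks q. cf q x * c)"
    using assms by (intro sum_mono mult_left_mono) (auto simp: cf_nonneg_def)
  finally show ?thesis by (simp add: mass_def sum_distrib_left mult_ac)
qed

lemma cf_le_mass: "cf_nonneg p \<Longrightarrow> cf p x \<le> mass p"
  unfolding mass_def cf_nonneg_def
  by (cases "x \<in> ks p") (auto intro: member_le_sum sum_nonneg simp: in_keys_iff)

text \<open>On the dual group, this is Hoelder's inequality together with that of the means.\<close>

lemma cf_prod_le_mean:
  fixes p :: "nat \<Rightarrow> 'a::ab_group_add \<Rightarrow>\<^sub>0 real"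
  assumes "\<And>c. c < 2 ^ Suc r \<Longrightarrow> cf_even (p c)"
  shows "cf (\<Prod>c<2 ^ Suc r. p c) a \<le> (\<Sum>c<2 ^ Suc r. cf (p c ^ 2 ^ Suc r) 0) / 2 ^ Suc r"
  using assms
proof (induction r arbitrary: p a)
  case 0
  thus ?case using cf_times_le_squares[of "p 0" "p 1" a]
    by (simp add: power2_eq_square numeral_2_eq_2 lessThan_Suc mult.commute add.commute)
next
  case (Suc r)
  define m :: nat where "m = 2 ^ Suc r"
  define A where "A = (\<Prod>c<m. p c)"
  define B where "B = (\<Prod>c<m. p (c + m))"
  have m2: "2 ^ Suc (Suc r) = m + m" by (simp add: m_def)
  have split: "(\<Prod>c<m + m. p c) = A * B"
  proof -
    have "(\<Prod>c<m + m. p c) = (\<Prod>c<m. p c) * (\<Prod>c\<in>{m..<m + m}. p c)"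
      using prod.atLeastLessThan_concat[of 0 m "m + m" p] by (simp add: lessThan_atLeast0)
    also have "(\<Prod>c\<in>{m..<m + m}. p c) = B"
      unfolding B_def using prod.shift_bounds_nat_ivl[of p 0 m m]
      by (simp add: atLeast0LessThan)
    finally show ?thesis by (simp add: A_def)
  qed
  have ev: "cf_even (p c)" if "c < m + m" for c using Suc.prems that unfolding m2 .
  have e2: "(p c * p c) ^ m = p c ^ (m + m)" for c
    by (simp add: power_mult_distrib power_add)
  have IH: "cf (\<Prod>c<m. g c) b \<le> (\<Sum>c<m. cf (g c ^ m) 0) / m"
    if "\<And>c. c < m \<Longrightarrow> cf_even (g c)" for g :: "nat \<Rightarrow> 'a \<Rightarrow>\<^sub>0 real" and b
  proof -
    have "real m = 2 ^ Suc r" by (simp add: m_def)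
    thus ?thesis using Suc.IH[of g b] that by (simp only: m_def[symmetric])
  qed
  \<comment> \<open>Cauchy-Schwarz separates the two halves. The induction hypothesis is then used
    for the squares \<open>p c * p c\<close>: exponents double while the number of factors
    halves.\<close>
  have "cf (A * B) a \<le> (cf (A * A) 0 + cf (B * B) 0) / 2"
    using ev by (intro cf_times_le_squares) (auto simp: A_def B_def intro!: cf_even_prod)
  also have "cf (A * A) 0 \<le> (\<Sum>c<m. cf (p c ^ (m + m)) 0) / m"
    using IH[of "\<lambda>c. p c * p c" 0] ev
    by (simp add: A_def prod.distrib[symmetric] e2 cf_even_mult)
  also have "cf (B * B) 0 \<le> (\<Sum>c<m. cf (p (c + m) ^ (m + m)) 0) / m"
    using IH[of "\<lambda>c. p (c + m) * p (c + m)" 0] ev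
    by (simp add: B_def prod.distrib[symmetric] e2 cf_even_mult)
  also have "((\<Sum>c<m. cf (p c ^ (m + m)) 0) / m + (\<Sum>c<m. cf (p (c + m) ^ (m + m)) 0) / m) / 2
    = (\<Sum>c<m + m. cf (p c ^ (m + m)) 0) / (m + m)"
  proof -
    have "(\<Sum>c<m + m. cf (p c ^ (m + m)) 0) =
      (\<Sum>c<m. cf (p c ^ (m + m)) 0) + (\<Sum>c\<in>{m..<m + m}. cf (p c ^ (m + m)) 0)"
      using sum.atLeastLessThan_concat[of 0 m "m + m" "\<lambda>c. cf (p c ^ (m + m)) 0"] by (simp add: lessThan_atLeast0)
    also have "(\<Sum>c\<in>{m..<m + m}. cf (p c ^ (m + m)) 0) = (\<Sum>c<m. cf (p (c + m) ^ (m + m)) 0)"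
      using sum.shift_bounds_nat_ivl[of "\<lambda>c. cf (p c ^ (m + m)) 0" 0 m m]
      by (simp add: atLeast0LessThan)
    finally show ?thesis by (simp add: add_divide_distrib)
  qed
  finally have "cf (A * B) a \<le> (\<Sum>c<m + m. cf (p c ^ (m + m)) 0) / (real m + real m)" by simp
  moreover have "(2 :: real) ^ Suc (Suc r) = real m + real m" by (simp add: m_def)
  ultimately show ?case unfolding m2 split by (simp only:)
qed

subsection \<open>Threefold sums\<close>

text \<open>Applied to the lexicographic order of the complex plane and to its reverse, to obtain
  both extremes of a finite set.\<close>

lemma finite_has_least:
  assumes "finite T" "T \<noteq> {}" and refl: "\<And>x. r x x"
    and trans: "\<And>x y z. r x y \<Longrightarrow> r y z \<Longrightarrow> r x z" and total: "\<And>x y. r x y \<or> r y x"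
  shows "\<exists>m\<in>T. \<forall>x\<in>T. r m x"
  using assms(1,2)
proof (induction T rule: finite_ne_induct)
  case (singleton x)
  thus ?case using refl by simp
next
  case (insert x F)
  then obtain m where "m \<in> F" "\<forall>y\<in>F. r m y" by blast
  thus ?case using refl trans[of x m] total[of x m] by (metis insert_iff)
qed

text \<open>In an order compatible with addition, the translates of \<open>T\<close> by its least
  element \<open>m\<close> and by its greatest element \<open>M\<close> share only
  \<open>m + M\<close>.\<close>

lemma card_sumset_ge:
  fixes T :: "complex set"
  assumes "finite T" "T \<noteq> {}"
  shows "2 * card T - 1 \<le> card {s + t |s t. s \<in> T \<and> t \<in> T}"
proof -
  define lo where "lo = (\<lambda>x y :: complex. Re x < Re y \<or> Re x = Re y \<and> Im x \<le> Im y)"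
  have lo: "lo x x" "lo x y \<Longrightarrow> lo y z \<Longrightarrow> lo x z" "lo x y \<or> lo y x"
    "lo x y \<Longrightarrow> lo x' y' \<Longrightarrow> x + x' = y + y' \<Longrightarrow> x = y \<and> x' = y'" for x y z x' y'
    by (auto simp: lo_def complex_eq_iff)
  have "\<exists>m\<in>T. \<forall>x\<in>T. lo m x"
    using lo(1-3) by (intro finite_has_least assms) blast+
  then obtain m where m: "m \<in> T" "\<And>x. x \<in> T \<Longrightarrow> lo m x" by blast
  have "\<exists>m\<in>T. \<forall>x\<in>T. lo x m"
    using lo(1-3) by (intro finite_has_least[where r = "\<lambda>x y. lo y x"] assms) blast+
  then obtain M where M: "M \<in> T" "\<And>x. x \<in> T \<Longrightarrow> lo x M" by blast
  define A where "A = (\<lambda>t. m + t) ` T"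
  define B where "B = (\<lambda>t. t + M) ` T"
  have "A \<inter> B \<subseteq> {m + M}"
  proof
    fix z assume "z \<in> A \<inter> B"
    then obtain s t where st: "s \<in> T" "t \<in> T" "z = m + s" "z = t + M" by (auto simp: A_def B_def)
    with lo(4)[of m t s M] m M show "z \<in> {m + M}" by auto
  qed
  hence "card (A \<inter> B) \<le> card {m + M}" by (intro card_mono) auto
  moreover have "card (A \<union> B) + card (A \<inter> B) = card A + card B"
    using assms by (intro card_Un_Int[symmetric]) (auto simp: A_def B_def)
  moreover have "card A = card T" "card B = card T"
    unfolding A_def B_def by (auto intro!: card_image simp: inj_on_def)
  moreover have "card (A \<union> B) \<le> card {s + t |s t. s \<in> T \<and> t \<in> T}"
  proof (rule card_mono)
    have "{s + t |s t. s \<in> T \<and> t \<in> T} = (\<lambda>(s, t). s + t) ` (T \<times> T)" by auto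
    thus "finite {s + t |s t. s \<in> T \<and> t \<in> T}" using assms by simp
    show "A \<union> B \<subseteq> {s + t |s t. s \<in> T \<and> t \<in> T}" using m M by (auto simp: A_def B_def)
  qed
  ultimately show ?thesis by simp
qed

text \<open>
  If \<open>p * p * p\<close> were almost as large at \<open>0\<close> as \<open>p\<close>, then \<open>p\<close> would be almost invariant under
  translation by a set \<open>T\<close> of almost \<open>1 / p 0\<close> elements, hence under \<open>T + T\<close>, which is almost
  twice as large.
\<close>

lemma cf_cube_le:
  fixes p :: "complex \<Rightarrow>\<^sub>0 real"
  assumes ev: "cf_even p" and nn: "cf_nonneg p" and mass: "mass p = 1"
    and max: "\<And>x. cf p x \<le> cf p 0" and half: "cf p 0 \<le> 1 / 2"
  shows "cf (p * p * p) 0 \<le> (255 / 256) * cf p 0"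
proof (rule ccontr)
  assume neg: "\<not> ?thesis"
  define q where "q = cf p 0"
  \<comment> \<open>By evenness \<open>C z\<close> is the correlation of \<open>p\<close> with its
    translate by \<open>z\<close>; the defect \<open>q - C z\<close> measures how far
    \<open>p\<close> is from being invariant under \<open>z\<close>.\<close>
  define C where "C = (\<lambda>z. cf (p * p) z)"
  define D where "D = ks p"
  have D: "finite D" "\<And>x. x \<notin> D \<Longrightarrow> cf p x = 0" by (auto simp: D_def in_keys_iff)
  have p0: "0 \<le> cf p x" for x using nn by (simp add: cf_nonneg_def)
  have pq: "cf p x \<le> q" for x using max by (simp add: q_def)
  have pm: "cf p (- x) = cf p x" for x using ev by (simp add: cf_even_def)
  have sum1: "(\<Sum>x\<in>D. cf p x) = 1" using mass by (simp add: mass_def D_def)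
  have qpos: "q > 0"
  proof (rule ccontr)
    assume "\<not> q > 0"
    hence "cf p x = 0" for x using p0[of x] pq[of x] by linarith
    thus False using sum1 by simp
  qed
  have C_eq: "C z = (\<Sum>x\<in>A. cf p x * cf p (x + z))" if "finite A" "D \<subseteq> A" for A z
  proof -
    have "C z = C (- z)" unfolding C_def using cf_even_mult[OF ev ev] by (simp add: cf_even_def)
    also have "\<dots> = (\<Sum>x\<in>A. cf p x * cf p (- z - x))"
      unfolding C_def using that by (intro cf_times) (auto simp: D_def)
    also have "\<dots> = (\<Sum>x\<in>A. cf p x * cf p (x + z))"
    proof (rule sum.cong[OF refl])
      show "cf p x * cf p (- z - x) = cf p x * cf p (x + z)" for x
        using pm[of "x + z"] by (metis minus_add_distrib diff_conv_add_uminus add.commute)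
    qed
    finally show ?thesis .
  qed
  have C0: "0 \<le> C z" for z unfolding C_eq[OF D(1) order.refl] using p0 by (intro sum_nonneg) auto
  have defect: "q - C z = (\<Sum>x\<in>A. cf p x * (q - cf p (x + z)))" if "finite A" "D \<subseteq> A" for A z
  proof -
    have "(\<Sum>x\<in>A. cf p x) = 1"
      using sum1 that D by (subst sum.mono_neutral_right[of A D]) auto
    hence "(\<Sum>x\<in>A. cf p x * q) = q" by (simp add: sum_distrib_right[symmetric])
    thus ?thesis by (simp add: C_eq[OF that] right_diff_distrib sum_subtractf)
  qed
  have Cq: "C z \<le> q" for z
  proof -
    have "0 \<le> q - C z" unfolding defect[OF D(1) order.refl] using p0 pq
      by (intro sum_nonneg mult_nonneg_nonneg) (auto simp: algebra_simps)
    thus ?thesis by simp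
  qed
  have triangle: "q - C (y + z) \<le> (q - C y) + (q - C z)" for y z
  proof -
    define A where "A = D \<union> (\<lambda>x. x - y) ` D"
    have A: "finite A" "D \<subseteq> A" "D \<subseteq> (\<lambda>x. x + y) ` A" "inj_on (\<lambda>x. x + y) A"
      using D by (auto simp: A_def image_Un image_image)
    have "q - C (y + z) = (\<Sum>x\<in>A. cf p x * (q - cf p (x + (y + z))))"
      by (rule defect) (use A in auto)
    also have "\<dots> \<le> (\<Sum>x\<in>A. cf p x * (q - cf p (x + y)) + cf p (x + y) * (q - cf p (x + (y + z))))"
    proof (rule sum_mono)
      fix x
      have *: "a * (q - c) \<le> a * (q - b) + b * (q - c)"
        if "0 \<le> a" "a \<le> q" "0 \<le> b" "b \<le> q" "0 \<le> c" "c \<le> q" for a b c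
      proof -
        \<comment> \<open>One factor \<open>q\<close> is split as \<open>b + (q - b)\<close>; then
          \<open>a \<le> q\<close> is used in the first part and \<open>q - c \<le> q\<close> in the
          second.\<close>
        have "q * (a * (q - c)) = a * (q - c) * b + a * (q - b) * (q - c)" by (simp add: algebra_simps)
        also have "\<dots> \<le> q * (q - c) * b + a * (q - b) * q"
          using that qpos by (intro add_mono mult_right_mono mult_left_mono mult_nonneg_nonneg) auto
        also have "\<dots> = q * (a * (q - b) + b * (q - c))" by (simp add: algebra_simps)
        finally show ?thesis using qpos by simp
      qed
      show "cf p x * (q - cf p (x + (y + z)))
        \<le> cf p x * (q - cf p (x + y)) + cf p (x + y) * (q - cf p (x + (y + z)))"
        by (rule *) (use p0 pq in auto)
    qed
    also have "\<dots> = (q - C y) + (\<Sum>x\<in>(\<lambda>x. x + y) ` A. cf p x * (q - cf p (x + z)))"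
      using A by (simp add: sum.distrib defect[of A y] sum.reindex add.assoc)
    also have "(\<Sum>x\<in>(\<lambda>x. x + y) ` A. cf p x * (q - cf p (x + z))) = q - C z"
      by (rule defect[symmetric]) (use A in auto)
    finally show ?thesis .
  qed
  \<comment> \<open>By \<open>neg\<close> the defect has \<open>p\<close>-average below
    \<open>q / 256 = (q / 16) * (1 / 16)\<close>, so by Markov's inequality the elements of defect
    above \<open>q / 16\<close> carry mass below \<open>1 / 16\<close>.\<close>
  define T where "T = {z. C z \<ge> (15 / 16) * q}"
  define E where "E = ks (p * p)"
  have E: "finite E" "\<And>x. x \<notin> E \<Longrightarrow> C x = 0" by (auto simp: E_def C_def in_keys_iff)
  have TE: "T \<subseteq> E"
  proof
    fix z assume "z \<in> T"
    hence "C z \<ge> (15 / 16) * q" by (simp add: T_def)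
    hence "C z > 0" using qpos by (simp add: field_simps)
    thus "z \<in> E" using E(2) by fastforce
  qed
  have finT: "finite T" using TE E(1) finite_subset by blast
  have cube: "cf (p * p * p) 0 = (\<Sum>z\<in>D. cf p z * C z)"
  proof -
    have "cf (p * p * p) 0 = cf (p * (p * p)) 0" by (simp add: mult.assoc)
    also have "\<dots> = (\<Sum>z\<in>D. cf p z * C (0 - z))"
      unfolding C_def by (rule cf_times) (auto simp: D_def)
    also have "\<dots> = (\<Sum>z\<in>D. cf p z * C z)"
      unfolding C_def using cf_even_mult[OF ev ev] by (simp add: cf_even_def)
    finally show ?thesis .
  qed
  have "(\<Sum>z\<in>D. cf p z * (q - C z)) < q / 256"
  proof -
    have "(\<Sum>z\<in>D. cf p z * (q - C z)) = q - cf (p * p * p) 0"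
      unfolding cube right_diff_distrib sum_subtractf sum_distrib_right[symmetric] by (simp add: sum1)
    thus ?thesis using neg by (simp add: q_def)
  qed
  moreover have "(\<Sum>z\<in>D. cf p z * (q - C z)) \<ge> (\<Sum>z\<in>D - T. cf p z * (q / 16))"
  proof -
    have "(\<Sum>z\<in>D - T. cf p z * (q / 16)) \<le> (\<Sum>z\<in>D - T. cf p z * (q - C z))"
      using p0 by (intro sum_mono mult_left_mono) (auto simp: T_def)
    also have "\<dots> \<le> (\<Sum>z\<in>D. cf p z * (q - C z))"
      using D p0 Cq by (intro sum_mono2) auto
    finally show ?thesis .
  qed
  moreover have "(\<Sum>z\<in>D - T. cf p z * (q / 16)) = (\<Sum>z\<in>D - T. cf p z) * (q / 16)"
    by (rule sum_distrib_right[symmetric])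
  ultimately have "(\<Sum>z\<in>D - T. cf p z) * q < q / 16" by simp
  hence out: "(\<Sum>z\<in>D - T. cf p z) < 1 / 16" using qpos by (simp add: field_simps)
  have "1 = (\<Sum>z\<in>D - T. cf p z) + (\<Sum>z\<in>D \<inter> T. cf p z)"
    using D(1) sum1 sum.Int_Diff[of D "cf p" T] by simp
  hence "15 / 16 < (\<Sum>z\<in>D \<inter> T. cf p z)" using out by linarith
  also have "\<dots> \<le> (\<Sum>z\<in>D \<inter> T. q)" by (intro sum_mono pq)
  also have "\<dots> \<le> card T * q"
    using qpos finT by (simp add: card_mono)
  finally have cardT: "15 / 16 < card T * q" .
  hence Tne: "T \<noteq> {}" by auto
  define T2 where "T2 = {s + t |s t. s \<in> T \<and> t \<in> T}"
  have T2C: "(7 / 8) * q \<le> C z" if "z \<in> T2" for z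
  proof -
    obtain s t where st: "z = s + t" "C s \<ge> (15 / 16) * q" "C t \<ge> (15 / 16) * q"
      using \<open>z \<in> T2\<close> by (auto simp: T2_def T_def)
    thus ?thesis using triangle[of s t] by simp
  qed
  have "T2 \<subseteq> E"
  proof
    fix z assume "z \<in> T2"
    hence "C z > 0" using qpos T2C[of z] by (simp add: field_simps)
    thus "z \<in> E" using E(2) by fastforce
  qed
  hence "(\<Sum>z\<in>T2. C z) \<le> (\<Sum>z\<in>E. C z)" using E C0 by (intro sum_mono2) auto
  also have "\<dots> = mass (p * p)" by (simp add: mass_def E_def C_def)
  also have "\<dots> = 1" using mass by (simp add: mass_mult)
  finally have "card T2 * ((7 / 8) * q) \<le> 1"
    using sum_mono[of T2 "\<lambda>_. (7 / 8) * q" C] T2C by simp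
  moreover have "(2 * real (card T) - 1) * ((7 / 8) * q) \<le> card T2 * ((7 / 8) * q)"
    using card_sumset_ge[OF finT Tne] qpos unfolding T2_def[symmetric]
    by (intro mult_right_mono) linarith+
  \<comment> \<open>With \<open>t = card T * q > 15 / 16\<close> and \<open>q \<le> 1 / 2\<close>,
    the quantity \<open>(2 * t - q) * (7 / 8)\<close> exceeds
    \<open>(11 / 8) * (7 / 8) > 1\<close>.\<close>
  ultimately show False using cardT half unfolding q_def[symmetric] by (simp add: algebra_simps)
qed

text \<open>The cube bound needs a law peaking at \<open>0\<close>, so it is applied to
  \<open>p\<^sup>2\<close>. Going on from exponent 6 to 8 loses nothing and makes each step multiply
  the exponent by 4, so that it stays a power of two as \<open>cf_prod_le_mean\<close>
  requires.\<close>

lemma cf_power_8_le: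
  fixes p :: "complex \<Rightarrow>\<^sub>0 real"
  assumes ev: "cf_even p" and nn: "cf_nonneg p" and mass: "mass p = 1"
    and half: "cf (p\<^sup>2) 0 \<le> 1 / 2"
  shows "cf (p ^ 8) 0 \<le> (255 / 256) * cf (p\<^sup>2) 0"
proof -
  define s where "s = p ^ 3"
  have "p ^ 8 = (s * s) * p\<^sup>2" by (simp add: s_def power_add[symmetric])
  also have "cf \<dots> 0 \<le> cf (s * s) 0 * mass (p\<^sup>2)"
    using ev nn by (intro cf_times_le_mass cf_square_le) (auto simp: s_def cf_even_power cf_nonneg_power)
  also have "\<dots> = cf (p\<^sup>2 * p\<^sup>2 * p\<^sup>2) 0"
    by (simp add: mass mass_power s_def power_add[symmetric])
  also have "\<dots> \<le> (255 / 256) * cf (p\<^sup>2) 0"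
    using half cf_square_le[OF ev]
    by (intro cf_cube_le cf_even_power cf_nonneg_power ev nn)
      (auto simp: mass mass_mult power2_eq_square)
  finally show ?thesis .
qed

lemma cf_power_antimono:
  fixes p :: "complex \<Rightarrow>\<^sub>0 real"
  assumes ev: "cf_even p" and nn: "cf_nonneg p" and mass: "mass p = 1" and "k \<le> l"
  shows "cf (p ^ (2 * l)) 0 \<le> cf (p ^ (2 * k)) 0"
proof -
  have "p ^ (2 * l) = (p ^ k * p ^ k) * p ^ (2 * (l - k))"
    using \<open>k \<le> l\<close> by (simp add: power_add[symmetric] algebra_simps)
  also have "cf \<dots> 0 \<le> cf (p ^ k * p ^ k) 0 * mass (p ^ (2 * (l - k)))"
    using ev nn by (intro cf_times_le_mass cf_square_le cf_even_power cf_nonneg_power)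
  finally show ?thesis by (simp add: mass mass_power power_add[symmetric] mult_2)
qed

lemma cf_power_le:
  fixes p :: "complex \<Rightarrow>\<^sub>0 real"
  assumes ev: "cf_even p" and nn: "cf_nonneg p" and mass: "mass p = 1"
    and half: "cf (p\<^sup>2) 0 \<le> 1 / 2"
  shows "cf (p ^ (2 * 4 ^ m)) 0 \<le> (255 / 256) ^ m * cf (p\<^sup>2) 0"
proof (induction m)
  case (Suc m)
  define s where "s = p ^ (4 ^ m)"
  have s2: "s\<^sup>2 = p ^ (2 * 4 ^ m)" and s8: "s ^ 8 = p ^ (2 * 4 ^ Suc m)"
    by (simp_all add: s_def power_mult[symmetric] mult.commute)
  \<comment> \<open>The hypothesis \<open>half\<close> survives the iteration because even powers
    decrease at \<open>0\<close>.\<close>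
  have "cf (s\<^sup>2) 0 \<le> cf (p ^ (2 * 1)) 0"
    unfolding s2 by (rule cf_power_antimono[OF ev nn mass]) auto
  hence "cf (s ^ 8) 0 \<le> (255 / 256) * cf (s\<^sup>2) 0"
    using ev nn mass half
    by (intro cf_power_8_le) (auto simp: s_def cf_even_power cf_nonneg_power mass_power)
  thus ?case using Suc.IH by (simp add: s2 s8)
qed auto

subsection \<open>Small ball probabilities of sign vectors\<close>

text \<open>The law of a uniform random sign times \<open>a\<close>; for \<open>a = 0\<close> the
  two atoms merge into the unit of the group ring.\<close>

definition half_sum :: "complex \<Rightarrow> complex \<Rightarrow>\<^sub>0 real" where
  "half_sum a = sg a (1 / 2) + sg (- a) (1 / 2)"

lemma half_sum_even: "cf_even (half_sum a)"
  by (auto simp: cf_even_def half_sum_def lookup_add lookup_single when_def)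

lemma half_sum_nonneg: "cf_nonneg (half_sum a)"
  by (auto simp: half_sum_def cf_nonneg_add)

lemma half_sum_mass: "mass (half_sum a) = 1"
  by (simp add: half_sum_def mass_add)

lemma half_sum_square:
  "half_sum a * half_sum a = sg 0 (1 / 2) + sg (2 * a) (1 / 4) + sg (- (2 * a)) (1 / 4)"
proof -
  have *: "sg (0 :: complex) (1 / 2 :: real) = sg 0 (1 / 4) + sg 0 (1 / 4)"
    by (subst single_add[symmetric]) simp
  show ?thesis unfolding * half_sum_def by (simp add: algebra_simps mult_single)
qed

lemma cf_half_sum_square_le:
  assumes "a \<noteq> 0" shows "cf ((half_sum a)\<^sup>2) x \<le> 1 / 2"
proof -
  have "2 * a \<noteq> - (2 * a)" using assms by (simp add: complex_eq_iff)
  thus ?thesis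
    using assms unfolding power2_eq_square half_sum_square
    by (auto simp: lookup_add lookup_single when_def)
qed

text \<open>The squared factor of one nonzero coordinate has atoms of at most \<open>1 / 2\<close>,
  and the other factors only average. This supplies the hypothesis \<open>half\<close> of
  \<open>cf_power_le\<close>.\<close>

lemma prod_half_sum_square_half:
  assumes "finite A" "j \<in> A" "v j \<noteq> 0"
  shows "cf ((\<Prod>j\<in>A. half_sum (v j))\<^sup>2) 0 \<le> 1 / 2"
proof -
  have "(\<Prod>j\<in>A. half_sum (v j))\<^sup>2 = (half_sum (v j))\<^sup>2 * (\<Prod>j\<in>A - {j}. half_sum (v j))\<^sup>2"
    using assms by (simp add: prod.remove power_mult_distrib)
  also have "cf \<dots> 0 \<le> 1 / 2 * mass ((\<Prod>j\<in>A - {j}. half_sum (v j))\<^sup>2)"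
    using assms by (intro cf_times_le_mass cf_half_sum_square_le cf_nonneg_power cf_nonneg_prod half_sum_nonneg)
  finally show ?thesis by (simp add: mass_power mass_prod half_sum_mass)
qed

lemma prod_single: "(\<Prod>j\<in>J. sg (a j) (c j)) = sg (\<Sum>j\<in>J. a j) (\<Prod>j\<in>J. c j :: real)"
  by (induction J rule: infinite_finite_induct) (auto simp: mult_single)

lemma prod_single_zero: "(\<Prod>j\<in>J. sg 0 (c j) * p j) = sg 0 (\<Prod>j\<in>J. c j :: real) * (\<Prod>j\<in>J. p j)"
  by (simp add: prod.distrib prod_single)

lemma cf_single_zero_mult: "cf (sg 0 c * p) x = c * cf (p :: complex \<Rightarrow>\<^sub>0 real) x"
  by (cases "c = 0") (simp_all add: cf_times[of "{0}"])

text \<open>The dictionary between products in the group ring and weighted counts of integer vectors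
  with a prescribed inner product with \<open>v\<close>.\<close>

lemma cf_prod_sum_single:
  fixes v :: "nat \<Rightarrow> complex" and q :: "nat \<Rightarrow> int \<Rightarrow> real"
  assumes "finite J" "finite D"
  shows "cf (\<Prod>j\<in>J. \<Sum>t\<in>D. sg (of_int t * v j) (q j t)) a =
    (\<Sum>s\<in>J \<rightarrow>\<^sub>E D. (\<Prod>j\<in>J. q j (s j)) * of_bool ((\<Sum>j\<in>J. of_int (s j) * v j) = a))"
  using assms
  by (subst prod_sum_PiE) (auto simp: prod_single lookup_sum lookup_single when_def intro!: sum.cong)

text \<open>Each summand is, with probability \<open>\<tau>\<close>, the sum of two independent
  signs times \<open>v j\<close>, hence \<open>0\<close> or \<open>2 * v j\<close> or
  \<open>- 2 * v j\<close>; squares appear because the Cauchy-Schwarz bounds end in even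
  powers.\<close>

definition lazy_law :: "real \<Rightarrow> nat \<Rightarrow> (nat \<Rightarrow> complex) \<Rightarrow> complex \<Rightarrow>\<^sub>0 real" where
  "lazy_law \<tau> n v = (\<Prod>j<n. sg 0 (1 - \<tau>) + sg 0 \<tau> * (half_sum (v j))\<^sup>2)"

text \<open>Coordinates join the class \<open>c\<close> independently with probability
  \<open>\<beta> / K\<close>, so the average over colourings factors over the coordinates.\<close>

lemma lazy_law_coloring:
  fixes K :: nat and \<beta> :: real
  assumes c: "c < K"
  shows "(\<Sum>\<kappa>\<in>{..<n} \<rightarrow>\<^sub>E {..K}. (\<Prod>j<n. if \<kappa> j = K then 1 - \<beta> else \<beta> / K) *
      cf ((\<Prod>j\<in>{j. j < n \<and> \<kappa> j = c}. half_sum (v j))\<^sup>2) x)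
    = cf (lazy_law (\<beta> / K) n v) x"
proof -
  have K: "real K > 0" using c by simp
  define w where "w = (\<lambda>d. if d = K then 1 - \<beta> else \<beta> / K)"
  define g where "g = (\<lambda>j d. sg 0 (w d) * (if d = c then (half_sum (v j))\<^sup>2 else 1))"
  have sumw: "(\<Sum>d\<in>{..K} - {c}. w d) = 1 - \<beta> / K"
  proof -
    have "(\<Sum>d\<le>K. w d) = (\<Sum>d<K. \<beta> / K) + (1 - \<beta>)"
      unfolding lessThan_Suc_atMost[symmetric] by (simp add: w_def)
    also have "\<dots> = 1" using K by simp
    finally show ?thesis using c by (simp add: sum_diff1 w_def)
  qed
  have "(\<Sum>d\<le>K. g j d) = sg 0 (1 - \<beta> / K) + sg 0 (\<beta> / K) * (half_sum (v j))\<^sup>2" for j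
  proof -
    have "(\<Sum>d\<le>K. g j d) = g j c + (\<Sum>d\<in>{..K} - {c}. sg 0 (w d))"
      using c by (subst sum.remove[of _ c]) (auto simp: g_def intro!: sum.cong)
    also have "(\<Sum>d\<in>{..K} - {c}. sg (0::complex) (w d)) = sg 0 (\<Sum>d\<in>{..K} - {c}. w d)"
      by (induction "{..K} - {c}" rule: infinite_finite_induct) (auto simp: poly_mapping_eq_iff lookup_sum fun_eq_iff lookup_single when_def)
    also have "\<dots> = sg 0 (1 - \<beta> / K)" by (simp only: sumw)
    finally show ?thesis using c by (simp add: g_def w_def add.commute)
  qed
  hence "lazy_law (\<beta> / K) n v = (\<Prod>j<n. \<Sum>d\<le>K. g j d)" by (simp add: lazy_law_def)
  also have "\<dots> = (\<Sum>\<kappa>\<in>{..<n} \<rightarrow>\<^sub>E {..K}. \<Prod>j<n. g j (\<kappa> j))" by (subst prod_sum_PiE) auto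
  also have "\<dots> = (\<Sum>\<kappa>\<in>{..<n} \<rightarrow>\<^sub>E {..K}. sg 0 (\<Prod>j<n. w (\<kappa> j)) *
      (\<Prod>j\<in>{j. j < n \<and> \<kappa> j = c}. half_sum (v j))\<^sup>2)"
  proof (rule sum.cong[OF refl])
    fix \<kappa>
    have "{j. j < n \<and> \<kappa> j = c} = {j \<in> {..<n}. \<kappa> j = c}" by auto
    thus "(\<Prod>j<n. g j (\<kappa> j)) = sg 0 (\<Prod>j<n. w (\<kappa> j)) * (\<Prod>j\<in>{j. j < n \<and> \<kappa> j = c}. half_sum (v j))\<^sup>2"
      unfolding g_def prod_single_zero prod_power_distrib
      by (simp only: prod.inter_filter[OF finite_lessThan])
  qed
  finally show ?thesis by (simp add: lookup_sum cf_single_zero_mult w_def)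
qed

text \<open>
  Each coordinate of the sign vector is uniform with probability \<open>\<beta>\<close>; the uniform coordinates are
  coloured at random with \<open>K\<close> colours, colour \<open>K\<close> marking the others. Every colour class is then
  a lazy copy of the whole sum.
\<close>

lemma small_ball_law:
  fixes v :: "nat \<Rightarrow> complex" and q :: "nat \<Rightarrow> int \<Rightarrow> real" and \<beta> :: real and m :: nat
  defines "K \<equiv> (2 * 4 ^ m :: nat)"
  assumes q1: "\<And>j. j < n \<Longrightarrow> q j 1 + q j (- 1) = 1"
    and qb: "\<And>j t. j < n \<Longrightarrow> t \<in> {1, - 1} \<Longrightarrow> q j t \<ge> \<beta> / 2"
    and \<beta>: "0 < \<beta>" "\<beta> \<le> 1"
    and bound: "\<And>A. A \<subseteq> {..<n} \<Longrightarrow> cf ((\<Prod>j\<in>A. half_sum (v j)) ^ K) 0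
        \<le> \<delta> * cf ((\<Prod>j\<in>A. half_sum (v j))\<^sup>2) 0 + of_bool (\<epsilon> \<and> (\<forall>j\<in>A. v j = 0))"
  shows "cf (\<Prod>j<n. sg (v j) (q j 1) + sg (- v j) (q j (- 1))) a
    \<le> \<delta> * cf (lazy_law (\<beta> / K) n v) 0 + of_bool \<epsilon> * (1 - \<beta> / K) ^ card {j. j < n \<and> v j \<noteq> 0}"
proof -
  define w where "w = (\<lambda>d. if d = K then 1 - \<beta> else \<beta> / K)"
  \<comment> \<open>What remains of a sign law once \<open>\<beta> / 2\<close> is taken from both
    values: nonnegative, of mass \<open>1 - \<beta>\<close>. The part taken out is shared equally by
    the \<open>K\<close> colours.\<close>
  define r where "r = (\<lambda>j. sg (v j) (q j 1 - \<beta> / 2) + sg (- v j) (q j (- 1) - \<beta> / 2))"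
  define g where "g = (\<lambda>j d. if d = K then r j else sg 0 (\<beta> / K) * half_sum (v j))"
  define \<Omega> where "\<Omega> = {..<n} \<rightarrow>\<^sub>E {..K}"
  define S where "S = (\<lambda>(\<kappa> :: nat \<Rightarrow> nat) c. \<Prod>j\<in>{j. j < n \<and> \<kappa> j = c}. half_sum (v j))"
  define W where "W = (\<lambda>\<kappa>. \<Prod>j<n. w (\<kappa> j))"
  have Kpos: "K > 0" and K1: "K = 2 ^ Suc (2 * m)"
    by (simp_all add: K_def power_mult)
  have w0: "w d \<ge> 0" for d using \<beta> by (simp add: w_def)
  hence W0: "W \<kappa> \<ge> 0" for \<kappa> by (simp add: W_def prod_nonneg)
  have r: "cf_nonneg (r j)" "mass (r j) = 1 - \<beta>" if "j < n" for j
    using qb[OF that, of 1] qb[OF that, of "-1"] q1[OF that]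
    by (auto simp: r_def mass_add intro!: cf_nonneg_add)
  have "(\<Sum>d\<le>K. g j d) = sg (v j) (q j 1) + sg (- v j) (q j (- 1))" for j
  proof -
    have "(\<Sum>d\<le>K. g j d) = (\<Sum>d<K. sg 0 (\<beta> / K) * half_sum (v j)) + r j"
      unfolding lessThan_Suc_atMost[symmetric] by (simp add: g_def)
    also have "(\<Sum>d<K. sg 0 (\<beta> / K) * half_sum (v j)) = sg (v j) (\<beta> / 2) + sg (- v j) (\<beta> / 2)"
    proof (rule poly_mapping_eqI)
      show "cf (\<Sum>d<K. sg 0 (\<beta> / K) * half_sum (v j)) x
        = cf (sg (v j) (\<beta> / 2) + sg (- v j) (\<beta> / 2)) x" for x
        unfolding lookup_sum cf_single_zero_mult using Kpos
        by (simp add: half_sum_def lookup_add lookup_single when_def)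
    qed
    finally show ?thesis by (simp add: r_def poly_mapping_eq_iff fun_eq_iff lookup_add lookup_single when_def)
  qed
  hence "(\<Prod>j<n. sg (v j) (q j 1) + sg (- v j) (q j (- 1))) = (\<Prod>j<n. \<Sum>d\<le>K. g j d)" by simp
  also have "\<dots> = (\<Sum>\<kappa>\<in>\<Omega>. \<Prod>j<n. g j (\<kappa> j))" unfolding \<Omega>_def by (subst prod_sum_PiE) auto
  finally have "cf (\<Prod>j<n. sg (v j) (q j 1) + sg (- v j) (q j (- 1))) a
    = (\<Sum>\<kappa>\<in>\<Omega>. cf (\<Prod>j<n. g j (\<kappa> j)) a)" by (simp add: lookup_sum)
  \<comment> \<open>For a fixed colouring the \<open>K\<close> classes are decoupled by
    \<open>cf_prod_le_mean\<close>, while the remainder \<open>R\<close> only averages and costs its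
    mass; the scalars multiply up to \<open>W \<kappa>\<close>.\<close>
  also have "\<dots> \<le> (\<Sum>\<kappa>\<in>\<Omega>. W \<kappa> * ((\<Sum>c<K. cf (S \<kappa> c ^ K) 0) / K))"
  proof (rule sum_mono)
    fix \<kappa> assume \<kappa>: "\<kappa> \<in> \<Omega>"
    define R where "R = (\<Prod>j\<in>{j. j < n \<and> \<kappa> j = K}. r j)"
    have part: "{..<n} = {j. j < n \<and> \<kappa> j = K} \<union> {j. j < n \<and> \<kappa> j < K}"
      using \<kappa> by (auto simp: \<Omega>_def PiE_iff le_less)
    have classes: "(\<Prod>j\<in>{j. j < n \<and> \<kappa> j < K}. half_sum (v j)) = (\<Prod>c<K. S \<kappa> c)"
    proof -
      have "(\<Prod>c<K. S \<kappa> c) = (\<Prod>c<K. \<Prod>j\<in>{j \<in> {j. j < n \<and> \<kappa> j < K}. \<kappa> j = c}. half_sum (v j))"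
        unfolding S_def by (intro prod.cong refl) auto
      also have "\<dots> = (\<Prod>j\<in>{j. j < n \<and> \<kappa> j < K}. half_sum (v j))"
        by (rule prod.group) auto
      finally show ?thesis ..
    qed
    have "(\<Prod>j<n. g j (\<kappa> j)) = R * (\<Prod>j\<in>{j. j < n \<and> \<kappa> j < K}. g j (\<kappa> j))"
      unfolding R_def by (subst part, subst prod.union_disjoint) (auto simp: g_def intro!: arg_cong2[where f = "(*)"] prod.cong)
    also have "(\<Prod>j\<in>{j. j < n \<and> \<kappa> j < K}. g j (\<kappa> j))
      = (\<Prod>j\<in>{j. j < n \<and> \<kappa> j < K}. sg 0 (\<beta> / K) * half_sum (v j))"
      by (intro prod.cong) (auto simp: g_def)
    also have "\<dots> = sg 0 ((\<beta> / K) ^ card {j. j < n \<and> \<kappa> j < K}) * (\<Prod>c<K. S \<kappa> c)"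
      by (simp add: prod_single_zero classes)
    finally have "cf (\<Prod>j<n. g j (\<kappa> j)) a
      = (\<beta> / K) ^ card {j. j < n \<and> \<kappa> j < K} * cf ((\<Prod>c<K. S \<kappa> c) * R) a"
      by (simp add: mult.commute[of R] mult.assoc cf_single_zero_mult)
    also have "\<dots> \<le> (\<beta> / K) ^ card {j. j < n \<and> \<kappa> j < K} *
        ((\<Sum>c<K. cf (S \<kappa> c ^ K) 0) / K * (1 - \<beta>) ^ card {j. j < n \<and> \<kappa> j = K})"
    proof (rule mult_left_mono)
      have "cf ((\<Prod>c<K. S \<kappa> c) * R) a \<le> (\<Sum>c<K. cf (S \<kappa> c ^ K) 0) / K * mass R"
      proof (rule cf_times_le_mass)
        show "cf_nonneg R" unfolding R_def using r by (auto intro!: cf_nonneg_prod)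
        have "cf_even (S \<kappa> c)" for c unfolding S_def by (intro cf_even_prod half_sum_even)
        thus "cf (\<Prod>c<K. S \<kappa> c) x \<le> (\<Sum>c<K. cf (S \<kappa> c ^ K) 0) / K" for x
          using cf_prod_le_mean[of "2 * m" "S \<kappa>" x] unfolding K1 by simp
      qed
      also have "mass R = (1 - \<beta>) ^ card {j. j < n \<and> \<kappa> j = K}"
        unfolding R_def mass_prod using r by simp
      finally show "cf ((\<Prod>c<K. S \<kappa> c) * R) a
        \<le> (\<Sum>c<K. cf (S \<kappa> c ^ K) 0) / K * (1 - \<beta>) ^ card {j. j < n \<and> \<kappa> j = K}" .
    qed (use \<beta> in auto)
    also have "\<dots> = W \<kappa> * ((\<Sum>c<K. cf (S \<kappa> c ^ K) 0) / K)"
    proof -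
      have "W \<kappa> = (\<Prod>j\<in>{j. j < n \<and> \<kappa> j = K}. w (\<kappa> j)) * (\<Prod>j\<in>{j. j < n \<and> \<kappa> j < K}. w (\<kappa> j))"
        unfolding W_def by (subst part, subst prod.union_disjoint) auto
      also have "(\<Prod>j\<in>{j. j < n \<and> \<kappa> j = K}. w (\<kappa> j)) = (1 - \<beta>) ^ card {j. j < n \<and> \<kappa> j = K}"
        by (simp add: w_def)
      also have "(\<Prod>j\<in>{j. j < n \<and> \<kappa> j < K}. w (\<kappa> j)) = (\<beta> / K) ^ card {j. j < n \<and> \<kappa> j < K}"
        by (simp add: w_def)
      finally show ?thesis by simp
    qed
    finally show "cf (\<Prod>j<n. g j (\<kappa> j)) a \<le> W \<kappa> * ((\<Sum>c<K. cf (S \<kappa> c ^ K) 0) / K)" .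
  qed
  also have "\<dots> = (\<Sum>c<K. (\<Sum>\<kappa>\<in>\<Omega>. W \<kappa> * cf (S \<kappa> c ^ K) 0)) / K"
    by (subst sum.swap) (simp add: sum_distrib_left sum_divide_distrib)
  also have "\<dots> \<le> (\<Sum>c<K. \<delta> * cf (lazy_law (\<beta> / K) n v) 0
      + of_bool \<epsilon> * (1 - \<beta> / K) ^ card {j. j < n \<and> v j \<noteq> 0}) / K"
  proof (intro divide_right_mono sum_mono)
    fix c assume "c \<in> {..<K}"
    hence c: "c < K" by simp
    have "(\<Sum>\<kappa>\<in>\<Omega>. W \<kappa> * cf (S \<kappa> c ^ K) 0) \<le> (\<Sum>\<kappa>\<in>\<Omega>. W \<kappa> * (\<delta> * cf ((S \<kappa> c)\<^sup>2) 0
        + of_bool (\<epsilon> \<and> (\<forall>j\<in>{j. j < n \<and> \<kappa> j = c}. v j = 0))))"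
      unfolding S_def by (intro sum_mono mult_left_mono W0 bound) auto
    also have "\<dots> = \<delta> * (\<Sum>\<kappa>\<in>\<Omega>. W \<kappa> * cf ((S \<kappa> c)\<^sup>2) 0)
        + of_bool \<epsilon> * (\<Sum>\<kappa>\<in>\<Omega>. W \<kappa> * of_bool (\<forall>j\<in>{j. j < n \<and> \<kappa> j = c}. v j = 0))"
      by (simp add: distrib_left sum.distrib sum_distrib_left mult_ac)
    also have "(\<Sum>\<kappa>\<in>\<Omega>. W \<kappa> * cf ((S \<kappa> c)\<^sup>2) 0) = cf (lazy_law (\<beta> / K) n v) 0"
      unfolding \<Omega>_def W_def w_def S_def by (rule lazy_law_coloring[OF c])
    \<comment> \<open>The colourings whose class \<open>c\<close> misses the support of
      \<open>v\<close>, where convolution gains nothing: each support coordinate avoids the colour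
      with probability \<open>1 - \<beta> / K\<close>.\<close>
    also have "(\<Sum>\<kappa>\<in>\<Omega>. W \<kappa> * of_bool (\<forall>j\<in>{j. j < n \<and> \<kappa> j = c}. v j = 0))
      = (1 - \<beta> / K) ^ card {j. j < n \<and> v j \<noteq> 0}"
    proof -
      have sumw: "(\<Sum>d\<le>K. w d) = 1"
        unfolding lessThan_Suc_atMost[symmetric] using Kpos by (simp add: w_def)
      have "(\<Sum>\<kappa>\<in>\<Omega>. W \<kappa> * of_bool (\<forall>j\<in>{j. j < n \<and> \<kappa> j = c}. v j = 0))
        = (\<Sum>\<kappa>\<in>\<Omega>. \<Prod>j<n. w (\<kappa> j) * of_bool (\<kappa> j = c \<longrightarrow> v j = 0))"
      proof (rule sum.cong[OF refl])
        fix \<kappa>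
        have "(\<Prod>j<n. of_bool (\<kappa> j = c \<longrightarrow> v j = 0) :: real) = of_bool (\<forall>j\<in>{j. j < n \<and> \<kappa> j = c}. v j = 0)"
        proof (cases "\<forall>j<n. \<kappa> j = c \<longrightarrow> v j = 0")
          case False
          hence "\<exists>j\<in>{..<n}. (of_bool (\<kappa> j = c \<longrightarrow> v j = 0) :: real) = 0" by auto
          hence "(\<Prod>j<n. of_bool (\<kappa> j = c \<longrightarrow> v j = 0) :: real) = 0" by (simp only: prod_zero_iff finite_lessThan)
          thus ?thesis using False by auto
        qed auto
        thus "W \<kappa> * of_bool (\<forall>j\<in>{j. j < n \<and> \<kappa> j = c}. v j = 0)
          = (\<Prod>j<n. w (\<kappa> j) * of_bool (\<kappa> j = c \<longrightarrow> v j = 0))"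
          by (simp only: W_def prod.distrib)
      qed
      also have "\<dots> = (\<Prod>j<n. \<Sum>d\<le>K. w d * of_bool (d = c \<longrightarrow> v j = 0))"
        unfolding \<Omega>_def by (subst prod_sum_PiE) auto
      also have "\<dots> = (\<Prod>j<n. if v j \<noteq> 0 then 1 - \<beta> / K else 1)"
      proof (intro prod.cong refl)
        fix j
        show "(\<Sum>d\<le>K. w d * of_bool (d = c \<longrightarrow> v j = 0)) = (if v j \<noteq> 0 then 1 - \<beta> / K else 1)"
        proof (cases "v j = 0")
          case False
          have "(\<Sum>d\<le>K. w d * of_bool (d = c \<longrightarrow> v j = 0)) = (\<Sum>d\<le>K. w d - (if d = c then w c else 0))"
            using False by (intro sum.cong) auto
          also have "\<dots> = 1 - w c" using c by (simp add: sum_subtractf sumw)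
          finally show ?thesis using False c by (simp add: w_def)
        qed (simp add: sumw)
      qed
      also have "\<dots> = (1 - \<beta> / K) ^ card {j \<in> {..<n}. v j \<noteq> 0}"
        by (subst prod.inter_filter[symmetric]) auto
      finally show ?thesis by simp
    qed
    finally show "(\<Sum>\<kappa>\<in>\<Omega>. W \<kappa> * cf (S \<kappa> c ^ K) 0) \<le> \<delta> * cf (lazy_law (\<beta> / K) n v) 0
      + of_bool \<epsilon> * (1 - \<beta> / K) ^ card {j. j < n \<and> v j \<noteq> 0}" .
  qed simp
  also have "\<dots> = \<delta> * cf (lazy_law (\<beta> / K) n v) 0
      + of_bool \<epsilon> * (1 - \<beta> / K) ^ card {j. j < n \<and> v j \<noteq> 0}"
    using Kpos by simp
  finally show ?thesis .
qed

section \<open>Sign vectors compared with lazy vectors\<close>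

definition sign_prob :: "nat \<Rightarrow> (nat \<Rightarrow> int \<Rightarrow> real) \<Rightarrow> (nat \<Rightarrow> complex) \<Rightarrow> complex \<Rightarrow> real" where
  "sign_prob n q v a = (\<Sum>s\<in>{..<n} \<rightarrow>\<^sub>E {1, - 1}.
     (\<Prod>j<n. q j (s j)) * of_bool ((\<Sum>j<n. of_int (s j) * v j) = a))"

definition lazy_prob :: "real \<Rightarrow> int \<Rightarrow> real" where
  "lazy_prob \<mu> t = (if t = 0 then 1 - \<mu> else \<mu> / 2)"

definition lazy_weight :: "real \<Rightarrow> nat \<Rightarrow> (nat \<Rightarrow> int) \<Rightarrow> real" where
  "lazy_weight \<mu> n y = (\<Prod>j<n. lazy_prob \<mu> (y j))"

definition orth_prob :: "real \<Rightarrow> nat \<Rightarrow> (nat \<Rightarrow> complex) \<Rightarrow> real" where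
  "orth_prob \<mu> n v = (\<Sum>y\<in>{..<n} \<rightarrow>\<^sub>E {- 1, 0, 1}.
     lazy_weight \<mu> n y * of_bool ((\<Sum>j<n. of_int (y j) * v j) = 0))"

lemma sign_prob_eq:
  "sign_prob n q v a = cf (\<Prod>j<n. sg (v j) (q j 1) + sg (- v j) (q j (- 1))) a"
  unfolding sign_prob_def by (subst cf_prod_sum_single[symmetric]) auto

text \<open>Two independent signs cancel with probability \<open>1 / 2\<close>, whence
  \<open>\<tau> / 2\<close>; otherwise they contribute twice a sign, and doubling the sum does not
  affect whether it vanishes.\<close>

lemma orth_prob_eq: "orth_prob (\<tau> / 2) n v = cf (lazy_law \<tau> n v) 0"
proof -
  have eq: "sg 0 (1 - \<tau>) + sg 0 \<tau> * (half_sum (v j))\<^sup>2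
    = (\<Sum>t\<in>{- 1, 0, 1 :: int}. sg (of_int t * (2 * v j)) (lazy_prob (\<tau> / 2) t))" for j
    by (rule poly_mapping_eqI)
      (simp add: power2_eq_square half_sum_square lookup_add cf_single_zero_mult lookup_single when_def lazy_prob_def)
  have "cf (lazy_law \<tau> n v) 0 = (\<Sum>y\<in>{..<n} \<rightarrow>\<^sub>E {- 1, 0, 1 :: int}.
    (\<Prod>j<n. lazy_prob (\<tau> / 2) (y j)) * of_bool ((\<Sum>j<n. of_int (y j) * (2 * v j)) = 0))"
    unfolding lazy_law_def eq by (rule cf_prod_sum_single) auto
  moreover have "(\<Sum>j<n. of_int (y j) * (2 * v j)) = 2 * (\<Sum>j<n. of_int (y j) * v j)" for y :: "nat \<Rightarrow> int"
    by (simp add: sum_distrib_left mult_ac)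
  ultimately show ?thesis by (simp add: orth_prob_def lazy_weight_def)
qed

lemma prod_half_sum:
  "cf_even (\<Prod>j\<in>A. half_sum (v j))" "cf_nonneg (\<Prod>j\<in>A. half_sum (v j))"
  "mass (\<Prod>j\<in>A. half_sum (v j)) = 1"
  by (simp_all add: cf_even_prod cf_nonneg_prod mass_prod half_sum_even half_sum_nonneg half_sum_mass)

text \<open>Both bounds use \<open>2 * 4 ^ m\<close> colours. The first rests on even powers
  decreasing at \<open>0\<close>. The second gains \<open>255 / 256\<close> in each of
  \<open>m\<close> steps on every class meeting the support of \<open>v\<close>; its last term is
  the probability that a given class misses that support.\<close>

theorem sign_prob_le_orth_prob:
  assumes "\<And>j. j < n \<Longrightarrow> q j 1 + q j (- 1) = 1"
    and "\<And>j t. j < n \<Longrightarrow> t \<in> {1, - 1} \<Longrightarrow> q j t \<ge> \<beta> / 2"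
    and "0 < \<beta>" "\<beta> \<le> 1"
  shows "sign_prob n q v a \<le> orth_prob (\<beta> / (4 * 4 ^ m)) n v"
    and "sign_prob n q v a \<le> (255 / 256) ^ m * orth_prob (\<beta> / (4 * 4 ^ m)) n v
      + (1 - \<beta> / (2 * 4 ^ m)) ^ card {j. j < n \<and> v j \<noteq> 0}"
proof -
  have orth: "cf (lazy_law (\<beta> / real (2 * 4 ^ m)) n v) 0 = orth_prob (\<beta> / (4 * 4 ^ m)) n v"
    by (simp add: orth_prob_eq[symmetric])
  have 1: "cf ((\<Prod>j\<in>A. half_sum (v j)) ^ (2 * 4 ^ m)) 0 \<le> 1 * cf ((\<Prod>j\<in>A. half_sum (v j))\<^sup>2) 0
    + of_bool (False \<and> (\<forall>j\<in>A. v j = 0))" for A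
    using cf_power_antimono[OF prod_half_sum, of 1 "4 ^ m"] by simp
  have "cf (\<Prod>j<n. sg (v j) (q j 1) + sg (- v j) (q j (- 1))) a
    \<le> 1 * cf (lazy_law (\<beta> / real (2 * 4 ^ m)) n v) 0
      + of_bool False * (1 - \<beta> / real (2 * 4 ^ m)) ^ card {j. j < n \<and> v j \<noteq> 0}"
    by (rule small_ball_law; (rule assms 1)?; assumption?)
  thus "sign_prob n q v a \<le> orth_prob (\<beta> / (4 * 4 ^ m)) n v"
    unfolding sign_prob_eq orth by simp
  have 2: "cf ((\<Prod>j\<in>A. half_sum (v j)) ^ (2 * 4 ^ m)) 0
    \<le> (255 / 256) ^ m * cf ((\<Prod>j\<in>A. half_sum (v j))\<^sup>2) 0 + of_bool (True \<and> (\<forall>j\<in>A. v j = 0))"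
    if "A \<subseteq> {..<n}" for A
  proof (cases "\<forall>j\<in>A. v j = 0")
    case True
    have "cf ((\<Prod>j\<in>A. half_sum (v j)) ^ (2 * 4 ^ m)) 0 \<le> mass ((\<Prod>j\<in>A. half_sum (v j)) ^ (2 * 4 ^ m))"
      by (intro cf_le_mass cf_nonneg_power prod_half_sum)
    also have "\<dots> = 1" by (simp add: mass_power prod_half_sum)
    also have "1 \<le> (255 / 256) ^ m * cf ((\<Prod>j\<in>A. half_sum (v j))\<^sup>2) 0 + of_bool (True \<and> (\<forall>j\<in>A. v j = 0))"
      using True cf_nonneg_power[OF prod_half_sum(2), of v A 2] by (simp add: cf_nonneg_def)
    finally show ?thesis .
  next
    case False
    then obtain j where "j \<in> A" "v j \<noteq> 0" by blast
    hence "cf ((\<Prod>j\<in>A. half_sum (v j))\<^sup>2) 0 \<le> 1 / 2"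
      using that finite_subset by (intro prod_half_sum_square_half) auto
    from cf_power_le[OF prod_half_sum this, of m] show ?thesis
      by (simp only: False simp_thms of_bool_eq add_0_right)
  qed
  have "cf (\<Prod>j<n. sg (v j) (q j 1) + sg (- v j) (q j (- 1))) a
    \<le> (255 / 256) ^ m * cf (lazy_law (\<beta> / real (2 * 4 ^ m)) n v) 0
      + of_bool True * (1 - \<beta> / real (2 * 4 ^ m)) ^ card {j. j < n \<and> v j \<noteq> 0}"
    by (rule small_ball_law; (rule assms 2)?; assumption?)
  thus "sign_prob n q v a
    \<le> (255 / 256) ^ m * orth_prob (\<beta> / (4 * 4 ^ m)) n v
      + (1 - \<beta> / (2 * 4 ^ m)) ^ card {j. j < n \<and> v j \<noteq> 0}"
    unfolding sign_prob_eq orth by simp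
qed

text \<open>One coordinate with \<open>v i \<noteq> 0\<close> takes two distinct values, each of
  probability at most \<open>1 - \<beta> / 2\<close>, and the others only average. This is the bound
  used for sparse vectors.\<close>

lemma sign_prob_le_one_minus:
  assumes q1: "\<And>j. j < n \<Longrightarrow> q j 1 + q j (- 1) = 1"
    and qb: "\<And>j t. j < n \<Longrightarrow> t \<in> {1, - 1} \<Longrightarrow> q j t \<ge> \<beta> / 2"
    and \<beta>: "0 < \<beta>" and v: "i < n" "v i \<noteq> 0"
  shows "sign_prob n q v a \<le> 1 - \<beta> / 2"
proof -
  define p where "p = (\<lambda>j. sg (v j) (q j 1) + sg (- v j) (q j (- 1)))"
  have nn: "cf_nonneg (p j)" and mass: "mass (p j) = 1" if "j < n" for j
    using qb[OF that, of 1] qb[OF that, of "- 1"] q1[OF that] \<beta>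
    by (auto simp: p_def mass_add intro!: cf_nonneg_add)
  have "cf (p i) x \<le> 1 - \<beta> / 2" for x
  proof -
    have "v i \<noteq> - v i" using v by (simp add: complex_eq_iff)
    thus ?thesis using qb[OF v(1), of 1] qb[OF v(1), of "- 1"] q1[OF v(1)] \<beta>
      by (auto simp: p_def lookup_add lookup_single when_def)
  qed
  hence "cf (p i * (\<Prod>j\<in>{..<n} - {i}. p j)) a \<le> (1 - \<beta> / 2) * mass (\<Prod>j\<in>{..<n} - {i}. p j)"
    using nn by (intro cf_times_le_mass cf_nonneg_prod) auto
  also have "mass (\<Prod>j\<in>{..<n} - {i}. p j) = 1" using mass by (simp add: mass_prod)
  also have "p i * (\<Prod>j\<in>{..<n} - {i}. p j) = (\<Prod>j<n. p j)"
    using v by (simp add: prod.remove)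
  finally show ?thesis by (simp add: sign_prob_eq p_def)
qed

subsection \<open>Lazy vectors in subspaces\<close>

text \<open>Rows and lazy vectors of length \<open>n\<close> become functions vanishing from
  \<open>n\<close> on, so that one vector space serves every \<open>n\<close>.\<close>

interpretation fv: vector_space "\<lambda>(c :: complex) (f :: nat \<Rightarrow> complex) x. c * f x"
  by standard (auto simp: fun_eq_iff algebra_simps)

definition dot :: "nat \<Rightarrow> (nat \<Rightarrow> complex) \<Rightarrow> (nat \<Rightarrow> complex) \<Rightarrow> complex" where
  "dot n r v = (\<Sum>j<n. r j * v j)"

lemma dot_span_zero:
  assumes "w \<in> fv.span B" "\<And>b. b \<in> B \<Longrightarrow> dot n b v = 0"
  shows "dot n w v = 0"
  using assms(1)
proof (induction rule: fv.span_induct)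
  case base
  show ?case
    by (auto simp: fv.subspace_def dot_def distrib_right sum.distrib mult.assoc sum_distrib_left[symmetric])
qed (use assms(2) in auto)

section \<open>Spans, rank and determining coordinates\<close>

lemma sum_fun_apply: "(\<Sum>j\<in>J. (g j :: nat \<Rightarrow> complex)) i = (\<Sum>j\<in>J. g j i)"
  by (induction J rule: infinite_finite_induct) auto

lemma in_span_unit_vectors:
  assumes "finite J" "\<And>i. i \<notin> J \<Longrightarrow> f i = 0"
  shows "f \<in> fv.span ((\<lambda>j i. if i = j then 1 else 0) ` J)"
proof -
  define e :: "nat \<Rightarrow> nat \<Rightarrow> complex" where "e = (\<lambda>j i. if i = j then 1 else 0)"
  have "f = (\<Sum>j\<in>J. (\<lambda>x. f j * e j x))"
  proof
    fix i
    have "(\<Sum>j\<in>J. f j * e j i) = (\<Sum>j\<in>J. if i = j then f i else 0)"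
      by (intro sum.cong) (auto simp: e_def)
    thus "f i = (\<Sum>j\<in>J. (\<lambda>x. f j * e j x)) i"
      using assms by (auto simp: sum_fun_apply)
  qed
  also have "\<dots> \<in> fv.span (e ` J)"
    by (intro fv.span_sum fv.span_scale fv.span_base) auto
  finally show ?thesis unfolding e_def .
qed

text \<open>Steinitz: \<open>Y\<close> extends by some of the \<open>r i\<close> to a basis of
  everything involved, and a basis of vectors supported on \<open>J\<close> has at most
  \<open>card J\<close> elements. Indices \<open>S\<close> are returned instead of vectors because
  the argument exchanges rows.\<close>

lemma exists_completion:
  fixes r :: "'i \<Rightarrow> nat \<Rightarrow> complex"
  assumes "finite J" and ind: "fv.independent Y"
    and supp: "\<And>f x. f \<in> Y \<union> r ` I \<Longrightarrow> x \<notin> J \<Longrightarrow> f x = 0"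
  shows "\<exists>S\<subseteq>I. card S + card Y \<le> card J \<and> (\<forall>i\<in>I. r i \<in> fv.span (Y \<union> r ` S))"
proof -
  define E :: "(nat \<Rightarrow> complex) set" where "E = (\<lambda>j i. if i = j then 1 else 0) ` J"
  obtain B where B: "Y \<subseteq> B" "B \<subseteq> Y \<union> r ` I" "fv.independent B" "Y \<union> r ` I \<subseteq> fv.span B"
    using fv.maximal_independent_subset_extend[of Y "Y \<union> r ` I"] ind by blast
  have "f \<in> fv.span E" if "f \<in> B" for f
    unfolding E_def using supp that B by (intro in_span_unit_vectors assms) auto
  hence "B \<subseteq> fv.span E" by blast
  hence finB: "finite B" "card B \<le> card E"
    using fv.independent_span_bound[of E B] B assms by (auto simp: E_def)
  have "B - Y \<subseteq> r ` I" using B by blast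
  then obtain S where S: "S \<subseteq> I" "inj_on r S" "B - Y = r ` S"
    by (auto simp: subset_image_inj)
  have "card S = card (B - Y)" using S by (simp add: card_image)
  also have "\<dots> = card B - card Y" using B finB by (intro card_Diff_subset finite_subset[OF B(1)]) auto
  finally have "card S + card Y \<le> card E"
    using finB card_mono[OF finB(1) B(1)] by linarith
  also have "\<dots> \<le> card J" unfolding E_def by (intro card_image_le assms)
  finally have "card S + card Y \<le> card J" .
  moreover have "B = Y \<union> r ` S" using S B by blast
  ultimately show ?thesis using S(1) B(4) by (intro exI[of _ S]) auto
qed

text \<open>If adjoining \<open>y\<close> makes \<open>I\<close> insufficient, the vectors of the
  larger span that vanish on \<open>I\<close> form a line; one coordinate where its generator
  \<open>w\<close> is nonzero repairs this.\<close>

lemma exists_determining_coordinates: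
  assumes "finite Y" "\<And>y i. y \<in> Y \<Longrightarrow> i \<ge> n \<Longrightarrow> y i = (0 :: complex)"
  shows "\<exists>I\<subseteq>{..<n}. card I \<le> card Y \<and> (\<forall>w\<in>fv.span Y. (\<forall>i\<in>I. w i = 0) \<longrightarrow> w = 0)"
  using assms
proof (induction Y)
  case empty
  show ?case by (intro exI[of _ "{}"]) auto
next
  case (insert y Y)
  have "\<exists>I\<subseteq>{..<n}. card I \<le> card Y \<and> (\<forall>w\<in>fv.span Y. (\<forall>i\<in>I. w i = 0) \<longrightarrow> w = 0)"
    by (rule insert.IH) (use insert.prems in auto)
  then obtain I where I: "I \<subseteq> {..<n}" "card I \<le> card Y"
    "\<And>w. w \<in> fv.span Y \<Longrightarrow> (\<forall>i\<in>I. w i = 0) \<Longrightarrow> w = 0" by blast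
  have finI: "finite I" using I(1) finite_subset by blast
  show ?case
  proof (cases "\<forall>w\<in>fv.span (insert y Y). (\<forall>i\<in>I. w i = 0) \<longrightarrow> w = 0")
    case True
    moreover have "card I \<le> card (insert y Y)" using I(2) insert.hyps by simp
    ultimately show ?thesis using I(1) by blast
  next
    case False
    then obtain w where w: "w \<in> fv.span (insert y Y)" "\<And>i. i \<in> I \<Longrightarrow> w i = 0" "w \<noteq> 0" by blast
    from w(3) obtain j where j: "w j \<noteq> 0" by (auto simp: fun_eq_iff)
    have "w i = 0" if "i \<ge> n" for i
      using w(1)
    proof (induction rule: fv.span_induct)
      case base
      show ?case by (auto simp: fv.subspace_def)
    qed (use insert.prems that in auto)
    hence jn: "j < n" using j not_le by blast
    have jI: "j \<notin> I" using w(2) j by blast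
    obtain c where c: "w - (\<lambda>x. c * y x) \<in> fv.span Y" using w(1) fv.span_breakdown_eq by blast
    have cnz: "c \<noteq> 0"
    proof
      assume "c = 0"
      hence "w - 0 \<in> fv.span Y" using c by (simp add: zero_fun_def)
      thus False using I(3)[of w] w by auto
    qed
    have "u = 0" if u: "u \<in> fv.span (insert y Y)" "\<forall>i\<in>insert j I. u i = 0" for u
    proof -
      obtain d where d: "u - (\<lambda>x. d * y x) \<in> fv.span Y" using u(1) fv.span_breakdown_eq by blast
      \<comment> \<open>This multiple of \<open>w\<close> cancels \<open>y\<close>, so the
        difference lies in the old span; as it also vanishes on \<open>I\<close>, it is
        \<open>0\<close>.\<close>
      have "(u - (\<lambda>x. d * y x)) - (\<lambda>x. (d / c) * (w - (\<lambda>x. c * y x)) x) \<in> fv.span Y"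
        by (intro fv.span_diff d fv.span_scale c)
      also have "(u - (\<lambda>x. d * y x)) - (\<lambda>x. (d / c) * (w - (\<lambda>x. c * y x)) x) = u - (\<lambda>x. (d / c) * w x)"
        using cnz by (auto simp: fun_eq_iff field_simps)
      finally have "u - (\<lambda>x. (d / c) * w x) = 0" by (rule I(3)) (use u(2) w(2) in auto)
      hence eq: "u x = (d / c) * w x" for x by (simp add: fun_eq_iff)
      with u(2) j have "d / c = 0" by (metis insertI1 mult_eq_0_iff)
      thus ?thesis using eq by (auto simp: fun_eq_iff)
    qed
    moreover have "card (insert j I) \<le> card (insert y Y)"
      using I(2) jI finI insert.hyps by simp
    moreover have "insert j I \<subseteq> {..<n}" using I(1) jn by auto
    ultimately show ?thesis by blast
  qed
qed

definition lazy_vectors :: "nat \<Rightarrow> (nat \<Rightarrow> int) set" where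
  "lazy_vectors n = {..<n} \<rightarrow>\<^sub>E {- 1, 0, 1}"

definition int_vec :: "nat \<Rightarrow> (nat \<Rightarrow> int) \<Rightarrow> nat \<Rightarrow> complex" where
  "int_vec n y = (\<lambda>j. if j < n then of_int (y j) else 0)"

lemma finite_lazy_vectors [simp]: "finite (lazy_vectors n)"
  unfolding lazy_vectors_def by (intro finite_PiE) auto

lemma orth_prob_dot:
  "orth_prob \<mu> n v = (\<Sum>y\<in>lazy_vectors n. lazy_weight \<mu> n y * of_bool (dot n (int_vec n y) v = 0))"
proof -
  have "dot n (int_vec n y) v = (\<Sum>j<n. of_int (y j) * v j)" for y
    unfolding dot_def by (intro sum.cong) (auto simp: int_vec_def)
  thus ?thesis by (simp add: orth_prob_def lazy_vectors_def)
qed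

lemma lazy_prob_nonneg: "0 \<le> \<mu> \<Longrightarrow> \<mu> \<le> 1 \<Longrightarrow> 0 \<le> lazy_prob \<mu> t"
  by (simp add: lazy_prob_def)

lemma lazy_weight_nonneg: "0 \<le> \<mu> \<Longrightarrow> \<mu> \<le> 1 \<Longrightarrow> 0 \<le> lazy_weight \<mu> n y"
  by (simp add: lazy_weight_def prod_nonneg lazy_prob_nonneg)

lemma sum_prod_lazy_prob:
  "finite I \<Longrightarrow> (\<Sum>z\<in>I \<rightarrow>\<^sub>E {- 1, 0, 1}. \<Prod>j\<in>I. lazy_prob \<mu> (z j)) = 1"
  by (subst prod_sum_PiE[symmetric]) (auto simp: lazy_prob_def)

text \<open>Odlyzko's bound: a vector in a \<open>d\<close>-dimensional space is determined by \<open>d\<close> coordinates.\<close>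

lemma lazy_span_prob_le:
  assumes \<mu>: "0 \<le> \<mu>" "\<mu> \<le> 1 / 2" and Y: "finite Y" "\<And>y i. y \<in> Y \<Longrightarrow> i \<ge> n \<Longrightarrow> y i = 0"
  shows "(\<Sum>y\<in>lazy_vectors n. lazy_weight \<mu> n y * of_bool (int_vec n y \<in> fv.span Y)) \<le> (1 - \<mu>) ^ (n - card Y)"
proof -
  obtain I where I: "I \<subseteq> {..<n}" "card I \<le> card Y"
    "\<And>w. w \<in> fv.span Y \<Longrightarrow> (\<forall>i\<in>I. w i = 0) \<Longrightarrow> w = 0"
    using exists_determining_coordinates[of Y n] Y by blast
  have finI: "finite I" using I(1) finite_subset by blast
  define A where "A = {y \<in> lazy_vectors n. int_vec n y \<in> fv.span Y}"
  have inj: "inj_on (\<lambda>y. restrict y I) A"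
  proof (rule inj_onI)
    fix y z assume yz: "y \<in> A" "z \<in> A" "restrict y I = restrict z I"
    have "int_vec n y - int_vec n z \<in> fv.span Y" using yz by (intro fv.span_diff) (auto simp: A_def)
    moreover have "(int_vec n y - int_vec n z) i = 0" if "i \<in> I" for i
      using fun_cong[OF yz(3), of i] that by (simp add: int_vec_def)
    ultimately have "int_vec n y - int_vec n z = 0" using I(3) by blast
    hence "y i = z i" if "i < n" for i
      using that by (auto simp: fun_eq_iff int_vec_def dest!: spec[of _ i])
    thus "y = z" using yz unfolding A_def lazy_vectors_def
      by (intro PiE_ext[of y "{..<n}" "\<lambda>_. {- 1, 0, 1}" z]) auto
  qed
  have split: "lazy_weight \<mu> n y \<le> (\<Prod>j\<in>I. lazy_prob \<mu> (y j)) * (1 - \<mu>) ^ (n - card Y)" for y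
  proof -
    have "lazy_weight \<mu> n y = (\<Prod>j\<in>I. lazy_prob \<mu> (y j)) * (\<Prod>j\<in>{..<n} - I. lazy_prob \<mu> (y j))"
      unfolding lazy_weight_def using prod.subset_diff[OF I(1), of "\<lambda>j. lazy_prob \<mu> (y j)"] by (simp add: mult.commute)
    \<comment> \<open>As \<open>\<mu> \<le> 1 / 2\<close>, no value of a lazy entry is more likely
      than \<open>0\<close>, of probability \<open>1 - \<mu>\<close>.\<close>
    also have "(\<Prod>j\<in>{..<n} - I. lazy_prob \<mu> (y j)) \<le> (\<Prod>j\<in>{..<n} - I. 1 - \<mu>)"
      using \<mu> by (intro prod_mono) (auto simp: lazy_prob_def)
    also have "(\<Prod>j\<in>{..<n} - I. 1 - \<mu>) = (1 - \<mu>) ^ (n - card I)"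
      using I(1) finI by (simp add: card_Diff_subset)
    also have "\<dots> \<le> (1 - \<mu>) ^ (n - card Y)" using \<mu> I(2) by (intro power_decreasing) auto
    finally show ?thesis using \<mu> by (simp add: mult_left_mono prod_nonneg lazy_prob_nonneg)
  qed
  have "(\<Sum>y\<in>lazy_vectors n. lazy_weight \<mu> n y * of_bool (int_vec n y \<in> fv.span Y)) = (\<Sum>y\<in>A. lazy_weight \<mu> n y)"
    unfolding A_def sum.inter_filter[OF finite_lazy_vectors] by (intro sum.cong) auto
  also have "\<dots> \<le> (\<Sum>y\<in>A. (\<Prod>j\<in>I. lazy_prob \<mu> (restrict y I j)) * (1 - \<mu>) ^ (n - card Y))"
    using split by (intro sum_mono) simp
  also have "\<dots> = (\<Sum>z\<in>(\<lambda>y. restrict y I) ` A. \<Prod>j\<in>I. lazy_prob \<mu> (z j)) * (1 - \<mu>) ^ (n - card Y)"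
    using inj by (simp add: sum.reindex sum_distrib_right)
  also have "\<dots> \<le> (\<Sum>z\<in>I \<rightarrow>\<^sub>E {- 1, 0, 1}. \<Prod>j\<in>I. lazy_prob \<mu> (z j)) * (1 - \<mu>) ^ (n - card Y)"
    using \<mu> I(1) finI
    by (intro mult_right_mono sum_mono2 finite_PiE)
      (auto simp: A_def lazy_vectors_def PiE_iff intro!: prod_nonneg lazy_prob_nonneg)
  finally show ?thesis using finI by (simp add: sum_prod_lazy_prob)
qed

section \<open>Independent tuples of lazy vectors orthogonal to a fixed vector\<close>

definition lazy_lists :: "nat \<Rightarrow> nat \<Rightarrow> (nat \<Rightarrow> int) list set" where
  "lazy_lists n k = {ys. set ys \<subseteq> lazy_vectors n \<and> length ys = k}"

definition list_weight :: "real \<Rightarrow> nat \<Rightarrow> (nat \<Rightarrow> int) list \<Rightarrow> real" where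
  "list_weight \<mu> n ys = prod_list (map (lazy_weight \<mu> n) ys)"

text \<open>Independence of a set does not see repetitions in the list, so distinctness is required
  separately; together they yield as many independent vectors as the list is long.\<close>

definition indep_orth :: "nat \<Rightarrow> (nat \<Rightarrow> complex) \<Rightarrow> (nat \<Rightarrow> int) list \<Rightarrow> bool" where
  "indep_orth n v ys \<longleftrightarrow> distinct (map (int_vec n) ys) \<and> fv.independent (int_vec n ` set ys)
     \<and> (\<forall>y\<in>set ys. dot n (int_vec n y) v = 0)"

lemma list_weight_nonneg: "0 \<le> \<mu> \<Longrightarrow> \<mu> \<le> 1 \<Longrightarrow> 0 \<le> list_weight \<mu> n ys"
  unfolding list_weight_def by (induction ys) (auto simp: lazy_weight_nonneg)

lemma lazy_lists_0 [simp]: "lazy_lists n 0 = {[]}"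
  by (auto simp: lazy_lists_def)

lemma sum_lazy_lists_Suc:
  "(\<Sum>ys\<in>lazy_lists n (Suc k). F ys) = (\<Sum>ys\<in>lazy_lists n k. \<Sum>y\<in>lazy_vectors n. F (y # ys))"
proof -
  have "lazy_lists n (Suc k) = (\<lambda>(ys, y). y # ys) ` (lazy_lists n k \<times> lazy_vectors n)"
    unfolding lazy_lists_def lists_length_Suc_eq by simp
  moreover have "inj_on (\<lambda>(ys, y). y # ys) (lazy_lists n k \<times> lazy_vectors n)" by (auto simp: inj_on_def)
  ultimately show ?thesis by (simp add: sum.reindex sum.cartesian_product case_prod_unfold)
qed

lemma finite_lazy_lists [simp]: "finite (lazy_lists n k)"
  unfolding lazy_lists_def by (rule finite_lists_length_eq) simp

lemma sum_list_weight: "(\<Sum>ys\<in>lazy_lists n k. list_weight \<mu> n ys) = 1"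
proof (induction k)
  case (Suc k)
  have "(\<Sum>y\<in>lazy_vectors n. lazy_weight \<mu> n y) = 1"
    unfolding lazy_vectors_def lazy_weight_def by (rule sum_prod_lazy_prob) simp
  thus ?case using Suc
    by (simp add: sum_lazy_lists_Suc list_weight_def sum_distrib_right[symmetric])
qed (simp add: list_weight_def)

text \<open>Draw the vectors one at a time: the next one is orthogonal to \<open>v\<close> with
  probability \<open>f\<close> and, by Odlyzko's bound, lies in the span of the previous ones with
  probability at most \<open>\<eta>\<close>. This gives \<open>(f - \<eta>) ^ k\<close>, which is at
  least \<open>f ^ k / 2\<close> by Bernoulli's inequality.\<close>

lemma indep_orth_prob_ge:
  assumes \<mu>: "0 \<le> \<mu>" "\<mu> \<le> 1 / 2" and f: "orth_prob \<mu> n v > 0"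
    and small: "2 * real k * (1 - \<mu>) ^ (n - k) \<le> orth_prob \<mu> n v"
  shows "orth_prob \<mu> n v ^ k / 2 \<le> (\<Sum>ys\<in>lazy_lists n k. list_weight \<mu> n ys * of_bool (indep_orth n v ys))"
proof (cases "k = 0")
  case True
  have "indep_orth n v []" by (simp add: indep_orth_def fv.independent_empty)
  thus ?thesis using True by (simp add: list_weight_def)
next
  case False
  define f where "f = orth_prob \<mu> n v"
  define \<eta> where "\<eta> = (1 - \<mu>) ^ (n - k)"
  define G where "G = (\<lambda>l. \<Sum>ys\<in>lazy_lists n l. list_weight \<mu> n ys * of_bool (indep_orth n v ys))"
  have \<eta>: "0 \<le> \<eta>" "2 * real k * \<eta> \<le> f" using \<mu> small by (auto simp: \<eta>_def f_def)
  have \<eta>f: "\<eta> \<le> f"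
  proof -
    have "\<eta> \<le> 2 * real k * \<eta>" using \<eta>(1) False by (simp add: mult_le_cancel_right1)
    thus ?thesis using \<eta>(2) by linarith
  qed
  have G0: "G l \<ge> 0" for l
    using \<mu> unfolding G_def by (intro sum_nonneg mult_nonneg_nonneg list_weight_nonneg) auto
  have step: "G (Suc l) \<ge> G l * (f - \<eta>)" if "l < k" for l
  proof -
    have "G l * (f - \<eta>) \<le> (\<Sum>ys\<in>lazy_lists n l. list_weight \<mu> n ys * of_bool (indep_orth n v ys) *
      (f - (\<Sum>y\<in>lazy_vectors n. lazy_weight \<mu> n y * of_bool (int_vec n y \<in> fv.span (int_vec n ` set ys)))))"
      unfolding G_def sum_distrib_right
    proof (intro sum_mono mult_left_mono diff_mono order.refl)
      fix ys assume ys: "ys \<in> lazy_lists n l"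
      have "(\<Sum>y\<in>lazy_vectors n. lazy_weight \<mu> n y * of_bool (int_vec n y \<in> fv.span (int_vec n ` set ys)))
        \<le> (1 - \<mu>) ^ (n - card (int_vec n ` set ys))"
        by (intro lazy_span_prob_le \<mu>) (auto simp: int_vec_def)
      also have "card (int_vec n ` set ys) \<le> l"
        using ys card_image_le[of "set ys" "int_vec n"] card_length[of ys] by (simp add: lazy_lists_def)
      hence "(1 - \<mu>) ^ (n - card (int_vec n ` set ys)) \<le> \<eta>"
        unfolding \<eta>_def using \<mu> that by (intro power_decreasing) auto
      finally show "(\<Sum>y\<in>lazy_vectors n. lazy_weight \<mu> n y * of_bool (int_vec n y \<in> fv.span (int_vec n ` set ys))) \<le> \<eta>" .
    qed (use \<mu> in \<open>auto intro!: list_weight_nonneg mult_nonneg_nonneg\<close>)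
    also have "\<dots> \<le> (\<Sum>ys\<in>lazy_lists n l. \<Sum>y\<in>lazy_vectors n.
        list_weight \<mu> n (y # ys) * of_bool (indep_orth n v (y # ys)))"
    proof (rule sum_mono)
      fix ys
      have "list_weight \<mu> n ys * of_bool (indep_orth n v ys) *
        (f - (\<Sum>y\<in>lazy_vectors n. lazy_weight \<mu> n y * of_bool (int_vec n y \<in> fv.span (int_vec n ` set ys))))
        = (\<Sum>y\<in>lazy_vectors n. list_weight \<mu> n ys * of_bool (indep_orth n v ys) * (lazy_weight \<mu> n y *
          (of_bool (dot n (int_vec n y) v = 0) - of_bool (int_vec n y \<in> fv.span (int_vec n ` set ys)))))"
        unfolding f_def orth_prob_dot
        by (simp add: sum_distrib_left[symmetric] right_diff_distrib sum_subtractf)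
      also have "\<dots> \<le> (\<Sum>y\<in>lazy_vectors n. list_weight \<mu> n (y # ys) * of_bool (indep_orth n v (y # ys)))"
      proof (rule sum_mono)
        fix y
        have "indep_orth n v (y # ys)" if "indep_orth n v ys" "dot n (int_vec n y) v = 0"
          "int_vec n y \<notin> fv.span (int_vec n ` set ys)"
        proof -
          have nin: "int_vec n y \<notin> int_vec n ` set ys" using that(3) fv.span_base by metis
          moreover have "fv.independent (insert (int_vec n y) (int_vec n ` set ys))"
            using that nin by (simp only: indep_orth_def fv.independent_insert if_False simp_thms)
          ultimately show ?thesis using that(1,2) by (simp add: indep_orth_def)
        qed
        hence "of_bool (indep_orth n v ys) * (of_bool (dot n (int_vec n y) v = 0)
          - of_bool (int_vec n y \<in> fv.span (int_vec n ` set ys))) \<le> (of_bool (indep_orth n v (y # ys)) :: real)"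
          by (cases "indep_orth n v ys"; cases "dot n (int_vec n y) v = 0";
              cases "int_vec n y \<in> fv.span (int_vec n ` set ys)") simp_all
        hence "list_weight \<mu> n (y # ys) * (of_bool (indep_orth n v ys) * (of_bool (dot n (int_vec n y) v = 0)
          - of_bool (int_vec n y \<in> fv.span (int_vec n ` set ys)))) \<le> list_weight \<mu> n (y # ys) * of_bool (indep_orth n v (y # ys))"
          using \<mu> by (intro mult_left_mono list_weight_nonneg) auto
        thus "list_weight \<mu> n ys * of_bool (indep_orth n v ys) * (lazy_weight \<mu> n y *
          (of_bool (dot n (int_vec n y) v = 0) - of_bool (int_vec n y \<in> fv.span (int_vec n ` set ys))))
          \<le> list_weight \<mu> n (y # ys) * of_bool (indep_orth n v (y # ys))"
          by (simp add: list_weight_def mult_ac)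
      qed
      finally show "list_weight \<mu> n ys * of_bool (indep_orth n v ys) *
        (f - (\<Sum>y\<in>lazy_vectors n. lazy_weight \<mu> n y * of_bool (int_vec n y \<in> fv.span (int_vec n ` set ys))))
        \<le> (\<Sum>y\<in>lazy_vectors n. list_weight \<mu> n (y # ys) * of_bool (indep_orth n v (y # ys)))" .
    qed
    finally show ?thesis by (simp only: G_def sum_lazy_lists_Suc)
  qed
  have "G l \<ge> (f - \<eta>) ^ l" if "l \<le> k" for l
    using that
  proof (induction l)
    case 0
    show ?case by (simp add: G_def list_weight_def indep_orth_def fv.independent_empty)
  next
    case (Suc l)
    hence "(f - \<eta>) ^ l * (f - \<eta>) \<le> G l * (f - \<eta>)" using \<eta>f by (intro mult_right_mono) auto
    thus ?case using step[of l] Suc.prems by (simp add: mult.commute)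
  qed
  hence "(f - \<eta>) ^ k \<le> G k" by simp
  moreover have "(f - \<eta>) ^ k \<ge> f ^ k / 2"
  proof -
    have fpos: "f > 0" using f by (simp add: f_def)
    have "1 / 2 \<le> 1 - real k * (\<eta> / f)" using \<eta>(2) fpos by (simp add: field_simps)
    also have "\<dots> \<le> (1 - \<eta> / f) ^ k"
      using Bernoulli_inequality[of "- (\<eta> / f)" k] \<eta>f fpos by simp
    finally have "f ^ k * (1 / 2) \<le> f ^ k * (1 - \<eta> / f) ^ k"
      using fpos by (intro mult_left_mono) auto
    also have "\<dots> = (f - \<eta>) ^ k" using fpos by (simp add: power_mult_distrib[symmetric] right_diff_distrib)
    finally show ?thesis by simp
  qed
  ultimately show ?thesis by (simp add: G_def f_def)
qed

subsection \<open>The law of the matrix\<close>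

text \<open>Matrices are curried, as functions giving rows, so that exchanging a row is a function
  update.\<close>

definition sign_mats :: "nat \<Rightarrow> (nat \<Rightarrow> nat \<Rightarrow> int) set" where
  "sign_mats n = {..<n} \<rightarrow>\<^sub>E ({..<n} \<rightarrow>\<^sub>E {1, - 1})"

text \<open>Signs square to 1, so below the diagonal \<open>x i j * x j i\<close> recovers
  \<open>\<xi>\<close>, and \<open>(1 + \<rho> * t) / 2\<close> is the probability that
  \<open>\<xi>\<close> equals the sign \<open>t\<close>.\<close>

definition mat_weight :: "real \<Rightarrow> nat \<Rightarrow> (nat \<Rightarrow> nat \<Rightarrow> int) \<Rightarrow> real" where
  "mat_weight \<rho> n x = (\<Prod>i<n. \<Prod>j<n. if i \<le> j then 1 / 2 else (1 + \<rho> * of_int (x i j * x j i)) / 2)"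

lemma finite_sign_mats [simp]: "finite (sign_mats n)"
  unfolding sign_mats_def by (intro finite_PiE) auto

text \<open>Passing from the independent variables to the entries is a bijection on sign arrays, and
  the same formula inverts it: below the diagonal both directions multiply by the mirrored
  entry.\<close>

lemma prob_rademacher_elliptical_eq:
  assumes \<rho>: "-1 < \<rho>" "\<rho> < 1"
  shows "measure_pmf.prob (rademacher_elliptical n \<rho>) {A. P A}
    = (\<Sum>x\<in>sign_mats n. mat_weight \<rho> n x * of_bool (P (mat n n (\<lambda>(i, j). x i j))))"
proof -
  define I where "I = {..<n} \<times> {..<n}"
  define L where "L = Pi_pmf I 0 (elliptical_entry_pmf \<rho>)"
  define F where "F = PiE_dflt I (0 :: int) (\<lambda>_. {1, - 1})"
  define X where "X = (\<lambda>\<omega> :: nat \<times> nat \<Rightarrow> int. \<lambda>i\<in>{..<n}. \<lambda>j\<in>{..<n}. if i \<le> j then \<omega> (i, j) else \<omega> (j, i) * \<omega> (i, j))"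
  define O' where "O' = (\<lambda>x :: nat \<Rightarrow> nat \<Rightarrow> int. \<lambda>(i, j). if i < n \<and> j < n then (if i \<le> j then x i j else x j i * x i j) else 0)"
  have finI: "finite I" by (simp add: I_def)
  have finF: "finite F" unfolding F_def using finI by (rule finite_PiE_dflt) auto
  have "set_pmf L \<subseteq> F"
    unfolding L_def set_Pi_pmf[OF finI] F_def
    by (auto simp: PiE_dflt_def elliptical_entry_pmf_def sign_pmf_def split: if_splits prod.splits)
  hence "measure_pmf.prob (rademacher_elliptical n \<rho>) {A. P A}
    = measure_pmf.prob L ({\<omega>. P (elliptical_mat n \<omega>)} \<inter> F)"
    unfolding rademacher_elliptical_def measure_map_pmf L_def[symmetric] I_def[symmetric]
    by (intro measure_pmf.finite_measure_eq_AE) (auto simp: AE_measure_pmf_iff)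
  also have "\<dots> = (\<Sum>\<omega>\<in>{\<omega>. P (elliptical_mat n \<omega>)} \<inter> F. pmf L \<omega>)"
    using finF by (simp add: measure_measure_pmf_finite)
  also have "\<dots> = (\<Sum>\<omega>\<in>F. pmf L \<omega> * of_bool (P (elliptical_mat n \<omega>)))"
    using finF by (intro sum.mono_neutral_cong_left) auto
  also have "\<dots> = (\<Sum>x\<in>sign_mats n. mat_weight \<rho> n x * of_bool (P (mat n n (\<lambda>(i, j). x i j))))"
  proof (rule sum.reindex_bij_witness[of _ O' X])
    fix \<omega> assume \<omega>: "\<omega> \<in> F"
    have w: "\<omega> (i, j) \<in> {1, - 1}" if "i < n" "j < n" for i j
      using \<omega> that by (auto simp: F_def PiE_dflt_def I_def)
    have w0: "\<omega> ij = 0" if "ij \<notin> I" for ij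
      using \<omega> that by (cases ij) (auto simp: F_def PiE_dflt_def)
    have sq: "\<omega> (i, j) * \<omega> (i, j) = 1" if "i < n" "j < n" for i j using w[OF that] by auto
    show "O' (X \<omega>) = \<omega>"
    proof (rule ext, safe)
      fix i j
      show "O' (X \<omega>) (i, j) = \<omega> (i, j)"
        using w0[of "(i, j)"] sq[of j i]
        by (auto simp: O'_def X_def I_def mult.assoc[symmetric])
    qed
    show "X \<omega> \<in> sign_mats n"
      unfolding sign_mats_def X_def
    proof (intro restrict_PiE_iff[THEN iffD2] ballI)
      fix i j assume "i \<in> {..<n}" "j \<in> {..<n}"
      thus "(if i \<le> j then \<omega> (i, j) else \<omega> (j, i) * \<omega> (i, j)) \<in> {1, - 1}"
        using w[of i j] w[of j i] by auto
    qed
    have "mat n n (\<lambda>(i, j). X \<omega> i j) = elliptical_mat n \<omega>"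
      by (rule eq_matI) (auto simp: elliptical_mat_def X_def)
    moreover have "mat_weight \<rho> n (X \<omega>) = pmf L \<omega>"
    proof -
      have "pmf L \<omega> = (\<Prod>ij\<in>I. pmf (elliptical_entry_pmf \<rho> ij) (\<omega> ij))"
        unfolding L_def using finI w0 by (subst pmf_Pi') auto
      also have "\<dots> = (\<Prod>i<n. \<Prod>j<n. pmf (elliptical_entry_pmf \<rho> (i, j)) (\<omega> (i, j)))"
        by (simp add: I_def prod.cartesian_product)
      also have "\<dots> = mat_weight \<rho> n (X \<omega>)"
        unfolding mat_weight_def
      proof (intro prod.cong refl)
        fix i j assume ij: "i \<in> {..<n}" "j \<in> {..<n}"
        have "\<omega> (j, i) * \<omega> (i, j) * \<omega> (j, i) = \<omega> (i, j)" using sq[of j i] ij by (simp add: mult_ac)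
        hence "X \<omega> i j * X \<omega> j i = \<omega> (i, j)" if "\<not> i \<le> j" using that ij by (simp add: X_def)
        thus "pmf (elliptical_entry_pmf \<rho> (i, j)) (\<omega> (i, j))
          = (if i \<le> j then 1 / 2 else (1 + \<rho> * of_int (X \<omega> i j * X \<omega> j i)) / 2)"
          using w[of i j] ij \<rho> by (auto simp: elliptical_entry_pmf_def pmf_sign_pmf field_simps)
      qed
      finally show ?thesis ..
    qed
    ultimately show "mat_weight \<rho> n (X \<omega>) * of_bool (P (mat n n (\<lambda>(i, j). X \<omega> i j)))
      = pmf L \<omega> * of_bool (P (elliptical_mat n \<omega>))" by simp
  next
    fix x assume x: "x \<in> sign_mats n"
    have w: "x i j \<in> {1, - 1}" if "i < n" "j < n" for i j
      using x that unfolding sign_mats_def by (auto simp: PiE_iff)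
    have sq: "x i j * x i j = 1" if "i < n" "j < n" for i j using w[OF that] by auto
    have row: "x i \<in> {..<n} \<rightarrow>\<^sub>E {1, - 1}" if "i < n" for i
      using x that unfolding sign_mats_def by (auto simp: PiE_iff)
    show "X (O' x) = x"
    proof (rule PiE_ext[of _ "{..<n}" "\<lambda>_. UNIV" x])
      fix i assume i: "i \<in> {..<n}"
      have "X (O' x) i j = x i j" for j
        using i sq[of j i] row[of i] by (auto simp: X_def O'_def mult.assoc[symmetric] PiE_iff extensional_def)
      thus "X (O' x) i = x i" by blast
    qed (use x in \<open>auto simp: X_def sign_mats_def PiE_iff\<close>)
    show "O' x \<in> F"
      unfolding F_def PiE_dflt_def
    proof (intro CollectI allI conjI impI)
      fix ij
      show "O' x ij = 0" if "ij \<notin> I" using that by (cases ij) (auto simp: O'_def I_def)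
      show "O' x ij \<in> {1, - 1}" if "ij \<in> I"
        using that w[of "fst ij" "snd ij"] w[of "snd ij" "fst ij"]
        by (cases ij) (auto simp: O'_def I_def)
    qed
  qed
  finally show ?thesis .
qed

section \<open>The law of one row given the others\<close>

definition sign_law :: "real \<Rightarrow> nat \<Rightarrow> (nat \<Rightarrow> int \<Rightarrow> real) \<Rightarrow> bool" where
  "sign_law \<beta> n q \<longleftrightarrow> (\<forall>j<n. q j 1 + q j (- 1) = 1 \<and> (\<forall>t\<in>{1, - 1}. q j t \<ge> \<beta> / 2))"

text \<open>The conditional law of the entry in position \<open>(i, j)\<close> given the other rows;
  off the diagonal it involves only the mirrored entry \<open>x j i\<close>, on whichever side of
  the diagonal \<open>j\<close> lies.\<close>

definition row_law :: "real \<Rightarrow> (nat \<Rightarrow> nat \<Rightarrow> int) \<Rightarrow> nat \<Rightarrow> nat \<Rightarrow> int \<Rightarrow> real" where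
  "row_law \<rho> x i j t = (if j = i then 1 / 2 else (1 + \<rho> * of_int (t * x j i)) / 2)"

lemma sign_law_row_law:
  assumes "\<And>j. j < n \<Longrightarrow> j \<noteq> i \<Longrightarrow> x j i \<in> {1, - 1}" "-1 < \<rho>" "\<rho> < 1"
  shows "sign_law (1 - \<bar>\<rho>\<bar>) n (row_law \<rho> x i)"
proof -
  have "row_law \<rho> x i j t \<ge> (1 - \<bar>\<rho>\<bar>) / 2" if "j < n" "t \<in> {1, - 1}" for j t
    using assms(1)[of j] that by (auto simp: row_law_def)
  moreover have "row_law \<rho> x i j 1 + row_law \<rho> x i j (- 1) = 1" for j
    by (simp add: row_law_def field_simps)
  ultimately show ?thesis unfolding sign_law_def by blast
qed

lemma sum_sign_law:
  assumes "sign_law \<beta> n q"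
  shows "(\<Sum>s\<in>{..<n} \<rightarrow>\<^sub>E {1, - 1}. \<Prod>j<n. q j (s j)) = 1"
proof -
  have "(\<Prod>j<n. \<Sum>t\<in>{1, - 1}. q j t) = 1"
    using assms by (intro prod.neutral) (auto simp: sign_law_def)
  thus ?thesis by (subst prod_sum_PiE[symmetric]) auto
qed

lemma mat_weight_nonneg:
  assumes "x \<in> sign_mats n" "-1 < \<rho>" "\<rho> < 1"
  shows "mat_weight \<rho> n x \<ge> 0"
  unfolding mat_weight_def
proof (intro prod_nonneg)
  fix i j assume "i \<in> {..<n}" "j \<in> {..<n}"
  hence "x i j \<in> {1, - 1}" "x j i \<in> {1, - 1}" using assms(1) unfolding sign_mats_def by (auto simp: PiE_iff)
  thus "0 \<le> (if i \<le> j then 1 / 2 else (1 + \<rho> * of_int (x i j * x j i)) / 2)"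
    using assms(2,3) by auto
qed

text \<open>
  The law of the matrix is symmetric under relabelling of the indices, so that the
  entries of a row are conditionally independent given all other rows, not just the earlier ones.
\<close>

lemma mat_weight_row:
  assumes i: "i < n"
  shows "mat_weight \<rho> n (x(i := s)) = (\<Prod>j<n. row_law \<rho> x i j (s j)) *
    ((1 / 2) ^ (n - 1) * (\<Prod>a\<in>{..<n} - {i}. \<Prod>b\<in>{..<n} - {i}.
      if a \<le> b then 1 / 2 else (1 + \<rho> * of_int (x a b * x b a)) / 2))"
proof -
  define w where "w = (\<lambda>(y :: nat \<Rightarrow> nat \<Rightarrow> int) a b. if a \<le> b then 1 / 2 else (1 + \<rho> * of_int (y a b * y b a)) / 2)"
  define J where "J = {..<n} - {i}"
  define E where "E = (\<Prod>a\<in>J. \<Prod>b\<in>J. w x a b)"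
  define y where "y = x(i := s)"
  have ins: "{..<n} = insert i J" "i \<notin> J" "finite J" using i by (auto simp: J_def)
  have "mat_weight \<rho> n y = (\<Prod>a<n. \<Prod>b<n. w y a b)" by (simp add: mat_weight_def w_def)
  also have "\<dots> = w y i i * (\<Prod>b\<in>J. w y i b) * (\<Prod>a\<in>J. w y a i * (\<Prod>b\<in>J. w y a b))"
    unfolding ins(1) using ins(2,3) by simp
  \<comment> \<open>Mirrored positions are paired: one of the two weights is \<open>1 / 2\<close>,
    and the other is the value of \<open>row_law\<close>, in either order.\<close>
  also have "\<dots> = w y i i * (\<Prod>b\<in>J. w y i b * w y b i) * (\<Prod>a\<in>J. \<Prod>b\<in>J. w y a b)"
    by (simp add: prod.distrib)
  also have "(\<Prod>a\<in>J. \<Prod>b\<in>J. w y a b) = E"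
    unfolding E_def using ins(2) by (intro prod.cong refl) (auto simp: w_def y_def fun_upd_apply)
  also have "(\<Prod>b\<in>J. w y i b * w y b i) = (\<Prod>b\<in>J. (1 / 2) * row_law \<rho> x i b (s b))"
    using ins(2) by (intro prod.cong refl) (auto simp: w_def y_def row_law_def mult.commute fun_upd_apply)
  also have "\<dots> = (1 / 2) ^ (n - 1) * (\<Prod>b\<in>J. row_law \<rho> x i b (s b))"
    using i unfolding prod.distrib by (simp add: J_def)
  also have "w y i i = row_law \<rho> x i i (s i)" by (simp add: w_def row_law_def y_def)
  finally have "mat_weight \<rho> n y = (row_law \<rho> x i i (s i) * (\<Prod>b\<in>J. row_law \<rho> x i b (s b))) * ((1 / 2) ^ (n - 1) * E)"
    by (simp add: mult_ac)
  also have "row_law \<rho> x i i (s i) * (\<Prod>b\<in>J. row_law \<rho> x i b (s b)) = (\<Prod>j<n. row_law \<rho> x i j (s j))"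
    unfolding ins(1) using ins(2,3) by simp
  finally show ?thesis unfolding y_def E_def w_def J_def .
qed

lemma sum_sign_mats_row:
  assumes "i < n"
  shows "(\<Sum>x\<in>sign_mats n. F x) =
    (\<Sum>x\<in>({..<n} - {i}) \<rightarrow>\<^sub>E ({..<n} \<rightarrow>\<^sub>E {1, - 1}). \<Sum>s\<in>{..<n} \<rightarrow>\<^sub>E {1, - 1}. F (x(i := s)))"
proof -
  have "{..<n} = insert i ({..<n} - {i})" using assms by auto
  hence "sign_mats n = insert i ({..<n} - {i}) \<rightarrow>\<^sub>E ({..<n} \<rightarrow>\<^sub>E {1, - 1})"
    unfolding sign_mats_def by simp
  also have "\<dots> = (\<lambda>(s, x). x(i := s)) ` (({..<n} \<rightarrow>\<^sub>E {1, - 1}) \<times> (({..<n} - {i}) \<rightarrow>\<^sub>E ({..<n} \<rightarrow>\<^sub>E {1, - 1})))"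
    by (rule PiE_insert_eq)
  finally have "(\<Sum>x\<in>sign_mats n. F x) = (\<Sum>(s, x)\<in>({..<n} \<rightarrow>\<^sub>E {1, - 1}) \<times> (({..<n} - {i}) \<rightarrow>\<^sub>E ({..<n} \<rightarrow>\<^sub>E {1, - 1})). F (x(i := s)))"
    by (simp only:) (subst sum.reindex[OF inj_combinator], simp_all add: case_prod_unfold comp_def)
  also have "\<dots> = (\<Sum>s\<in>{..<n} \<rightarrow>\<^sub>E {1, - 1}. \<Sum>x\<in>({..<n} - {i}) \<rightarrow>\<^sub>E ({..<n} \<rightarrow>\<^sub>E {1, - 1}). F (x(i := s)))"
    by (rule sum.cartesian_product[symmetric])
  finally show ?thesis by (subst (asm) sum.swap)
qed

definition row_vec :: "nat \<Rightarrow> complex \<Rightarrow> (nat \<Rightarrow> nat \<Rightarrow> int) \<Rightarrow> nat \<Rightarrow> nat \<Rightarrow> complex" where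
  "row_vec n z x i = (\<lambda>j. if j < n then of_int (x i j) - (if i = j then z else 0) else 0)"

lemma row_vec_upd [simp]: "i \<noteq> j \<Longrightarrow> row_vec n z (x(i := s)) j = row_vec n z x j"
  unfolding row_vec_def by (simp only: fun_upd_other not_sym)

lemma dot_row_vec:
  assumes "i < n"
  shows "dot n (row_vec n z x i) v = 0 \<longleftrightarrow> (\<Sum>j<n. of_int (x i j) * v j) = z * v i"
proof -
  have "dot n (row_vec n z x i) v = (\<Sum>j<n. of_int (x i j) * v j - (if i = j then z * v i else 0))"
    unfolding dot_def by (intro sum.cong) (auto simp: row_vec_def left_diff_distrib)
  also have "\<dots> = (\<Sum>j<n. of_int (x i j) * v j) - z * v i" using assms by (simp add: sum_subtractf)
  finally show ?thesis by simp
qed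

text \<open>By \<open>inv\<close>, the weight, the vector and the bound ignore row \<open>i\<close>,
  so they are constants once the other rows are fixed. The bound is asked for only where
  \<open>H x\<close> is nonzero, since \<open>v x\<close> will be a choice that is meaningful only
  there.\<close>

lemma row_bound:
  assumes \<rho>: "-1 < \<rho>" "\<rho> < 1" and i: "i < n"
    and inv: "\<And>x s. H (x(i := s)) = H x" "\<And>x s. v (x(i := s)) = v x" "\<And>x s. b (x(i := s)) = b x"
    and H: "\<And>x. H x \<ge> (0 :: real)"
    and b: "\<And>x q a. H x \<noteq> 0 \<Longrightarrow> sign_law (1 - \<bar>\<rho>\<bar>) n q \<Longrightarrow> sign_prob n q (v x) a \<le> b x"
  shows "(\<Sum>x\<in>sign_mats n. mat_weight \<rho> n x * (H x * of_bool (dot n (row_vec n z x i) (v x) = 0)))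
    \<le> (\<Sum>x\<in>sign_mats n. mat_weight \<rho> n x * (H x * b x))"
  unfolding sum_sign_mats_row[OF i] inv
proof (rule sum_mono)
  fix x assume x: "x \<in> ({..<n} - {i}) \<rightarrow>\<^sub>E ({..<n} \<rightarrow>\<^sub>E {1, - 1 :: int})"
  define C where "C = (1 / 2) ^ (n - 1) * (\<Prod>a\<in>{..<n} - {i}. \<Prod>b\<in>{..<n} - {i}.
      if a \<le> b then 1 / 2 else (1 + \<rho> * of_int (x a b * x b a)) / 2)"
  define q where "q = row_law \<rho> x i"
  have xv: "x a b \<in> {1, - 1}" if "a < n" "a \<noteq> i" "b < n" for a b
    using x that by (auto simp: PiE_iff)
  have q: "sign_law (1 - \<bar>\<rho>\<bar>) n q" unfolding q_def using xv i \<rho> by (intro sign_law_row_law) auto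
  have C0: "C \<ge> 0" unfolding C_def
  proof (intro mult_nonneg_nonneg prod_nonneg)
    fix a b assume "a \<in> {..<n} - {i}" "b \<in> {..<n} - {i}"
    hence "x a b \<in> {1, - 1}" "x b a \<in> {1, - 1}" using xv by auto
    thus "0 \<le> (if a \<le> b then 1 / 2 else (1 + \<rho> * of_int (x a b * x b a)) / 2)"
      using \<rho> by auto
  qed auto
  have w: "mat_weight \<rho> n (x(i := s)) = (\<Prod>j<n. q j (s j)) * C" for s
    unfolding q_def C_def by (rule mat_weight_row[OF i])
  have "(\<Sum>s\<in>{..<n} \<rightarrow>\<^sub>E {1, - 1}. mat_weight \<rho> n (x(i := s)) * (H x * of_bool (dot n (row_vec n z (x(i := s)) i) (v x) = 0)))
    = C * (H x * sign_prob n q (v x) (z * v x i))"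
    unfolding sign_prob_def w dot_row_vec[OF i] by (simp add: sum_distrib_left mult_ac)
  also have "\<dots> \<le> C * (H x * b x)"
    using C0 H[of x] b[OF _ q, of x] by (cases "H x = 0") (auto intro!: mult_left_mono)
  also have "\<dots> = (\<Sum>s\<in>{..<n} \<rightarrow>\<^sub>E {1, - 1}. \<Prod>j<n. q j (s j)) * (C * (H x * b x))"
    by (simp add: sum_sign_law[OF q])
  also have "\<dots> = (\<Sum>s\<in>{..<n} \<rightarrow>\<^sub>E {1, - 1}. (\<Prod>j<n. q j (s j)) * (C * (H x * b x)))"
    by (rule sum_distrib_right)
  also have "\<dots> = (\<Sum>s\<in>{..<n} \<rightarrow>\<^sub>E {1, - 1}. mat_weight \<rho> n (x(i := s)) * (H x * b x))"
    unfolding w by (simp add: mult_ac)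
  finally show "(\<Sum>s\<in>{..<n} \<rightarrow>\<^sub>E {1, - 1}. mat_weight \<rho> n (x(i := s)) * (H x * of_bool (dot n (row_vec n z (x(i := s)) i) (v x) = 0)))
    \<le> (\<Sum>s\<in>{..<n} \<rightarrow>\<^sub>E {1, - 1}. mat_weight \<rho> n (x(i := s)) * (H x * b x))" .
qed

text \<open>One row is treated at a time: the conditions on the rows still to come are hidden in the
  weight \<open>H'\<close>, and the factor \<open>b\<close> just gained is moved into the weight for
  the induction hypothesis.\<close>

lemma rows_bound:
  assumes \<rho>: "-1 < \<rho>" "\<rho> < 1" and T: "finite T" "T \<subseteq> {..<n}"
    and inv: "\<And>i x s. i \<in> T \<Longrightarrow> H (x(i := s)) = H x" "\<And>i x s. i \<in> T \<Longrightarrow> v (x(i := s)) = v x"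
      "\<And>i x s. i \<in> T \<Longrightarrow> b (x(i := s)) = b x"
    and H: "\<And>x. H x \<ge> (0 :: real)" and b0: "\<And>x. b x \<ge> 0"
    and b: "\<And>x q a. H x \<noteq> 0 \<Longrightarrow> sign_law (1 - \<bar>\<rho>\<bar>) n q \<Longrightarrow> sign_prob n q (v x) a \<le> b x"
  shows "(\<Sum>x\<in>sign_mats n. mat_weight \<rho> n x * (H x * of_bool (\<forall>i\<in>T. dot n (row_vec n z x i) (v x) = 0)))
    \<le> (\<Sum>x\<in>sign_mats n. mat_weight \<rho> n x * (H x * b x ^ card T))"
  using T inv H b
proof (induction T arbitrary: H rule: finite_induct)
  case empty
  show ?case by simp
next
  case (insert i T)
  define H' where "H' = (\<lambda>x. H x * of_bool (\<forall>j\<in>T. dot n (row_vec n z x j) (v x) = 0))"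
  have "(\<Sum>x\<in>sign_mats n. mat_weight \<rho> n x * (H x * of_bool (\<forall>i\<in>insert i T. dot n (row_vec n z x i) (v x) = 0)))
    = (\<Sum>x\<in>sign_mats n. mat_weight \<rho> n x * (H' x * of_bool (dot n (row_vec n z x i) (v x) = 0)))"
    by (intro sum.cong refl) (auto simp: H'_def)
  also have "\<dots> \<le> (\<Sum>x\<in>sign_mats n. mat_weight \<rho> n x * (H' x * b x))"
  proof (rule row_bound[OF \<rho>])
    show "i < n" using insert.prems by auto
    show "v (x(i := s)) = v x" "b (x(i := s)) = b x" for x s
      by (rule insert.prems(3,4), simp)+
    have "row_vec n z (x(i := s)) j = row_vec n z x j" if "j \<in> T" for x s j
      using that insert.hyps by (intro row_vec_upd) auto
    moreover have "H (x(i := s)) = H x" "v (x(i := s)) = v x" for x s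
      by (rule insert.prems(2,3), simp)+
    ultimately show "H' (x(i := s)) = H' x" for x s
      unfolding H'_def by (simp only: cong: ball_cong)
    show "H' x \<ge> 0" for x using insert.prems by (simp add: H'_def)
    show "sign_prob n q (v x) a \<le> b x" if "H' x \<noteq> 0" "sign_law (1 - \<bar>\<rho>\<bar>) n q" for x q a
      using that insert.prems(6)[of x q a] by (auto simp: H'_def)
  qed
  also have "\<dots> = (\<Sum>x\<in>sign_mats n. mat_weight \<rho> n x * ((H x * b x) * of_bool (\<forall>j\<in>T. dot n (row_vec n z x j) (v x) = 0)))"
    by (intro sum.cong refl) (auto simp: H'_def)
  also have "\<dots> \<le> (\<Sum>x\<in>sign_mats n. mat_weight \<rho> n x * ((H x * b x) * b x ^ card T))"
    using insert.prems b0 by (intro insert.IH) auto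
  finally show ?case using insert.hyps by (simp add: mult_ac)
qed

lemma sum_mat_weight:
  assumes "-1 < \<rho>" "\<rho> < 1"
  shows "(\<Sum>x\<in>sign_mats n. mat_weight \<rho> n x) = 1"
  using prob_rademacher_elliptical_eq[OF assms, of n "\<lambda>_. True"] by simp

subsection \<open>Random null vectors\<close>

definition nonzero_vec :: "nat \<Rightarrow> (nat \<Rightarrow> complex) \<Rightarrow> bool" where
  "nonzero_vec n v \<longleftrightarrow> (\<exists>i<n. v i \<noteq> 0)"

definition annih :: "nat \<Rightarrow> complex \<Rightarrow> (nat \<Rightarrow> nat \<Rightarrow> int) \<Rightarrow> nat set \<Rightarrow> (nat \<Rightarrow> complex) \<Rightarrow> bool" where
  "annih n z x S v \<longleftrightarrow> (\<forall>i\<in>S. dot n (row_vec n z x i) v = 0)"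

lemma annih_upd [simp]:
  assumes "i \<notin> S" shows "annih n z (x(i := s)) S v = annih n z x S v"
proof -
  have "row_vec n z (x(i := s)) j = row_vec n z x j" if "j \<in> S" for j
    using assms that by (intro row_vec_upd) auto
  thus ?thesis by (simp add: annih_def)
qed

lemma annih_span:
  assumes "\<forall>i\<in>I. row_vec n z x i \<in> fv.span (Y \<union> row_vec n z x ` S)"
    and "\<And>y. y \<in> Y \<Longrightarrow> dot n y v = 0" "annih n z x S v"
  shows "annih n z x I v"
  using assms dot_span_zero[of _ "Y \<union> row_vec n z x ` S" n v] unfolding annih_def by blast

text \<open>A singular matrix also has a left null vector \<open>y\<close>; a row with nonzero
  coefficient in \<open>y\<close> is a combination of the others, hence annihilates whatever they
  annihilate.\<close>

lemma exists_dependent_row: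
  assumes "nonzero_vec n v" "annih n z x {..<n} v"
  shows "\<exists>i<n. \<forall>w. annih n z x ({..<n} - {i}) w \<longrightarrow> dot n (row_vec n z x i) w = 0"
proof -
  define A where "A = mat n n (\<lambda>(i, j). row_vec n z x i j)"
  have A: "A \<in> carrier_mat n n" by (simp add: A_def)
  have "A *\<^sub>v vec n v = 0\<^sub>v n"
    using assms(2) by (intro eq_vecI) (auto simp: A_def scalar_prod_def annih_def dot_def atLeast0LessThan)
  moreover have "vec n v \<noteq> 0\<^sub>v n"
    using assms(1) by (auto simp: nonzero_vec_def vec_eq_iff)
  ultimately have "det A = 0" using det_0_iff_vec_prod_zero[OF A] by (auto intro!: exI[of _ "vec n v"])
  hence "det (transpose_mat A) = 0" using det_transpose[OF A] by simp
  then obtain y where y: "y \<in> carrier_vec n" "y \<noteq> 0\<^sub>v n" "transpose_mat A *\<^sub>v y = 0\<^sub>v n"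
    using det_0_iff_vec_prod_zero[of "transpose_mat A" n] A by auto
  from y(1,2) obtain i where i: "i < n" "y $ i \<noteq> 0" by (auto simp: vec_eq_iff)
  have col: "(\<Sum>a<n. row_vec n z x a k * y $ a) = 0" if "k < n" for k
  proof -
    have "(transpose_mat A *\<^sub>v y) $ k = 0" using y(3) that by simp
    thus ?thesis using that y(1) by (simp add: A_def scalar_prod_def atLeast0LessThan)
  qed
  have "dot n (row_vec n z x i) w = 0" if w: "annih n z x ({..<n} - {i}) w" for w
  proof -
    have "(\<Sum>a<n. y $ a * dot n (row_vec n z x a) w) = (\<Sum>k<n. (\<Sum>a<n. row_vec n z x a k * y $ a) * w k)"
      unfolding dot_def sum_distrib_left sum_distrib_right by (subst sum.swap) (simp add: mult_ac)
    also have "\<dots> = 0" by (intro sum.neutral) (simp add: col)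
    also have "(\<Sum>a<n. y $ a * dot n (row_vec n z x a) w)
      = y $ i * dot n (row_vec n z x i) w + (\<Sum>a\<in>{..<n} - {i}. y $ a * dot n (row_vec n z x a) w)"
      using i by (subst sum.remove[of _ i]) auto
    also have "(\<Sum>a\<in>{..<n} - {i}. y $ a * dot n (row_vec n z x a) w) = 0"
      using w by (intro sum.neutral) (auto simp: annih_def)
    finally show ?thesis using i by simp
  qed
  thus ?thesis using i by blast
qed

text \<open>For a dependent row \<open>i\<close>, \<open>u i x\<close> is selected among the vectors
  with \<open>Q\<close> annihilated by the other rows. The choice does not see row \<open>i\<close>,
  yet row \<open>i\<close> must annihilate it; the sum over \<open>i\<close> gives the factor
  \<open>n\<close>.\<close>

lemma dependent_row_bound:
  assumes \<rho>: "-1 < \<rho>" "\<rho> < 1" and \<theta>: "\<theta> \<ge> 0"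
    and small: "\<And>v q a. nonzero_vec n v \<Longrightarrow> Q v \<Longrightarrow> sign_law (1 - \<bar>\<rho>\<bar>) n q \<Longrightarrow> sign_prob n q v a \<le> \<theta>"
  shows "(\<Sum>x\<in>sign_mats n. mat_weight \<rho> n x *
    of_bool (\<exists>v. nonzero_vec n v \<and> annih n z x {..<n} v \<and> Q v)) \<le> n * \<theta>"
proof -
  define P where "P = (\<lambda>i x w. nonzero_vec n w \<and> annih n z x ({..<n} - {i}) w \<and> Q w)"
  define H :: "nat \<Rightarrow> (nat \<Rightarrow> nat \<Rightarrow> int) \<Rightarrow> real" where "H = (\<lambda>i x. of_bool (\<exists>w. P i x w))"
  define u where "u = (\<lambda>i x. SOME w. P i x w)"
  have P_upd: "P i (x(i := s)) = P i x" for i x s unfolding P_def by simp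
  have u: "P i x (u i x)" if "H i x \<noteq> 0" for i x
    using that someI_ex[of "P i x"] by (auto simp: H_def u_def)
  have "(\<Sum>x\<in>sign_mats n. mat_weight \<rho> n x * of_bool (\<exists>v. nonzero_vec n v \<and> annih n z x {..<n} v \<and> Q v))
    \<le> (\<Sum>x\<in>sign_mats n. mat_weight \<rho> n x * (\<Sum>i<n. H i x * of_bool (dot n (row_vec n z x i) (u i x) = 0)))"
  proof (intro sum_mono mult_left_mono mat_weight_nonneg \<rho>)
    fix x
    show "of_bool (\<exists>v. nonzero_vec n v \<and> annih n z x {..<n} v \<and> Q v)
      \<le> (\<Sum>i<n. H i x * of_bool (dot n (row_vec n z x i) (u i x) = 0))"
    proof (cases "\<exists>v. nonzero_vec n v \<and> annih n z x {..<n} v \<and> Q v")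
      case True
      then obtain v where v: "nonzero_vec n v" "annih n z x {..<n} v" "Q v" by blast
      obtain i where i: "i < n" "\<And>w. annih n z x ({..<n} - {i}) w \<Longrightarrow> dot n (row_vec n z x i) w = 0"
        using exists_dependent_row[OF v(1,2)] by blast
      have "P i x v" using v by (auto simp: P_def annih_def)
      hence H: "H i x = 1" by (auto simp: H_def)
      hence "P i x (u i x)" using u by simp
      hence "dot n (row_vec n z x i) (u i x) = 0" using i(2) by (simp add: P_def)
      hence "1 \<le> H i x * of_bool (dot n (row_vec n z x i) (u i x) = 0)" using H by simp
      also have "\<dots> \<le> (\<Sum>i<n. H i x * of_bool (dot n (row_vec n z x i) (u i x) = 0))"
        using i by (intro member_le_sum) (auto simp: H_def)
      finally show ?thesis using True by simp
    next
      case False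
      thus ?thesis by (simp only: of_bool_eq) (intro sum_nonneg mult_nonneg_nonneg, auto simp: H_def)
    qed
  qed
  also have "\<dots> = (\<Sum>i<n. \<Sum>x\<in>sign_mats n. mat_weight \<rho> n x * (H i x * of_bool (dot n (row_vec n z x i) (u i x) = 0)))"
    unfolding sum_distrib_left by (rule sum.swap)
  also have "\<dots> \<le> (\<Sum>i<n. \<theta>)"
  proof (rule sum_mono)
    fix i assume "i \<in> {..<n}"
    hence "(\<Sum>x\<in>sign_mats n. mat_weight \<rho> n x * (H i x * of_bool (dot n (row_vec n z x i) (u i x) = 0)))
      \<le> (\<Sum>x\<in>sign_mats n. mat_weight \<rho> n x * (H i x * \<theta>))"
      using u small by (intro row_bound[OF \<rho>]) (auto simp: H_def u_def P_upd P_def)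
    also have "\<dots> \<le> (\<Sum>x\<in>sign_mats n. mat_weight \<rho> n x * \<theta>)"
      using \<theta> by (intro sum_mono mult_left_mono mat_weight_nonneg \<rho>) (auto simp: H_def)
    also have "\<dots> = \<theta>" by (simp add: sum_distrib_right[symmetric] sum_mat_weight[OF \<rho>])
    finally show "(\<Sum>x\<in>sign_mats n. mat_weight \<rho> n x * (H i x * of_bool (dot n (row_vec n z x i) (u i x) = 0))) \<le> \<theta>" .
  qed
  finally show ?thesis by simp
qed

lemma obtain_superset_card:
  assumes "S \<subseteq> {..<n}" "card S \<le> s" "s \<le> n"
  obtains T where "S \<subseteq> T" "T \<subseteq> {..<n}" "card T = s"
  using exists_subset_between[of S s "{..<n}"] assms by auto

text \<open>Restricted to a set \<open>T\<close> of \<open>s\<close> columns containing the support,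
  the rows have rank at most \<open>s\<close>, so some \<open>s\<close> of them, \<open>S'\<close>,
  span the others there. A vector on \<open>T\<close> picked from the rows in \<open>S'\<close>
  alone is then annihilated by all rows, and each of the other \<open>n - s\<close> rows costs
  \<open>c\<close>. The squared power counts the pairs \<open>(T, S')\<close>.\<close>

lemma sparse_null_vector_bound:
  assumes \<rho>: "-1 < \<rho>" "\<rho> < 1" and s: "s \<le> n" and c: "0 \<le> c"
    and bound: "\<And>v q a. nonzero_vec n v \<Longrightarrow> sign_law (1 - \<bar>\<rho>\<bar>) n q \<Longrightarrow> sign_prob n q v a \<le> c"
  shows "(\<Sum>x\<in>sign_mats n. mat_weight \<rho> n x *
    of_bool (\<exists>v. nonzero_vec n v \<and> annih n z x {..<n} v \<and> card {j. j < n \<and> v j \<noteq> 0} \<le> s))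
    \<le> (real n ^ s)\<^sup>2 * c ^ (n - s)"
proof -
  define U where "U = {T. T \<subseteq> {..<n} \<and> card T = s}"
  define P where "P = (\<lambda>TS x w. nonzero_vec n w \<and> (\<forall>j. j \<notin> fst TS \<longrightarrow> w j = 0) \<and> annih n z x (snd TS) w)"
  define H :: "nat set \<times> nat set \<Rightarrow> (nat \<Rightarrow> nat \<Rightarrow> int) \<Rightarrow> real" where "H = (\<lambda>TS x. of_bool (\<exists>w. P TS x w))"
  define u where "u = (\<lambda>TS x. SOME w. P TS x w)"
  define F where "F = (\<lambda>TS x. H TS x * of_bool (\<forall>i\<in>{..<n} - snd TS. dot n (row_vec n z x i) (u TS x) = 0))"
  have finU: "finite U" unfolding U_def by (rule finite_subset[of _ "Pow {..<n}"]) auto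
  have F0: "F TS x \<ge> 0" for TS x by (simp add: F_def H_def)
  have u: "P TS x (u TS x)" if "H TS x \<noteq> 0" for TS x
    using that someI_ex[of "P TS x"] by (auto simp: H_def u_def)
  have "(\<Sum>x\<in>sign_mats n. mat_weight \<rho> n x *
      of_bool (\<exists>v. nonzero_vec n v \<and> annih n z x {..<n} v \<and> card {j. j < n \<and> v j \<noteq> 0} \<le> s))
    \<le> (\<Sum>x\<in>sign_mats n. mat_weight \<rho> n x * (\<Sum>TS\<in>U \<times> U. F TS x))"
  proof (intro sum_mono mult_left_mono mat_weight_nonneg \<rho>)
    fix x
    show "of_bool (\<exists>v. nonzero_vec n v \<and> annih n z x {..<n} v \<and> card {j. j < n \<and> v j \<noteq> 0} \<le> s)
      \<le> (\<Sum>TS\<in>U \<times> U. F TS x)"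
    proof (cases "\<exists>v. nonzero_vec n v \<and> annih n z x {..<n} v \<and> card {j. j < n \<and> v j \<noteq> 0} \<le> s")
      case True
      then obtain v where v: "nonzero_vec n v" "annih n z x {..<n} v" "card {j. j < n \<and> v j \<noteq> 0} \<le> s" by blast
      obtain T where T: "{j. j < n \<and> v j \<noteq> 0} \<subseteq> T" "T \<subseteq> {..<n}" "card T = s"
        using v(3) s by (rule obtain_superset_card[rotated]) auto
      define r where "r = (\<lambda>i j. if j \<in> T then row_vec n z x i j else 0)"
      have "\<exists>S\<subseteq>{..<n}. card S + card ({} :: (nat \<Rightarrow> complex) set) \<le> card T \<and> (\<forall>i\<in>{..<n}. r i \<in> fv.span ({} \<union> r ` S))"
        using T(2) by (intro exists_completion) (auto simp: r_def fv.independent_empty intro: finite_subset)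
      then obtain S where S: "S \<subseteq> {..<n}" "card S \<le> s" "\<And>i. i < n \<Longrightarrow> r i \<in> fv.span (r ` S)"
        using T(3) by auto
      obtain S' where S': "S \<subseteq> S'" "S' \<subseteq> {..<n}" "card S' = s"
        using S(1,2) s by (rule obtain_superset_card)
      \<comment> \<open>\<open>v\<close> is unconstrained from \<open>n\<close> on, whereas
        \<open>P\<close> demands zeros outside \<open>T\<close>.\<close>
      define w where "w = (\<lambda>j. if j < n then v j else 0)"
      have "P (T, S') x w"
      proof -
        have "nonzero_vec n w" using v(1) by (auto simp: nonzero_vec_def w_def)
        moreover have "dot n r w = dot n r v" for r
          unfolding dot_def by (intro sum.cong) (auto simp: w_def)
        hence "annih n z x S' w" using v(2) S'(2) by (auto simp: annih_def)
        ultimately show ?thesis using T(1) by (auto simp: P_def w_def)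
      qed
      hence H: "H (T, S') x = 1" by (auto simp: H_def)
      define y where "y = u (T, S') x"
      have y: "\<And>j. j \<notin> T \<Longrightarrow> y j = 0" "annih n z x S' y" using u[of "(T, S')" x] H by (auto simp: P_def y_def)
      have ry: "dot n (r i) y = dot n (row_vec n z x i) y" for i
        unfolding dot_def using y(1) by (intro sum.cong) (auto simp: r_def)
      have "dot n (row_vec n z x i) y = 0" if "i < n" for i
      proof -
        have "dot n b y = 0" if "b \<in> r ` S" for b
          using that y(2) S'(1) unfolding annih_def by (auto simp only: ry)
        thus ?thesis using dot_span_zero[OF S(3)[OF that], of n y] by (simp only: ry)
      qed
      hence "1 \<le> F (T, S') x" using H by (simp add: F_def y_def)
      also have "\<dots> \<le> (\<Sum>TS\<in>U \<times> U. F TS x)"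
        using finU T S' F0 by (intro member_le_sum) (auto simp: U_def)
      finally show ?thesis using True by simp
    next
      case False
      thus ?thesis by (simp only: of_bool_eq) (intro sum_nonneg F0)
    qed
  qed
  also have "\<dots> = (\<Sum>TS\<in>U \<times> U. \<Sum>x\<in>sign_mats n. mat_weight \<rho> n x * F TS x)"
    unfolding sum_distrib_left by (rule sum.swap)
  also have "\<dots> \<le> (\<Sum>TS\<in>U \<times> U. c ^ (n - s))"
  proof (rule sum_mono)
    fix TS assume TS: "TS \<in> U \<times> U"
    define S where "S = snd TS"
    have S: "S \<subseteq> {..<n}" "card S = s" using TS by (auto simp: U_def S_def)
    have P_upd: "P TS (x(i := t)) = P TS x" if "i \<in> {..<n} - S" for i x t
      using that unfolding P_def S_def by simp
    have "(\<Sum>x\<in>sign_mats n. mat_weight \<rho> n x * F TS x) \<le> (\<Sum>x\<in>sign_mats n. mat_weight \<rho> n x * (H TS x * c ^ card ({..<n} - S)))"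
      unfolding F_def S_def[symmetric]
    proof (rule rows_bound[OF \<rho>, where b = "\<lambda>_. c"])
      show "H TS (x(i := t)) = H TS x" "u TS (x(i := t)) = u TS x" if "i \<in> {..<n} - S" for i x t
        unfolding H_def u_def P_upd[OF that] by (rule refl)+
      show "sign_prob n q (u TS x) a \<le> c" if "H TS x \<noteq> 0" "sign_law (1 - \<bar>\<rho>\<bar>) n q" for x q a
        using u[of TS x] that by (intro bound) (auto simp: P_def)
    qed (use c in \<open>auto simp: H_def\<close>)
    also have "\<dots> \<le> (\<Sum>x\<in>sign_mats n. mat_weight \<rho> n x * c ^ (n - s))"
      using c S by (intro sum_mono mult_left_mono mat_weight_nonneg \<rho>) (auto simp: H_def card_Diff_subset finite_subset)
    also have "\<dots> = c ^ (n - s)" by (simp add: sum_distrib_right[symmetric] sum_mat_weight[OF \<rho>])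
    finally show "(\<Sum>x\<in>sign_mats n. mat_weight \<rho> n x * F TS x) \<le> c ^ (n - s)" .
  qed
  also have "\<dots> = (real (card U))\<^sup>2 * c ^ (n - s)"
    by (simp add: card_cartesian_product power2_eq_square)
  also have "\<dots> \<le> (real n ^ s)\<^sup>2 * c ^ (n - s)"
  proof -
    have "card U \<le> n ^ s" using s by (simp add: U_def n_subsets binomial_le_pow)
    hence "real (card U) \<le> real (n ^ s)" by (simp only: of_nat_le_iff)
    hence "real (card U) \<le> real n ^ s" by simp
    thus ?thesis using c by (intro mult_right_mono power_mono) auto
  qed
  finally show ?thesis .
qed

lemma orth_prob_nonneg: "0 \<le> \<mu> \<Longrightarrow> \<mu> \<le> 1 \<Longrightarrow> 0 \<le> orth_prob \<mu> n v"
  unfolding orth_prob_dot by (intro sum_nonneg mult_nonneg_nonneg lazy_weight_nonneg) auto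

text \<open>The value depends only on which of the finitely many lazy vectors are orthogonal to
  \<open>v\<close>; hence a null vector maximising it exists.\<close>

lemma finite_range_orth_prob: "finite (range (orth_prob \<mu> n))"
proof (rule finite_subset)
  show "range (orth_prob \<mu> n) \<subseteq> (\<lambda>L. \<Sum>y\<in>L. lazy_weight \<mu> n y) ` Pow (lazy_vectors n)"
  proof safe
    fix v
    have "orth_prob \<mu> n v = (\<Sum>y\<in>{y \<in> lazy_vectors n. dot n (int_vec n y) v = 0}. lazy_weight \<mu> n y)"
      unfolding orth_prob_dot sum.inter_filter[OF finite_lazy_vectors] by (intro sum.cong) auto
    thus "orth_prob \<mu> n v \<in> (\<lambda>L. \<Sum>y\<in>L. lazy_weight \<mu> n y) ` Pow (lazy_vectors n)" by blast
  qed
qed simp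

text \<open>
  The replacement argument of Kahn, Komlos and Szemeredi: \<open>k\<close> of the rows are exchanged for
  independent lazy vectors orthogonal to the null vector \<open>v\<close>, which are much more likely than the
  rows themselves to be orthogonal to \<open>v\<close>. Choosing \<open>v\<close> to maximise \<open>orth_prob\<close> makes the choice
  of a null vector of the exchanged system harmless.
\<close>

lemma structured_null_vector_bound:
  assumes \<rho>: "-1 < \<rho>" "\<rho> < 1" and k: "k \<le> n" and \<gamma>: "0 \<le> \<gamma>" and \<mu>: "0 \<le> \<mu>" "\<mu> \<le> 1 / 2"
    and G: "\<And>v. G v \<Longrightarrow> orth_prob \<mu> n v > 0 \<and> 2 * real k * (1 - \<mu>) ^ (n - k) \<le> orth_prob \<mu> n v"
    and bound: "\<And>v q a. nonzero_vec n v \<Longrightarrow> G v \<Longrightarrow> sign_law (1 - \<bar>\<rho>\<bar>) n q \<Longrightarrow> sign_prob n q v a \<le> \<gamma> * orth_prob \<mu> n v"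
  shows "(\<Sum>x\<in>sign_mats n. mat_weight \<rho> n x *
    of_bool ((\<exists>v. nonzero_vec n v \<and> annih n z x {..<n} v) \<and> (\<forall>v. nonzero_vec n v \<and> annih n z x {..<n} v \<longrightarrow> G v)))
    \<le> 2 * 2 ^ n * \<gamma> ^ k"
proof -
  define U where "U = {S. S \<subseteq> {..<n} \<and> card S = n - k}"
  define P where "P = (\<lambda>ys S x w. nonzero_vec n w \<and> (\<forall>y\<in>set ys. dot n (int_vec n y) w = 0) \<and> annih n z x S w \<and> G w)"
  define u where "u = (\<lambda>ys S x. SOME w. P ys S x w)"
  \<comment> \<open>The inverse power prepays for the exchange: each of the \<open>k\<close> rows
    will contribute \<open>\<gamma>\<close> times \<open>orth_prob\<close> of the chosen vector, and
    this weight cancels the second factor.\<close>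
  define H :: "(nat \<Rightarrow> int) list \<Rightarrow> nat set \<Rightarrow> (nat \<Rightarrow> nat \<Rightarrow> int) \<Rightarrow> real"
    where "H = (\<lambda>ys S x. of_bool (\<exists>w. P ys S x w) * inverse (orth_prob \<mu> n (u ys S x)) ^ k)"
  define F where "F = (\<lambda>ys S x. H ys S x * of_bool (\<forall>i\<in>{..<n} - S. dot n (row_vec n z x i) (u ys S x) = 0))"
  have finU: "finite U" unfolding U_def by (rule finite_subset[of _ "Pow {..<n}"]) auto
  have op0: "orth_prob \<mu> n v \<ge> 0" for v using \<mu> by (intro orth_prob_nonneg) auto
  have H0: "H ys S x \<ge> 0" for ys S x using op0 by (simp add: H_def)
  have F0: "F ys S x \<ge> 0" for ys S x using H0 by (simp add: F_def)
  have u: "P ys S x (u ys S x)" if "\<exists>w. P ys S x w" for ys S x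
    using that someI_ex[of "P ys S x"] by (auto simp: u_def)
  have lw0: "list_weight \<mu> n ys \<ge> 0" for ys using \<mu> by (intro list_weight_nonneg) auto
  have "(\<Sum>x\<in>sign_mats n. mat_weight \<rho> n x * of_bool ((\<exists>v. nonzero_vec n v \<and> annih n z x {..<n} v)
      \<and> (\<forall>v. nonzero_vec n v \<and> annih n z x {..<n} v \<longrightarrow> G v)))
    \<le> (\<Sum>x\<in>sign_mats n. mat_weight \<rho> n x * (\<Sum>ys\<in>lazy_lists n k. 2 * list_weight \<mu> n ys * (\<Sum>S\<in>U. F ys S x)))"
  proof (intro sum_mono mult_left_mono mat_weight_nonneg \<rho>)
    fix x
    let ?E = "(\<exists>v. nonzero_vec n v \<and> annih n z x {..<n} v) \<and> (\<forall>v. nonzero_vec n v \<and> annih n z x {..<n} v \<longrightarrow> G v)"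
    show "of_bool ?E \<le> (\<Sum>ys\<in>lazy_lists n k. 2 * list_weight \<mu> n ys * (\<Sum>S\<in>U. F ys S x))"
    proof (cases ?E)
      case True
      define V where "V = {v. nonzero_vec n v \<and> annih n z x {..<n} v}"
      have VG: "G v" if "v \<in> V" for v using True that by (auto simp: V_def)
      have "finite (orth_prob \<mu> n ` V)" by (rule finite_subset[OF _ finite_range_orth_prob]) auto
      moreover have "V \<noteq> {}" using True by (auto simp: V_def)
      ultimately have "Max (orth_prob \<mu> n ` V) \<in> orth_prob \<mu> n ` V" by (intro Max_in) auto
      then obtain v where v: "v \<in> V" "Max (orth_prob \<mu> n ` V) = orth_prob \<mu> n v" by blast
      have vmax: "orth_prob \<mu> n w \<le> orth_prob \<mu> n v" if "w \<in> V" for w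
        unfolding v(2)[symmetric] using \<open>finite (orth_prob \<mu> n ` V)\<close> that by (intro Max_ge) auto
      define f where "f = orth_prob \<mu> n v"
      have f: "f > 0" "2 * real k * (1 - \<mu>) ^ (n - k) \<le> f" using G[OF VG[OF v(1)]] by (auto simp: f_def)
      have ys: "inverse f ^ k \<le> (\<Sum>S\<in>U. F ys S x)" if "ys \<in> lazy_lists n k" "indep_orth n v ys" for ys
      proof -
        define Y where "Y = int_vec n ` set ys"
        have cardY: "card Y = k"
          using that distinct_card[of "map (int_vec n) ys"] by (simp add: Y_def indep_orth_def lazy_lists_def)
        have "\<exists>S\<subseteq>{..<n}. card S + card Y \<le> card {..<n} \<and> (\<forall>i\<in>{..<n}. row_vec n z x i \<in> fv.span (Y \<union> row_vec n z x ` S))"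
          using that by (intro exists_completion) (auto simp: Y_def indep_orth_def int_vec_def row_vec_def)
        then obtain S where S: "S \<subseteq> {..<n}" "card S \<le> n - k"
          "\<forall>i\<in>{..<n}. row_vec n z x i \<in> fv.span (Y \<union> row_vec n z x ` S)"
          unfolding cardY by auto
        obtain S' where S': "S \<subseteq> S'" "S' \<subseteq> {..<n}" "card S' = n - k"
          using S(1,2) by (rule obtain_superset_card) simp
        have "P ys S' x v" using v(1) VG that(2) S'(2) by (auto simp: P_def V_def annih_def indep_orth_def)
        hence ex: "\<exists>w. P ys S' x w" by blast
        define w where "w = u ys S' x"
        have w: "P ys S' x w" using u[OF ex] by (simp add: w_def)
        \<comment> \<open>The lazy vectors and the rows in \<open>S\<close> span all rows, so the
          chosen \<open>w\<close> is a true null vector, and maximality of \<open>f\<close> applies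
          to it.\<close>
        have "annih n z x {..<n} w"
        proof (rule annih_span[OF S(3)])
          show "annih n z x S w" using w S'(1) by (auto simp: P_def annih_def)
        qed (use w in \<open>auto simp: P_def Y_def\<close>)
        moreover from this have "w \<in> V" using w by (simp add: V_def P_def)
        hence "orth_prob \<mu> n w \<le> f" "orth_prob \<mu> n w > 0" using vmax[of w] G[OF VG, of w] by (auto simp: f_def)
        ultimately have "inverse f ^ k \<le> F ys S' x"
          using ex f(1) by (auto simp: F_def H_def annih_def w_def[symmetric] intro!: power_mono le_imp_inverse_le)
        also have "\<dots> \<le> (\<Sum>S\<in>U. F ys S x)" using finU S' F0 by (intro member_le_sum) (auto simp: U_def)
        finally show ?thesis .
      qed
      \<comment> \<open>The suitable lists have total weight at least \<open>f ^ k / 2\<close>, so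
        averaging over them recovers the event up to the factor 2.\<close>
      have "1 = 2 * inverse f ^ k * (f ^ k / 2)" using f(1) by (simp add: field_simps)
      also have "\<dots> \<le> 2 * inverse f ^ k * (\<Sum>ys\<in>lazy_lists n k. list_weight \<mu> n ys * of_bool (indep_orth n v ys))"
        using f \<mu> unfolding f_def by (intro mult_left_mono indep_orth_prob_ge) auto
      also have "\<dots> = (\<Sum>ys\<in>lazy_lists n k. 2 * list_weight \<mu> n ys * (inverse f ^ k * of_bool (indep_orth n v ys)))"
        unfolding sum_distrib_left by (intro sum.cong) auto
      also have "\<dots> \<le> (\<Sum>ys\<in>lazy_lists n k. 2 * list_weight \<mu> n ys * (\<Sum>S\<in>U. F ys S x))"
      proof (intro sum_mono mult_left_mono)
        fix xs assume "xs \<in> lazy_lists n k"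
        thus "inverse f ^ k * of_bool (indep_orth n v xs) \<le> (\<Sum>S\<in>U. F xs S x)"
          using ys[of xs] by (cases "indep_orth n v xs") (auto simp: F0 sum_nonneg)
      qed (use lw0 in auto)
      finally show ?thesis using True by simp
    next
      case False
      thus ?thesis using lw0 F0 by (simp only: of_bool_eq) (intro sum_nonneg mult_nonneg_nonneg, auto)
    qed
  qed
  also have "\<dots> = (\<Sum>ys\<in>lazy_lists n k. 2 * list_weight \<mu> n ys * (\<Sum>S\<in>U. \<Sum>x\<in>sign_mats n. mat_weight \<rho> n x * F ys S x))"
  proof -
    have "(\<Sum>S\<in>U. \<Sum>x\<in>sign_mats n. mat_weight \<rho> n x * F ys S x)
      = (\<Sum>x\<in>sign_mats n. mat_weight \<rho> n x * (\<Sum>S\<in>U. F ys S x))" for ys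
      unfolding sum_distrib_left by (rule sum.swap)
    moreover have "(\<Sum>x\<in>sign_mats n. mat_weight \<rho> n x * (\<Sum>ys\<in>lazy_lists n k. 2 * list_weight \<mu> n ys * A ys x))
      = (\<Sum>ys\<in>lazy_lists n k. 2 * list_weight \<mu> n ys * (\<Sum>x\<in>sign_mats n. mat_weight \<rho> n x * A ys x))" for A
    proof -
      have "(\<Sum>x\<in>sign_mats n. mat_weight \<rho> n x * (\<Sum>ys\<in>lazy_lists n k. 2 * list_weight \<mu> n ys * A ys x))
        = (\<Sum>x\<in>sign_mats n. \<Sum>ys\<in>lazy_lists n k. 2 * list_weight \<mu> n ys * (mat_weight \<rho> n x * A ys x))"
        by (simp add: sum_distrib_left mult_ac)
      also have "\<dots> = (\<Sum>ys\<in>lazy_lists n k. \<Sum>x\<in>sign_mats n. 2 * list_weight \<mu> n ys * (mat_weight \<rho> n x * A ys x))"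
        by (rule sum.swap)
      finally show ?thesis by (simp only: sum_distrib_left)
    qed
    ultimately show ?thesis by (simp only:)
  qed
  also have "\<dots> \<le> (\<Sum>ys\<in>lazy_lists n k. 2 * list_weight \<mu> n ys * (\<Sum>S\<in>U. \<gamma> ^ k))"
  proof (intro sum_mono mult_left_mono)
    fix ys S assume "S \<in> U"
    hence S: "S \<subseteq> {..<n}" "card S = n - k" by (auto simp: U_def)
    have P_upd: "P ys S (x(i := t)) = P ys S x" if "i \<in> {..<n} - S" for i x t
      using that unfolding P_def by simp
    have u_upd: "u ys S (x(i := t)) = u ys S x" if "i \<in> {..<n} - S" for i x t
      using P_upd[OF that] unfolding u_def by simp
    have card: "card ({..<n} - S) = k" using S k by (simp add: card_Diff_subset finite_subset)
    have "(\<Sum>x\<in>sign_mats n. mat_weight \<rho> n x * F ys S x)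
      \<le> (\<Sum>x\<in>sign_mats n. mat_weight \<rho> n x * (H ys S x * (\<gamma> * orth_prob \<mu> n (u ys S x)) ^ card ({..<n} - S)))"
      unfolding F_def
    proof (rule rows_bound[OF \<rho>])
      show "H ys S (x(i := t)) = H ys S x" if "i \<in> {..<n} - S" for i x t
        unfolding H_def u_upd[OF that] P_upd[OF that] ..
      show "u ys S (x(i := t)) = u ys S x" if "i \<in> {..<n} - S" for i x t by (rule u_upd[OF that])
      show "\<gamma> * orth_prob \<mu> n (u ys S (x(i := t))) = \<gamma> * orth_prob \<mu> n (u ys S x)" if "i \<in> {..<n} - S" for i x t
        by (simp only: u_upd[OF that])
      show "sign_prob n q (u ys S x) a \<le> \<gamma> * orth_prob \<mu> n (u ys S x)"
        if "H ys S x \<noteq> 0" "sign_law (1 - \<bar>\<rho>\<bar>) n q" for x q a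
      proof -
        have "P ys S x (u ys S x)" using that by (intro u) (auto simp: H_def)
        thus ?thesis using that by (intro bound) (auto simp: P_def)
      qed
    qed (use H0 op0 \<gamma> in auto)
    also have "\<dots> \<le> (\<Sum>x\<in>sign_mats n. mat_weight \<rho> n x * \<gamma> ^ k)"
    proof (intro sum_mono mult_left_mono mat_weight_nonneg \<rho>)
      fix x
      show "H ys S x * (\<gamma> * orth_prob \<mu> n (u ys S x)) ^ card ({..<n} - S) \<le> \<gamma> ^ k"
      proof (cases "\<exists>w. P ys S x w")
        case True
        hence "orth_prob \<mu> n (u ys S x) > 0" using u[OF True] G by (auto simp: P_def)
        thus ?thesis using True by (simp add: H_def card power_mult_distrib power_inverse field_simps)
      qed (use \<gamma> in \<open>auto simp: H_def\<close>)
    qed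
    also have "\<dots> = \<gamma> ^ k" by (simp add: sum_distrib_right[symmetric] sum_mat_weight[OF \<rho>])
    finally show "(\<Sum>x\<in>sign_mats n. mat_weight \<rho> n x * F ys S x) \<le> \<gamma> ^ k" .
  qed (use lw0 in auto)
  also have "\<dots> = (\<Sum>ys\<in>lazy_lists n k. list_weight \<mu> n ys) * (2 * (card U * \<gamma> ^ k))"
    unfolding sum_distrib_right by (intro sum.cong) (simp_all add: mult_ac)
  also have "\<dots> = 2 * card U * \<gamma> ^ k" by (simp add: sum_list_weight)
  also have "\<dots> \<le> 2 * 2 ^ n * \<gamma> ^ k"
  proof -
    have "card U \<le> card (Pow {..<n})" unfolding U_def by (intro card_mono) auto
    hence "card U \<le> 2 ^ n" by (simp add: card_Pow)
    hence "real (card U) \<le> real (2 ^ n)" by (simp only: of_nat_le_iff)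
    hence "real (card U) \<le> 2 ^ n" by simp
    thus ?thesis using \<gamma> by (intro mult_right_mono mult_left_mono) auto
  qed
  finally show ?thesis .
qed

subsection \<open>A fixed eigenvalue\<close>

text \<open>The three summands are the three cases, with thresholds \<open>\<theta>\<close> for
  \<open>orth_prob\<close> and \<open>s\<close> for the support. Outside the first two,
  \<open>sparse\<close> makes the additive small ball error at most the main term, hence the 2
  beside \<open>(255 / 256) ^ m\<close>; \<open>indep\<close> is what
  \<open>indep_orth_prob_ge\<close> asks for.\<close>

lemma null_vector_bound:
  fixes m s k n :: nat and \<rho> \<theta> :: real and z :: complex
  defines "\<beta> \<equiv> 1 - \<bar>\<rho>\<bar>"
  assumes \<rho>: "-1 < \<rho>" "\<rho> < 1" and \<theta>: "\<theta> > 0" and s: "s \<le> n" and k: "k \<le> n"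
    and sparse: "(1 - \<beta> / (2 * 4 ^ m)) ^ s \<le> (255 / 256) ^ m * \<theta>"
    and indep: "2 * real k * (1 - \<beta> / (4 * 4 ^ m)) ^ (n - k) \<le> \<theta>"
  shows "(\<Sum>x\<in>sign_mats n. mat_weight \<rho> n x * of_bool (\<exists>v. nonzero_vec n v \<and> annih n z x {..<n} v))
    \<le> n * \<theta> + (real n ^ s)\<^sup>2 * (1 - \<beta> / 2) ^ (n - s) + 2 * 2 ^ n * (2 * (255 / 256) ^ m) ^ k"
proof -
  define \<mu> where "\<mu> = \<beta> / (4 * 4 ^ m)"
  define N where "N = (\<lambda>v. card {j. j < n \<and> v j \<noteq> (0 :: complex)})"
  define G where "G = (\<lambda>v. \<not> orth_prob \<mu> n v < \<theta> \<and> \<not> N v \<le> s)"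
  have \<beta>: "0 < \<beta>" "\<beta> \<le> 1" using \<rho> by (auto simp: \<beta>_def)
  have m4: "\<beta> \<le> 4 ^ m" by (rule order.trans[OF \<beta>(2)]) simp
  have \<mu>: "0 \<le> \<mu>" "\<mu> \<le> 1 / 2" using \<beta> m4 unfolding \<mu>_def by (auto simp: field_simps)
  have law: "sign_prob n q v a \<le> orth_prob \<mu> n v"
    "sign_prob n q v a \<le> (255 / 256) ^ m * orth_prob \<mu> n v + (1 - \<beta> / (2 * 4 ^ m)) ^ N v"
    if "sign_law \<beta> n q" for q v a
    using sign_prob_le_orth_prob[of n q \<beta> v a m] that \<beta> by (auto simp: sign_law_def \<mu>_def N_def)
  let ?P = "\<lambda>x E. mat_weight \<rho> n x * (of_bool E :: real)"
  let ?D = "\<lambda>x v. nonzero_vec n v \<and> annih n z x {..<n} v"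
  have 1: "(\<Sum>x\<in>sign_mats n. ?P x (\<exists>v. nonzero_vec n v \<and> annih n z x {..<n} v \<and> orth_prob \<mu> n v < \<theta>)) \<le> n * \<theta>"
  proof (rule dependent_row_bound[OF \<rho>])
    show "sign_prob n q v a \<le> \<theta>" if "orth_prob \<mu> n v < \<theta>" "sign_law (1 - \<bar>\<rho>\<bar>) n q" for v q a
      using law(1)[of q v a] that by (simp add: \<beta>_def)
  qed (use \<theta> in auto)
  have 2: "(\<Sum>x\<in>sign_mats n. ?P x (\<exists>v. nonzero_vec n v \<and> annih n z x {..<n} v \<and> card {j. j < n \<and> v j \<noteq> 0} \<le> s))
    \<le> (real n ^ s)\<^sup>2 * (1 - \<beta> / 2) ^ (n - s)"
  proof (rule sparse_null_vector_bound[OF \<rho> s])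
    show "sign_prob n q v a \<le> 1 - \<beta> / 2" if "nonzero_vec n v" "sign_law (1 - \<bar>\<rho>\<bar>) n q" for v q a
      using that sign_prob_le_one_minus[of n q \<beta> _ v a] \<beta> by (auto simp: nonzero_vec_def sign_law_def \<beta>_def[symmetric])
  qed (use \<beta> in auto)
  have 3: "(\<Sum>x\<in>sign_mats n. ?P x ((\<exists>v. nonzero_vec n v \<and> annih n z x {..<n} v)
      \<and> (\<forall>v. nonzero_vec n v \<and> annih n z x {..<n} v \<longrightarrow> G v)))
    \<le> 2 * 2 ^ n * (2 * (255 / 256) ^ m) ^ k"
  proof (rule structured_null_vector_bound[OF \<rho> k _ \<mu>])
    show "orth_prob \<mu> n v > 0 \<and> 2 * real k * (1 - \<mu>) ^ (n - k) \<le> orth_prob \<mu> n v" if "G v" for v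
      using that \<theta> indep by (auto simp: G_def \<mu>_def)
    show "sign_prob n q v a \<le> 2 * (255 / 256) ^ m * orth_prob \<mu> n v"
      if "G v" "sign_law (1 - \<bar>\<rho>\<bar>) n q" for v q a
    proof -
      have "(1 - \<beta> / (2 * 4 ^ m)) ^ N v \<le> (1 - \<beta> / (2 * 4 ^ m)) ^ s"
        using that(1) \<beta> m4 by (intro power_decreasing) (auto simp: G_def field_simps)
      also note sparse
      also have "(255 / 256) ^ m * \<theta> \<le> (255 / 256) ^ m * orth_prob \<mu> n v"
        using that(1) by (simp add: G_def)
      finally show ?thesis using law(2)[of q v a] that(2) by (simp add: \<beta>_def)
    qed
  qed simp
  have "(\<Sum>x\<in>sign_mats n. ?P x (\<exists>v. ?D x v))
    \<le> (\<Sum>x\<in>sign_mats n. ?P x (\<exists>v. nonzero_vec n v \<and> annih n z x {..<n} v \<and> orth_prob \<mu> n v < \<theta>)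
      + ?P x (\<exists>v. nonzero_vec n v \<and> annih n z x {..<n} v \<and> card {j. j < n \<and> v j \<noteq> 0} \<le> s)
      + ?P x ((\<exists>v. ?D x v) \<and> (\<forall>v. ?D x v \<longrightarrow> G v)))"
  proof (rule sum_mono)
    fix x assume x: "x \<in> sign_mats n"
    have "(of_bool (\<exists>v. ?D x v) :: real) \<le> of_bool (\<exists>v. nonzero_vec n v \<and> annih n z x {..<n} v \<and> orth_prob \<mu> n v < \<theta>)
      + of_bool (\<exists>v. nonzero_vec n v \<and> annih n z x {..<n} v \<and> card {j. j < n \<and> v j \<noteq> 0} \<le> s)
      + of_bool ((\<exists>v. ?D x v) \<and> (\<forall>v. ?D x v \<longrightarrow> G v))" (is "_ \<le> ?r")
    proof (cases "\<exists>v. ?D x v")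
      case True
      then consider "\<exists>v. nonzero_vec n v \<and> annih n z x {..<n} v \<and> orth_prob \<mu> n v < \<theta>"
        | "\<exists>v. nonzero_vec n v \<and> annih n z x {..<n} v \<and> card {j. j < n \<and> v j \<noteq> 0} \<le> s"
        | "(\<exists>v. ?D x v) \<and> (\<forall>v. ?D x v \<longrightarrow> G v)"
        unfolding G_def N_def by blast
      hence "?r \<ge> 1"
      proof cases
        case 1
        thus ?thesis by (simp only: of_bool_eq) (simp only: of_bool_def split: if_split, simp)
      next
        case 2
        thus ?thesis by (simp only: of_bool_eq) (simp only: of_bool_def split: if_split, simp)
      next
        case 3
        thus ?thesis by (simp only: of_bool_eq) (simp only: of_bool_def split: if_split, simp)
      qed
      thus ?thesis by (rule order.trans[rotated]) simp
    next
      case False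
      thus ?thesis by (simp only: of_bool_eq) (simp only: of_bool_def split: if_split, simp)
    qed
    from mult_left_mono[OF this mat_weight_nonneg[OF x \<rho>]]
    show "?P x (\<exists>v. ?D x v) \<le> ?P x (\<exists>v. nonzero_vec n v \<and> annih n z x {..<n} v \<and> orth_prob \<mu> n v < \<theta>)
      + ?P x (\<exists>v. nonzero_vec n v \<and> annih n z x {..<n} v \<and> card {j. j < n \<and> v j \<noteq> 0} \<le> s)
      + ?P x ((\<exists>v. ?D x v) \<and> (\<forall>v. ?D x v \<longrightarrow> G v))" by (simp only: distrib_left)
  qed
  also have "\<dots> \<le> n * \<theta> + (real n ^ s)\<^sup>2 * (1 - \<beta> / 2) ^ (n - s) + 2 * 2 ^ n * (2 * (255 / 256) ^ m) ^ k"
    unfolding sum.distrib by (intro add_mono 1 2 3)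
  finally show ?thesis .
qed

lemma real_power_le_powr_of_le:
  fixes c r :: real
  assumes "0 < c" "c \<le> 1" "r \<le> real s"
  shows "c ^ s \<le> c powr r"
  using assms by (simp add: powr_realpow[symmetric] powr_mono')

text \<open>The bound is uniform in \<open>z\<close>, because the set of candidate eigenvalues will
  depend on \<open>n\<close>.\<close>

lemma eventually_null_vector_bound:
  fixes \<rho> B :: real
  assumes \<rho>: "-1 < \<rho>" "\<rho> < 1"
  shows "\<forall>\<^sub>F n in sequentially. \<forall>z.
    (\<Sum>x\<in>sign_mats n. mat_weight \<rho> n x * of_bool (\<exists>v. nonzero_vec n v \<and> annih n z x {..<n} v)) \<le> real n powr (- B)"
proof -
  define \<beta> where "\<beta> = 1 - \<bar>\<rho>\<bar>"
  have \<beta>: "0 < \<beta>" "\<beta> \<le> 1" using \<rho> by (auto simp: \<beta>_def)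
  \<comment> \<open>This makes \<open>2 * (255 / 256) ^ m\<close> at most \<open>1 / 16\<close>; its
    power \<open>n div 2\<close> is of order \<open>4 ^ (- n)\<close> and beats the
    \<open>2 ^ n\<close> choices of rows.\<close>
  obtain m where m: "(255 / 256 :: real) ^ m < 1 / 32"
    using real_arch_pow_inv[of "1 / 32" "255 / 256"] by auto
  define d :: real where "d = (255 / 256) ^ m"
  define a1 where "a1 = - ln (1 - \<beta> / (2 * 4 ^ m))"
  define a2 where "a2 = - ln (1 - \<beta> / (4 * 4 ^ m))"
  define a3 where "a3 = - ln (1 - \<beta> / 2)"
  have d: "d > 0" "d < 1 / 32" using m by (auto simp: d_def)
  have m4: "\<beta> \<le> 4 ^ m" by (rule order.trans[OF \<beta>(2)]) simp
  have base: "0 < 1 - \<beta> / (2 * 4 ^ m)" "1 - \<beta> / (2 * 4 ^ m) < 1"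
    "0 < 1 - \<beta> / (4 * 4 ^ m)" "1 - \<beta> / (4 * 4 ^ m) < 1" "0 < 1 - \<beta> / 2" "1 - \<beta> / 2 < 1"
    using \<beta> m4 by (auto simp: field_simps)
  have a: "a1 > 0" "a2 > 0" "a3 > 0" using base by (auto simp: a1_def a2_def a3_def)
  \<comment> \<open>The union over the dependent row costs one factor \<open>n\<close>; a second one
    absorbs the constant 3.\<close>
  define C where "C = B + 2"
  have "\<forall>\<^sub>F n :: nat in sequentially. exp (- a1 * (sqrt n - 1)) \<le> d * n powr (- C)"
    using a d by real_asymp
  moreover have "\<forall>\<^sub>F n :: nat in sequentially. n * exp (- a2 * (n / 2)) \<le> n powr (- C)"
    using a by real_asymp
  moreover have "\<forall>\<^sub>F n :: nat in sequentially. n powr (2 * sqrt n) * exp (- a3 * (n - sqrt n)) \<le> n powr (- B) / 3"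
    using a by real_asymp
  moreover have "\<forall>\<^sub>F n :: nat in sequentially. 8 * (1 / 2) ^ n \<le> n powr (- B) / 3"
    by real_asymp
  moreover have "\<forall>\<^sub>F n :: nat in sequentially. n * n powr (- C) \<le> n powr (- B) / 3"
    unfolding C_def by real_asymp
  moreover have "\<forall>\<^sub>F n :: nat in sequentially. n \<ge> 1" by (rule eventually_ge_at_top)
  ultimately show ?thesis
  proof eventually_elim
    case (elim n)
    \<comment> \<open>Any size well between \<open>log n\<close> and \<open>n / log n\<close> works:
      the additive small ball error must beat a power of \<open>n\<close>, while
      \<open>n ^ (2 * s)\<close> must lose against an exponential in \<open>n\<close>.\<close>
    define s where "s = nat \<lfloor>sqrt n\<rfloor>"
    define k where "k = n div 2"
    define \<theta> where "\<theta> = n powr (- C)"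
    have s: "real s \<le> sqrt n" "sqrt n - 1 \<le> real s" by (auto simp: s_def)
    have sn: "s \<le> n"
    proof -
      have "sqrt n \<le> n" using elim(6) by (intro real_le_lsqrt) (auto simp: power2_eq_square)
      thus ?thesis using s by linarith
    qed
    have kn: "k \<le> n" "n / 2 \<le> real (n - k)" by (auto simp: k_def)
    have \<theta>: "\<theta> > 0" using elim(6) by (simp add: \<theta>_def)
    have "(1 - \<beta> / (2 * 4 ^ m)) ^ s \<le> (1 - \<beta> / (2 * 4 ^ m)) powr (sqrt n - 1)"
      using base s by (intro real_power_le_powr_of_le) auto
    also have "\<dots> = exp (- a1 * (sqrt n - 1))" using base by (simp add: powr_def a1_def)
    finally have sparse: "(1 - \<beta> / (2 * 4 ^ m)) ^ s \<le> (255 / 256) ^ m * \<theta>"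
      using elim(1) by (simp add: d_def \<theta>_def)
    have "2 * real k * (1 - \<beta> / (4 * 4 ^ m)) ^ (n - k) \<le> n * (1 - \<beta> / (4 * 4 ^ m)) powr (n / 2)"
      using base kn by (intro mult_mono real_power_le_powr_of_le) (auto simp: k_def)
    also have "\<dots> = n * exp (- a2 * (n / 2))" using base by (simp add: powr_def a2_def)
    finally have indep: "2 * real k * (1 - \<beta> / (4 * 4 ^ m)) ^ (n - k) \<le> \<theta>"
      using elim(2) by (simp add: \<theta>_def)
    have t2: "(real n ^ s)\<^sup>2 * (1 - \<beta> / 2) ^ (n - s) \<le> n powr (- B) / 3"
    proof -
      have "(real n ^ s)\<^sup>2 = n powr (2 * real s)"
        using elim(6) by (simp add: powr_realpow[symmetric] powr_powr power2_eq_square powr_add[symmetric])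
      also have "\<dots> \<le> n powr (2 * sqrt n)" using elim(6) s by (intro powr_mono) auto
      finally have "(real n ^ s)\<^sup>2 \<le> n powr (2 * sqrt n)" .
      moreover have "(1 - \<beta> / 2) ^ (n - s) \<le> (1 - \<beta> / 2) powr (n - sqrt n)"
        using base s sn by (intro real_power_le_powr_of_le) auto
      moreover have "(1 - \<beta> / 2) powr (n - sqrt n) = exp (- a3 * (n - sqrt n))"
        using base by (simp add: powr_def a3_def)
      ultimately have "(real n ^ s)\<^sup>2 * (1 - \<beta> / 2) ^ (n - s) \<le> n powr (2 * sqrt n) * exp (- a3 * (n - sqrt n))"
        using base by (intro mult_mono) auto
      thus ?thesis using elim(3) by linarith
    qed
    have t3: "2 * 2 ^ n * (2 * (255 / 256) ^ m) ^ k \<le> n powr (- B) / 3"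
    proof -
      have "(2 * (255 / 256) ^ m :: real) ^ k \<le> (1 / 16) ^ k" using m by (intro power_mono) auto
      also have "\<dots> = (1 / 4) ^ (2 * k)" by (simp add: power_mult power2_eq_square)
      \<comment> \<open>For odd \<open>n\<close> the rounding in \<open>n div 2\<close> loses one
        factor, which becomes the 4 below.\<close>
      also have "\<dots> \<le> (1 / 4) ^ (n - 1)" by (intro power_decreasing) (auto simp: k_def)
      also have "\<dots> = 4 * (1 / 4) ^ n" using elim(6) by (cases n) auto
      finally have "2 * 2 ^ n * (2 * (255 / 256) ^ m :: real) ^ k \<le> 2 * 2 ^ n * (4 * (1 / 4) ^ n)"
        by (intro mult_left_mono) auto
      also have "\<dots> = 8 * (2 ^ n * (1 / 4) ^ n)" by simp
      also have "2 ^ n * (1 / 4 :: real) ^ n = (1 / 2) ^ n" by (simp add: power_mult_distrib[symmetric])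
      finally show ?thesis using elim(4) by linarith
    qed
    show ?case
    proof
      fix z
      have "(\<Sum>x\<in>sign_mats n. mat_weight \<rho> n x * of_bool (\<exists>v. nonzero_vec n v \<and> annih n z x {..<n} v))
        \<le> n * \<theta> + (real n ^ s)\<^sup>2 * (1 - \<beta> / 2) ^ (n - s) + 2 * 2 ^ n * (2 * (255 / 256) ^ m) ^ k"
        unfolding \<beta>_def
        by (rule null_vector_bound[OF \<rho> \<theta> sn kn(1) sparse[unfolded \<beta>_def] indep[unfolded \<beta>_def]])
      also have "\<dots> \<le> n powr (- B) / 3 + n powr (- B) / 3 + n powr (- B) / 3"
        using elim(5) t2 t3 unfolding \<theta>_def by (intro add_mono)
      finally show "(\<Sum>x\<in>sign_mats n. mat_weight \<rho> n x * of_bool (\<exists>v. nonzero_vec n v \<and> annih n z x {..<n} v))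
        \<le> n powr (- B)" by simp
    qed
  qed
qed

subsection \<open>Algebraic eigenvalues\<close>

text \<open>Multiplying by a factor \<open>[:- r, 1:]\<close> with \<open>cmod r \<le> R\<close>
  enlarges the coefficients at most \<open>1 + R\<close> times.\<close>

lemma coeff_le_of_roots:
  fixes p :: "complex poly"
  assumes "lead_coeff p = 1" "\<And>r. poly p r = 0 \<Longrightarrow> cmod r \<le> R" "0 \<le> R"
  shows "cmod (poly.coeff p i) \<le> (1 + R) ^ degree p"
  using assms(1,2)
proof (induction "degree p" arbitrary: p i)
  case 0
  hence "poly.coeff p i = (if i = 0 then 1 else 0)" by (simp add: coeff_eq_0)
  thus ?case using 0 by (metis norm_one norm_zero power_0 order_refl zero_le_one)
next
  case (Suc d)
  obtain rs where rs: "Polynomial.smult (lead_coeff p) (\<Prod>a\<leftarrow>rs. [:- a, 1:]) = p" "length rs = degree p"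
    using fundamental_theorem_algebra_factorized[of p] by blast
  obtain r rs' where "rs = r # rs'" using rs(2) Suc.hyps(2) by (cases rs) auto
  then obtain q where q: "p = [:- r, 1:] * q" using rs(1) Suc.prems(1) by auto
  hence r: "poly p r = 0" by simp
  have q0: "q \<noteq> 0" using Suc.prems(1) q by auto
  have deg: "degree p = Suc (degree q)" using q0 unfolding q by (subst degree_mult_eq) auto
  have "lead_coeff q = 1" using Suc.prems(1) unfolding q lead_coeff_mult by simp
  hence IH: "cmod (poly.coeff q j) \<le> (1 + R) ^ d" for j
    using Suc.hyps(1)[of q] Suc.hyps(2) deg Suc.prems(2) by (auto simp: q)
  have "poly.coeff p i = (case i of 0 \<Rightarrow> 0 | Suc j \<Rightarrow> poly.coeff q j) - r * poly.coeff q i"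
    by (simp add: q coeff_pCons split: nat.split)
  hence "cmod (poly.coeff p i) \<le> cmod (case i of 0 \<Rightarrow> 0 | Suc j \<Rightarrow> poly.coeff q j) + cmod r * cmod (poly.coeff q i)"
    by (metis norm_mult norm_triangle_ineq4)
  also have "\<dots> \<le> (1 + R) ^ d + R * (1 + R) ^ d"
    using IH Suc.prems(2)[OF r] assms(3) by (intro add_mono mult_mono) (auto split: nat.split)
  also have "\<dots> = (1 + R) ^ degree p" using Suc.hyps(2)[symmetric] by (simp add: algebra_simps)
  finally show ?case .
qed

text \<open>Gauss's lemma: the minimal polynomial divides \<open>c\<close> over the rationals, and
  its primitive integer multiple \<open>f\<close> still divides \<open>c\<close> over the
  integers.\<close>

lemma min_poly_divides_monic_int:
  fixes c :: "int poly"
  assumes "algebraic z" "lead_coeff c = 1" "poly (map_poly of_int c) z = 0"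
  shows "\<exists>f :: int poly. lead_coeff f = 1 \<and> degree f = alg_degree z \<and> poly (map_poly of_int f) z = 0
    \<and> map_poly of_int f dvd (map_poly of_int c :: complex poly)"
proof -
  define p where "p = min_poly_rat z"
  have "is_min_poly_rat p z" unfolding p_def min_poly_rat_def by (rule theI'[OF ex1_min_poly_rat[OF assms(1)]])
  hence p: "lead_coeff p = 1" "poly (map_poly of_rat p) z = 0"
    "\<And>q. q \<noteq> 0 \<Longrightarrow> poly (map_poly of_rat q) z = 0 \<Longrightarrow> degree p \<le> degree q"
    unfolding is_min_poly_rat_def by blast+
  have rat_int: "map_poly of_rat (map_poly of_int g :: rat poly) = (map_poly of_int g :: complex poly)" for g
    by (rule poly_eqI) (simp add: coeff_map_poly)
  define C where "C = (map_poly of_int c :: rat poly)"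
  have p0: "p \<noteq> 0" using p(1) by auto
  have Cz: "poly (map_poly of_rat C) z = 0" using assms(3) by (simp add: C_def rat_int)
  interpret rat: map_poly_comm_ring_hom "of_rat :: rat \<Rightarrow> complex" ..
  have "C mod p = 0"
  proof (rule ccontr)
    assume nz: "C mod p \<noteq> 0"
    have "map_poly of_rat C = map_poly of_rat (C div p) * map_poly of_rat p + (map_poly of_rat (C mod p) :: complex poly)"
      by (simp add: rat.hom_add[symmetric] rat.hom_mult[symmetric])
    hence "poly (map_poly of_rat (C mod p)) z = 0" using Cz p(2) by simp
    hence "degree p \<le> degree (C mod p)" using p(3) nz by blast
    thus False using degree_mod_less[OF p0, of C] nz by simp
  qed
  then obtain h where h: "C = p * h" by (meson dvdE mod_0_imp_dvd)
  obtain r f where rf: "rat_to_normalized_int_poly p = (r, f)" by force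
  have f: "p = Polynomial.smult r (map_poly of_int f)" "r > 0" using rat_to_normalized_int_poly[OF rf] by auto
  obtain g where g: "c = f * Polynomial.smult (content c) g"
    using rat_to_int_factor_explicit[OF h[unfolded C_def] rf] by blast
  \<comment> \<open>As \<open>c\<close> is monic, \<open>f\<close> has leading coefficient
    \<open>1\<close> or \<open>-1\<close>; positivity of \<open>r\<close> excludes \<open>-1\<close>
    and forces \<open>r = 1\<close>, so the minimal polynomial is integral itself.\<close>
  have "lead_coeff f * lead_coeff (Polynomial.smult (content c) g) = 1"
    using assms(2) g by (metis lead_coeff_mult)
  hence unit: "lead_coeff f = 1 \<or> lead_coeff f = -1" using zmult_eq_1_iff by blast
  have "lead_coeff (Polynomial.smult r (map_poly of_int f)) = r * of_int (lead_coeff f)"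
    using f(2) by simp
  hence lead: "r * of_int (lead_coeff f) = 1" unfolding f(1)[symmetric] using p(1) by simp
  hence lf: "lead_coeff f = 1" using unit f(2) by auto
  hence "r = 1" using lead by simp
  hence pf: "p = map_poly of_int f" using f(1) by simp
  have "degree f = alg_degree z" using pf by (simp add: alg_degree_def p_def[symmetric])
  moreover have "poly (map_poly of_int f) z = 0" using p(2) by (simp add: pf rat_int)
  moreover have "map_poly of_int c = map_poly of_int f * (map_poly of_int (Polynomial.smult (content c) g) :: complex poly)"
    using g by (metis of_int_poly_hom.hom_mult)
  ultimately show ?thesis using lf by (intro exI[of _ f]) auto
qed

lemma eigenvalue_null_vector:
  assumes "eigenvalue (map_mat of_int (mat n n (\<lambda>(i, j). x i j))) z"
  shows "\<exists>v. nonzero_vec n v \<and> annih n z x {..<n} v"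
proof -
  obtain u where u: "u \<in> carrier_vec n" "u \<noteq> 0\<^sub>v n" "map_mat of_int (mat n n (\<lambda>(i, j). x i j)) *\<^sub>v u = z \<cdot>\<^sub>v u"
    using assms unfolding eigenvalue_def eigenvector_def by auto
  have "nonzero_vec n (($) u)" using u(1,2) by (auto simp: nonzero_vec_def vec_eq_iff)
  moreover have "dot n (row_vec n z x i) (($) u) = 0" if "i < n" for i
  proof -
    have "(map_mat of_int (mat n n (\<lambda>(i, j). x i j)) *\<^sub>v u) $ i = (z \<cdot>\<^sub>v u) $ i" by (simp only: u(3))
    thus ?thesis using that u(1) by (simp add: dot_row_vec scalar_prod_def atLeast0LessThan)
  qed
  ultimately show ?thesis by (intro exI[of _ "($) u"]) (auto simp: annih_def)
qed

text \<open>Read the eigenvalue equation at a coordinate where \<open>v\<close> has largest modulus;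
  all matrix entries have modulus 1.\<close>

lemma null_vector_eigenvalue_bound:
  assumes x: "x \<in> sign_mats n" and v: "nonzero_vec n v" "annih n z x {..<n} v"
  shows "cmod z \<le> n"
proof -
  define m where "m = Max ((\<lambda>i. cmod (v i)) ` {..<n})"
  have n: "{..<n} \<noteq> {}" using v(1) by (auto simp: nonzero_vec_def)
  hence "m \<in> (\<lambda>i. cmod (v i)) ` {..<n}" unfolding m_def by (intro Max_in) auto
  then obtain i where i: "i < n" "m = cmod (v i)" by auto
  have le: "cmod (v j) \<le> m" if "j < n" for j unfolding m_def using that by (intro Max_ge) auto
  have m: "m > 0" using v(1) le by (metis nonzero_vec_def less_le_trans zero_less_norm_iff)
  have xv: "cmod (of_int (x i j)) = 1" if "j < n" for j
  proof -
    have "x i j \<in> {1, - 1}" using x i(1) that unfolding sign_mats_def by (auto simp: PiE_iff)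
    thus ?thesis by auto
  qed
  have "z * v i = (\<Sum>j<n. of_int (x i j) * v j)"
    using v(2) i(1) by (simp add: annih_def dot_row_vec)
  hence "cmod z * m = cmod (\<Sum>j<n. of_int (x i j) * v j)" by (simp add: i(2) norm_mult[symmetric])
  also have "\<dots> \<le> (\<Sum>j<n. m)"
  proof (rule sum_norm_le)
    fix j assume "j \<in> {..<n}"
    thus "cmod (of_int (x i j) * v j) \<le> m" unfolding norm_mult using xv[of j] le[of j] by simp
  qed
  finally show ?thesis using m by simp
qed

section \<open>Counting the candidate eigenvalues\<close>

definition bounded_polys :: "nat \<Rightarrow> nat \<Rightarrow> int poly set" where
  "bounded_polys K M = {f. f \<noteq> 0 \<and> degree f \<le> K \<and> (\<forall>i. \<bar>poly.coeff f i\<bar> \<le> int M)}"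

definition bounded_algebraic :: "nat \<Rightarrow> nat \<Rightarrow> complex set" where
  "bounded_algebraic K M = (\<Union>f\<in>bounded_polys K M. {z. poly (map_poly of_int f) z = 0})"

lemma bounded_polys_card: "finite (bounded_polys K M)" "card (bounded_polys K M) \<le> (2 * M + 1) ^ (K + 1)"
proof -
  define A where "A = {..K} \<rightarrow>\<^sub>E {- int M..int M}"
  have finA: "finite A" unfolding A_def by (intro finite_PiE) auto
  have "inj_on (\<lambda>f. restrict (poly.coeff f) {..K}) (bounded_polys K M)"
  proof (rule inj_onI)
    fix f g assume fg: "f \<in> bounded_polys K M" "g \<in> bounded_polys K M"
      "restrict (poly.coeff f) {..K} = restrict (poly.coeff g) {..K}"
    show "f = g"
    proof (rule poly_eqI)
      fix i
      show "poly.coeff f i = poly.coeff g i"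
        using fun_cong[OF fg(3), of i] fg(1,2)
        by (cases "i \<le> K") (auto simp: bounded_polys_def coeff_eq_0)
    qed
  qed
  moreover have "(\<lambda>f. restrict (poly.coeff f) {..K}) ` bounded_polys K M \<subseteq> A"
    unfolding A_def bounded_polys_def by (auto simp: abs_le_iff minus_le_iff)
  ultimately show "finite (bounded_polys K M)" "card (bounded_polys K M) \<le> (2 * M + 1) ^ (K + 1)"
    using inj_on_finite[of _ "bounded_polys K M" A] card_inj_on_le[of _ "bounded_polys K M" A] finA
    by (auto simp: A_def card_PiE nat_add_distrib nat_mult_distrib)
qed

lemma bounded_algebraic_card:
  "finite (bounded_algebraic K M)" "card (bounded_algebraic K M) \<le> (2 * M + 1) ^ (K + 1) * K"
proof -
  have roots: "finite {z. poly (map_poly of_int f :: complex poly) z = 0}"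
    "card {z. poly (map_poly of_int f :: complex poly) z = 0} \<le> K" if "f \<in> bounded_polys K M" for f
  proof -
    have nz: "(map_poly of_int f :: complex poly) \<noteq> 0" using that by (simp add: bounded_polys_def)
    show "finite {z. poly (map_poly of_int f :: complex poly) z = 0}" by (rule poly_roots_finite[OF nz])
    have "card {z. poly (map_poly of_int f :: complex poly) z = 0} \<le> degree (map_poly of_int f :: complex poly)"
      by (rule card_poly_roots_bound[OF nz])
    thus "card {z. poly (map_poly of_int f :: complex poly) z = 0} \<le> K" using that by (simp add: bounded_polys_def)
  qed
  show "finite (bounded_algebraic K M)"
    unfolding bounded_algebraic_def using bounded_polys_card(1) roots(1) by blast
  have "card (bounded_algebraic K M) \<le> (\<Sum>f\<in>bounded_polys K M. card {z. poly (map_poly of_int f :: complex poly) z = 0})"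
    unfolding bounded_algebraic_def by (rule card_UN_le[OF bounded_polys_card(1)])
  also have "\<dots> \<le> (\<Sum>f\<in>bounded_polys K M. K)" by (intro sum_mono roots(2))
  also have "\<dots> \<le> (2 * M + 1) ^ (K + 1) * K" using bounded_polys_card(2) by simp
  finally show "card (bounded_algebraic K M) \<le> (2 * M + 1) ^ (K + 1) * K" .
qed

lemma algebraic_eigenvalue_bounded:
  assumes x: "x \<in> sign_mats n" and ev: "eigenvalue (map_mat of_int (mat n n (\<lambda>(i, j). x i j))) z"
    and alg: "algebraic z" "alg_degree z \<le> K"
  shows "z \<in> bounded_algebraic K ((1 + n) ^ K)"
proof -
  define A where "A = mat n n (\<lambda>(i, j). x i j)"
  have A: "A \<in> carrier_mat n n" by (simp add: A_def)
  have A': "map_mat of_int A \<in> carrier_mat n n" using A by simp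
  have char: "char_poly (map_mat of_int A) = (map_poly of_int (char_poly A) :: complex poly)"
    by (rule of_int_hom.char_poly_hom[OF A])
  have monic: "lead_coeff (char_poly A) = 1" using degree_monic_char_poly[OF A] by simp
  have "poly (map_poly of_int (char_poly A)) z = 0"
    using ev unfolding A_def[symmetric] eigenvalue_root_char_poly[OF A'] char .
  then obtain f :: "int poly" where f: "lead_coeff f = 1" "degree f = alg_degree z" "poly (map_poly of_int f) z = 0"
    "map_poly of_int f dvd (map_poly of_int (char_poly A) :: complex poly)"
    using min_poly_divides_monic_int[OF alg(1) monic] by blast
  define F where "F = (map_poly of_int f :: complex poly)"
  have F: "degree F = degree f" "lead_coeff F = 1" using f(1) by (simp_all add: F_def)
  have "cmod r \<le> n" if "poly F r = 0" for r
  proof -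
    have "poly (map_poly of_int (char_poly A)) r = 0" using f(4) that unfolding F_def by (metis dvdE mult_zero_left poly_mult)
    hence "eigenvalue (map_mat of_int A) r" unfolding eigenvalue_root_char_poly[OF A'] char .
    thus ?thesis using eigenvalue_null_vector null_vector_eigenvalue_bound[OF x] unfolding A_def by blast
  qed
  \<comment> \<open>The bound on all conjugates turns into a bound on the integer coefficients,
    which leaves finitely many polynomials.\<close>
  hence "cmod (poly.coeff F i) \<le> (1 + real n) ^ degree F" for i
    by (intro coeff_le_of_roots F) auto
  hence "\<bar>poly.coeff f i\<bar> \<le> int ((1 + n) ^ K)" for i
  proof -
    have "real_of_int \<bar>poly.coeff f i\<bar> = cmod (poly.coeff F i)" by (simp add: F_def coeff_map_poly)
    also have "\<dots> \<le> (1 + real n) ^ degree F" by fact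
    also have "\<dots> \<le> (1 + real n) ^ K" using alg(2) f(2) F(1) by (intro power_increasing) auto
    also have "\<dots> = real_of_int (int ((1 + n) ^ K))" by simp
    finally show ?thesis by (simp only: of_int_le_iff)
  qed
  hence "f \<in> bounded_polys K ((1 + n) ^ K)" using f(1,2) alg(2) by (auto simp: bounded_polys_def)
  thus ?thesis using f(3) by (auto simp: bounded_algebraic_def)
qed

text \<open>All that matters is an exponent depending on \<open>K\<close> alone, so the estimates
  are generous: with \<open>b = 1 + n\<close>, \<open>2 * b ^ K + 1 \<le> b ^ (K + 2)\<close>,
  \<open>K \<le> b\<close> and \<open>b \<le> n\<^sup>2\<close>.\<close>

lemma bounded_algebraic_card_le_powr:
  assumes "K \<le> n" "2 \<le> n"
  shows "real (card (bounded_algebraic K ((1 + n) ^ K))) \<le> n powr real (2 * ((K + 2) * (K + 1) + 1))"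
proof -
  define b where "b = 1 + n"
  define D where "D = (K + 2) * (K + 1) + 1"
  have "card (bounded_algebraic K (b ^ K)) \<le> (2 * b ^ K + 1) ^ (K + 1) * K"
    by (rule bounded_algebraic_card(2))
  also have "\<dots> \<le> (b ^ (K + 2)) ^ (K + 1) * b"
  proof (intro mult_mono power_mono)
    have "4 \<le> b * b" using assms mult_le_mono[of 2 b 2 b] by (simp add: b_def)
    hence "b ^ K * 4 \<le> b ^ K * (b * b)" by (rule mult_le_mono2)
    moreover have "1 \<le> b ^ K" by (simp add: b_def)
    ultimately have "2 * b ^ K + 1 \<le> b ^ K * (b * b)" by linarith
    thus "2 * b ^ K + 1 \<le> b ^ (K + 2)" by (simp add: mult_ac)
  qed (use assms in \<open>auto simp: b_def\<close>)
  also have "\<dots> = b ^ D" by (simp only: D_def power_add power_mult power_one_right)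
  also have "\<dots> \<le> (n ^ 2) ^ D"
  proof (rule power_mono)
    have "1 + n \<le> 2 * n" using assms by simp
    also have "\<dots> \<le> n * n" using assms by (intro mult_right_mono) auto
    finally show "b \<le> n ^ 2" by (simp add: b_def power2_eq_square)
  qed simp
  finally have "card (bounded_algebraic K (b ^ K)) \<le> n ^ (2 * D)" by (simp add: power_mult)
  hence "real (card (bounded_algebraic K (b ^ K))) \<le> real (n ^ (2 * D))" by (simp only: of_nat_le_iff)
  also have "\<dots> = n powr (2 * D)" using assms by (simp add: powr_realpow[symmetric])
  finally show ?thesis by (simp add: b_def D_def)
qed

theorem theorem2p8:
  fixes \<rho> B K :: real
  assumes "-1 < \<rho>" "\<rho> < 1" "B > 0" "K \<ge> 1"
  shows "\<exists>N. \<forall>n\<ge>N.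
    measure_pmf.prob (rademacher_elliptical n \<rho>)
      {A. \<exists>z :: complex. eigenvalue (map_mat of_int A) z \<and> algebraic z \<and> real (alg_degree z) \<le> K}
    \<le> real n powr (- B)"
proof -
  \<comment> \<open>\<open>K\<close> is real but degrees are natural numbers, so the bound may be
    rounded down.\<close>
  define k where "k = nat \<lfloor>K\<rfloor>"
  \<comment> \<open>The exponent of the number of candidates; the estimate for a fixed eigenvalue is
    invoked with \<open>B + E\<close> to pay for the union over them.\<close>
  define E where "E = real (2 * ((k + 2) * (k + 1) + 1))"
  have deg: "alg_degree z \<le> k" if "real (alg_degree z) \<le> K" for z
    using that by (simp add: k_def le_nat_floor)
  have "\<forall>\<^sub>F n in sequentially. n \<ge> max 2 k" by (rule eventually_ge_at_top)
  with eventually_null_vector_bound[OF assms(1,2), of "B + E"]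
  have "\<forall>\<^sub>F n in sequentially. measure_pmf.prob (rademacher_elliptical n \<rho>)
      {A. \<exists>z :: complex. eigenvalue (map_mat of_int A) z \<and> algebraic z \<and> real (alg_degree z) \<le> K}
    \<le> real n powr (- B)"
  proof eventually_elim
    case (elim n)
    define Z where "Z = bounded_algebraic k ((1 + n) ^ k)"
    have finZ: "finite Z" unfolding Z_def by (rule bounded_algebraic_card)
    have "measure_pmf.prob (rademacher_elliptical n \<rho>)
        {A. \<exists>z :: complex. eigenvalue (map_mat of_int A) z \<and> algebraic z \<and> real (alg_degree z) \<le> K}
      = (\<Sum>x\<in>sign_mats n. mat_weight \<rho> n x * of_bool (\<exists>z :: complex.
          eigenvalue (map_mat of_int (mat n n (\<lambda>(i, j). x i j))) z \<and> algebraic z \<and> real (alg_degree z) \<le> K))"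
      by (rule prob_rademacher_elliptical_eq[OF assms(1,2)])
    also have "\<dots> \<le> (\<Sum>x\<in>sign_mats n. mat_weight \<rho> n x * (\<Sum>z\<in>Z. of_bool (\<exists>v. nonzero_vec n v \<and> annih n z x {..<n} v)))"
    proof (intro sum_mono mult_left_mono mat_weight_nonneg assms(1,2))
      fix x assume x: "x \<in> sign_mats n"
      show "of_bool (\<exists>z :: complex. eigenvalue (map_mat of_int (mat n n (\<lambda>(i, j). x i j))) z \<and> algebraic z \<and> real (alg_degree z) \<le> K)
        \<le> (\<Sum>z\<in>Z. of_bool (\<exists>v. nonzero_vec n v \<and> annih n z x {..<n} v) :: real)" (is "of_bool ?E \<le> _")
      proof (cases ?E)
        case True
        then obtain z :: complex where z: "eigenvalue (map_mat of_int (mat n n (\<lambda>(i, j). x i j))) z" "algebraic z"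
          "real (alg_degree z) \<le> K" by blast
        have "z \<in> Z" unfolding Z_def by (rule algebraic_eigenvalue_bounded[OF x z(1,2) deg[OF z(3)]])
        moreover have "\<exists>v. nonzero_vec n v \<and> annih n z x {..<n} v" by (rule eigenvalue_null_vector[OF z(1)])
        hence "(1 :: real) = of_bool (\<exists>v. nonzero_vec n v \<and> annih n z x {..<n} v)" by (simp only: of_bool_eq)
        moreover have "of_bool (\<exists>v. nonzero_vec n v \<and> annih n z x {..<n} v)
          \<le> (\<Sum>z\<in>Z. of_bool (\<exists>v. nonzero_vec n v \<and> annih n z x {..<n} v) :: real)"
          using \<open>z \<in> Z\<close> finZ by (intro member_le_sum[where f = "\<lambda>z. of_bool (\<exists>v. nonzero_vec n v \<and> annih n z x {..<n} v)"]) auto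
        ultimately have "1 \<le> (\<Sum>z\<in>Z. of_bool (\<exists>v. nonzero_vec n v \<and> annih n z x {..<n} v) :: real)" by linarith
        thus ?thesis using True by (simp only: of_bool_eq)
      next
        case False
        thus ?thesis by (simp only: of_bool_eq) (intro sum_nonneg, simp)
      qed
    qed
    also have "\<dots> = (\<Sum>z\<in>Z. \<Sum>x\<in>sign_mats n. mat_weight \<rho> n x * of_bool (\<exists>v. nonzero_vec n v \<and> annih n z x {..<n} v))"
      unfolding sum_distrib_left by (rule sum.swap)
    also have "\<dots> \<le> (\<Sum>z\<in>Z. n powr (- (B + E)))" by (intro sum_mono) (use elim(1) in blast)
    also have "\<dots> = card Z * n powr (- (B + E))" by simp
    also have "\<dots> \<le> n powr E * n powr (- (B + E))"
      unfolding Z_def E_def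
      by (rule mult_right_mono[OF bounded_algebraic_card_le_powr]) (use elim(2) in auto)
    also have "\<dots> = n powr (- B)" by (simp add: powr_add[symmetric])
    finally show ?case .
  qed
  thus ?thesis by (simp only: eventually_sequentially)
qed

end
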